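(* A $\mathcal B(\mathcal U)$-valued function $R(z)$ is the transfer function of a dichotomous system if and only if it has a stable representation $$R(z)=\delta+z\gamma_+(I_{\mathcal X_+}-z\alpha_+)^{-1}\beta_++\gamma_-(zI_{\mathcal X_-}-\alpha_-)^{-1}\beta_-\qquad(\ast)$$ with $\alpha_-$ invertible. If $R(z)$ is given by $(\ast)$ with $\alpha_+$ and $\alpha_-$ exponentially stable and $\alpha_-$ invertible, then $R(z)$ is the transfer function of the dichotomous system with state space $\mathcal X_-\dotplus\mathcal X_+$ and $$\begin{bmatrix} A & B \\ C & D \end{bmatrix}:=\left[\begin{array}{cc|c} A_- & 0 & B_- \\ 0 & A_+ & B_+ \\ \hline C_- & C_+ & D \end{array}\right]=\left[\begin{array}{cc|c} \alpha_-^{-1} & 0 & \alpha_-^{-1}\beta_- \\ 0 & \alpha_+ & \beta_+ \\ \hline -\gamma_-\alpha_-^{-1} & \gamma_+ & \delta-\gamma_-\alpha_-^{-1}\beta_- \end{array}\right].$$ In particular, $R(z)$ does not have a pole at $0$. Conversely, if $R(z)$ is the transfer function of a dichotomous system with operators $A,B,C,D$, decomposed with respect to $\mathcal X=\mathcal X_-\dotplus\mathcal X_+$ as $$A=\begin{bmatrix} A_- & 0 \\ 0 & A_+ \end{bmatrix},\quad B=\begin{bmatrix} B_- \\ B_+ \end{bmatrix},\quad C=\begin{bmatrix} C_- & C_+ \end{bmatrix},$$ with $A_-$ invertible and $A_+$, $A_-^{-1}$ exponentially stable, then $R(z)$ is given by $(\ast)$ with $$\delta:=D-C_-A_-^{-1}B_-,\quad\gamma_+:=C_+,\quad\alpha_+:=A_+,\quad\beta_+:=B_+,$$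 $$\gamma_-:=-C_-A_-^{-1},\quad\alpha_-:=A_-^{-1},\quad\beta_-:=A_-^{-1}B_-.$$
   Context: $\mathbb D$ is the open unit disc, $\mathbb T$ the unit circle. $\mathcal B(\mathcal X,\mathcal Y)$ denotes bounded linear operators between Hilbert spaces, $\mathcal B(\mathcal X)=\mathcal B(\mathcal X,\mathcal X)$; "invertible" means boundedly invertible. An operator $T$ is exponentially stable if $\sigma(T)\subset\mathbb D$. $\dotplus$ denotes a direct sum of closed subspaces. A stable representation of a $\mathcal B(\mathcal U)$-valued function $R$ is a formula of the form $(\ast)$, where $\mathcal U,\mathcal X_+,\mathcal X_-$ are complex Hilbert spaces, $\delta\in\mathcal B(\mathcal U)$, $\alpha_\pm\in\mathcal B(\mathcal X_\pm)$, $\beta_\pm\in\mathcal B(\mathcal U,\mathcal X_\pm)$, $\gamma_\pm\in\mathcal B(\mathcal X_\pm,\mathcal U)$, and $\alpha_+$, $\alpha_-$ are both exponentially stable. A dichotomous system is a discrete-time system $x(n+1)=Ax(n)+Bu(n)$, $y(n)=Cx(n)+Du(n)$, $n\ge0$, with $A\in\mathcal B(\mathcal X)$, $B\in\mathcal B(\mathcal U,\mathcal X)$, $C\in\mathcal B(\mathcal X,\mathcal U)$, $D\in\mathcal B(\mathcal U)$, $\mathcal X$ a complex Hilbert space, such that $\sigma(A)\cap\mathbb T=\emptyset$. Its transfer function is $D+zC(I_{\mathcal X}-zA)^{-1}B$. The condition $\sigma(A)\cap\mathbb T=\emptyset$ is equivalent to the existence of a direct sum decomposition $\mathcal X=\mathcal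 X_-\dotplus\mathcal X_+$ with respect to which $A=\begin{bmatrix} A_- & 0 \\ 0 & A_+ \end{bmatrix}$ with $A_-$ invertible and $A_+$, $A_-^{-1}$ exponentially stable; $\mathcal X_+$ and $\mathcal X_-$ are the spectral subspaces of $A$ for $\mathbb D$ and $\mathbb C\setminus\overline{\mathbb D}$, respectively. *)

theory Defs
  imports "HOL-Analysis.Analysis" "HOL-Algebra.Module" "HOL-Algebra.AbelCoset"
begin

section \<open>Complex Hilbert spaces\<close>

text \<open>
  The state space of a system is existentially quantified, so Hilbert spaces are records with an
  explicit carrier set instead of type class instances. A statement that quantifies over
  \<open>'x hilbert\<close> ranges over all Hilbert spaces carried by subsets of the type \<open>'x\<close>; since \<open>'x\<close> is
  arbitrary, no cardinality or dimension is excluded. As always for module records, the ring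
  fields \<open>mult\<close> and \<open>one\<close> of the vector space carry no meaning.
  The inner product is linear in its first argument.
\<close>

record 'a hilbert = "(complex, 'a) module" +
  cinner :: "'a \<Rightarrow> 'a \<Rightarrow> complex"

text \<open>Equal to \<open>ring_of_type_algebra\<close>, whose theory would turn \<open>X\<close> into polynomial syntax.\<close>

definition complex_ring :: "complex ring"
  where "complex_ring = \<lparr>carrier = UNIV, mult = (*), one = 1, zero = 0, add = (+)\<rparr>"

lemma complex_ring_cring: "cring complex_ring"
proof (rule cringI)
  show "abelian_group complex_ring"
    by (rule abelian_groupI)
      (auto simp: complex_ring_def intro: exI[of _ "- x" for x :: complex])
  show "comm_monoid complex_ring"
    by (rule comm_monoidI) (auto simp: complex_ring_def)
qed (auto simp: complex_ring_def algebra_simps)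

definition hnorm :: "'a hilbert \<Rightarrow> 'a \<Rightarrow> real"
  where "hnorm X x = sqrt (Re (cinner X x x))"

text \<open>The locale \<open>Metric_space\<close> demands non-negativity and symmetry on the whole type,
  hence the value \<open>0\<close> off the carrier.\<close>

definition hdist :: "'a hilbert \<Rightarrow> 'a \<Rightarrow> 'a \<Rightarrow> real"
  where "hdist X x y =
    (if x \<in> carrier X \<and> y \<in> carrier X then hnorm X (x \<ominus>\<^bsub>X\<^esub> y) else 0)"

locale complex_hilbert = module complex_ring X for X :: "'a hilbert" (structure) +
  assumes cinner_add_left:
      "\<lbrakk>x \<in> carrier X; y \<in> carrier X; z \<in> carrier X\<rbrakk>
        \<Longrightarrow> cinner X (x \<oplus> y) z = cinner X x z + cinner X y z"
    and cinner_smult_left: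
      "\<lbrakk>x \<in> carrier X; y \<in> carrier X\<rbrakk> \<Longrightarrow> cinner X (a \<odot> x) y = a * cinner X x y"
    and cinner_commute:
      "\<lbrakk>x \<in> carrier X; y \<in> carrier X\<rbrakk> \<Longrightarrow> cinner X x y = cnj (cinner X y x)"
    and cinner_nonneg: "x \<in> carrier X \<Longrightarrow> 0 \<le> Re (cinner X x x)"
    and cinner_definite: "\<lbrakk>x \<in> carrier X; cinner X x x = 0\<rbrakk> \<Longrightarrow> x = \<zero>"
    and complete: "Metric_space.mcomplete (carrier X) (hdist X)"

lemma (in complex_hilbert) hdist_Metric_space: "Metric_space (carrier X) (hdist X)"
proof -
  have C [simp]: "a \<in> carrier complex_ring" for a
    by (simp add: complex_ring_def)
  note cl [simp] = M.a_closed M.minus_closed smult_closed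
  have add_right: "cinner X z (x \<oplus> y) = cinner X z x + cinner X z y"
    if "x \<in> carrier X" "y \<in> carrier X" "z \<in> carrier X" for x y z
    using that by (metis cinner_add_left cinner_commute cl(1) complex_cnj_add)
  have smult_right: "cinner X y (a \<odot> x) = cnj a * cinner X y x"
    if "x \<in> carrier X" "y \<in> carrier X" for a x y
    using that by (metis C cinner_smult_left cinner_commute cl(3) complex_cnj_mult)
  have real: "cinner X x x = of_real ((hnorm X x)\<^sup>2)" if "x \<in> carrier X" for x
    using that cinner_nonneg[OF that] cinner_commute[OF that that]
    by (simp add: hnorm_def complex_eq_iff)
  have nonneg: "0 \<le> hnorm X x" if "x \<in> carrier X" for x
    using that cinner_nonneg by (simp add: hnorm_def)
  have expand: "(hnorm X (x \<oplus> a \<odot> y))\<^sup>2 =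
      (hnorm X x)\<^sup>2 + 2 * Re (cnj a * cinner X x y) + (cmod a)\<^sup>2 * (hnorm X y)\<^sup>2"
    if "x \<in> carrier X" "y \<in> carrier X" for a x y
  proof -
    have "cinner X (x \<oplus> a \<odot> y) (x \<oplus> a \<odot> y) = cinner X x x + cnj a * cinner X x y
        + a * cinner X y x + a * cnj a * cinner X y y"
      using that by (simp add: cinner_add_left add_right cinner_smult_left smult_right algebra_simps)
    also have "a * cinner X y x = cnj (cnj a * cinner X x y)"
      using that cinner_commute[of y x] by simp
    also have "a * cnj a = of_real ((cmod a)\<^sup>2)"
      by (rule complex_norm_square[symmetric])
    finally have "Re (cinner X (x \<oplus> a \<odot> y) (x \<oplus> a \<odot> y)) = (hnorm X x)\<^sup>2
        + 2 * Re (cnj a * cinner X x y) + (cmod a)\<^sup>2 * (hnorm X y)\<^sup>2"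
      using that by (simp add: real)
    then show ?thesis
      using that real[of "x \<oplus> a \<odot> y"] by simp
  qed
  have norm0: "hnorm X x = 0 \<longleftrightarrow> x = \<zero>" if "x \<in> carrier X" for x
  proof
    show "hnorm X x = 0 \<Longrightarrow> x = \<zero>"
      using real[OF that] cinner_definite[OF that] by simp
    have "cinner X \<zero> \<zero> = 0"
      using cinner_add_left[of \<zero> \<zero> \<zero>] by simp
    then show "x = \<zero> \<Longrightarrow> hnorm X x = 0"
      by (simp add: hnorm_def)
  qed
  have CS: "cmod (cinner X x y) \<le> hnorm X x * hnorm X y"
    if x: "x \<in> carrier X" and y: "y \<in> carrier X" for x y
  proof (cases "hnorm X y = 0")
    case True
    then have "y = \<zero>" using norm0 y by blast
    then have "cinner X x y = 0" using add_right[of \<zero> \<zero> x] x by simp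
    then show ?thesis using nonneg x y by simp
  next
    case False
    define c where "c = cinner X x y"
    define n where "n = (hnorm X y)\<^sup>2"
    have n: "n > 0" using False by (simp add: n_def)
    have r: "Re (cnj (- c / of_real n) * c) = - (cmod c)\<^sup>2 / n"
    proof -
      have "cnj (- c / of_real n) * c = of_real (- (cmod c)\<^sup>2 / n)"
        using complex_norm_square[of c] by (simp add: mult.commute)
      then show ?thesis by (metis Re_complex_of_real)
    qed
    have "0 \<le> (hnorm X x)\<^sup>2 + 2 * (- (cmod c)\<^sup>2 / n) + (cmod (- c / of_real n))\<^sup>2 * n"
      using expand[OF x y, of "- c / of_real n"] r by (metis c_def n_def zero_le_power2)
    also have "(cmod (- c / of_real n))\<^sup>2 * n = (cmod c)\<^sup>2 / n"
      using n by (simp add: norm_divide power2_eq_square)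
    finally have "(cmod c)\<^sup>2 \<le> (hnorm X x)\<^sup>2 * n"
      using n by (simp add: field_simps)
    then have "(cmod c)\<^sup>2 \<le> (hnorm X x * hnorm X y)\<^sup>2"
      by (simp add: n_def power_mult_distrib)
    then show ?thesis
      using nonneg x y by (metis c_def mult_nonneg_nonneg power2_le_imp_le)
  qed
  have one [simp]: "1 \<odot> x = x" if "x \<in> carrier X" for x
    using smult_one[OF that] by (simp add: complex_ring_def)
  have tri: "hnorm X (x \<oplus> y) \<le> hnorm X x + hnorm X y"
    if x: "x \<in> carrier X" and y: "y \<in> carrier X" for x y
  proof -
    have "(hnorm X (x \<oplus> y))\<^sup>2 = (hnorm X x)\<^sup>2 + 2 * Re (cinner X x y) + (hnorm X y)\<^sup>2"
      using expand[OF x y, of 1] y by simp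
    also have "\<dots> \<le> (hnorm X x + hnorm X y)\<^sup>2"
      using CS[OF x y] complex_Re_le_cmod[of "cinner X x y"] by (simp add: power2_sum)
    finally show ?thesis
      using nonneg x y by (meson add_nonneg_nonneg power2_le_imp_le)
  qed
  have minus_one: "(- 1) \<odot> x = \<ominus> x" if "x \<in> carrier X" for x
  proof -
    have "(- 1) \<odot> x \<oplus> x = (- 1) \<odot> x \<oplus> 1 \<odot> x" using that by simp
    also have "\<dots> = ((- 1) + 1) \<odot> x"
      using smult_l_distr[of "- 1" 1 x] that by (simp add: complex_ring_def)
    also have "\<dots> = \<zero>" using smult_l_null[OF that] by (simp add: complex_ring_def)
    finally show ?thesis using that by (metis C M.minus_equality cl(3))
  qed
  have norm_neg: "hnorm X (\<ominus> x) = hnorm X x" if "x \<in> carrier X" for x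
    unfolding minus_one[OF that, symmetric] hnorm_def
    using that by (simp add: cinner_smult_left smult_right)
  show ?thesis
  proof
    fix x y
    show "0 \<le> hdist X x y" by (simp add: hdist_def nonneg)
    show "hdist X x y = hdist X y x"
    proof -
      have "x \<ominus> y = \<ominus> (y \<ominus> x)" if "x \<in> carrier X" "y \<in> carrier X"
        using that by (simp add: M.minus_eq M.minus_add M.a_comm)
      then show ?thesis by (simp add: hdist_def norm_neg)
    qed
    assume "x \<in> carrier X" "y \<in> carrier X"
    then show "hdist X x y = 0 \<longleftrightarrow> x = y"
      using M.minus_equality[of x "\<ominus> y"] by (auto simp: hdist_def norm0 M.minus_eq M.r_neg)
  next
    fix x y z
    assume xyz: "x \<in> carrier X" "y \<in> carrier X" "z \<in> carrier X"
    then have "x \<ominus> z = (x \<ominus> y) \<oplus> (y \<ominus> z)"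
      by (simp add: M.minus_eq M.a_assoc M.r_neg1 M.r_neg2)
    then show "hdist X x z \<le> hdist X x y + hdist X y z"
      using xyz tri[of "x \<ominus> y" "y \<ominus> z"] by (simp add: hdist_def)
  qed
qed

definition closed_subspace :: "'a hilbert \<Rightarrow> 'a set \<Rightarrow> bool"
  where "closed_subspace X S \<longleftrightarrow>
    submodule S complex_ring X \<and> closedin (Metric_space.mtopology (carrier X) (hdist X)) S"

definition subspace_of :: "'a hilbert \<Rightarrow> 'a set \<Rightarrow> 'a hilbert"
  where "subspace_of X S = X\<lparr>carrier := S\<rparr>"

text \<open>\<open>X\<close> is the (not necessarily orthogonal) direct sum of its closed subspaces \<open>S\<close> and \<open>T\<close>.\<close>

definition direct_sum_decomposition :: "'a hilbert \<Rightarrow> 'a set \<Rightarrow> 'a set \<Rightarrow> bool"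
  where "direct_sum_decomposition X S T \<longleftrightarrow>
    closed_subspace X S \<and> closed_subspace X T \<and>
    S \<inter> T = {\<zero>\<^bsub>X\<^esub>} \<and> S <+>\<^bsub>X\<^esub> T = carrier X"

text \<open>The direct sum of two given spaces; the choice of \<open>mult\<close> and \<open>one\<close> is immaterial.\<close>

definition hilbert_sum :: "'a hilbert \<Rightarrow> 'b hilbert \<Rightarrow> ('a \<times> 'b) hilbert"
  where "hilbert_sum X Y = \<lparr>
    carrier = carrier X \<times> carrier Y,
    mult = (\<lambda>_ _. (\<zero>\<^bsub>X\<^esub>, \<zero>\<^bsub>Y\<^esub>)),
    one = (\<zero>\<^bsub>X\<^esub>, \<zero>\<^bsub>Y\<^esub>),
    zero = (\<zero>\<^bsub>X\<^esub>, \<zero>\<^bsub>Y\<^esub>),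
    add = (\<lambda>p q. (fst p \<oplus>\<^bsub>X\<^esub> fst q, snd p \<oplus>\<^bsub>Y\<^esub> snd q)),
    smult = (\<lambda>a p. (a \<odot>\<^bsub>X\<^esub> fst p, a \<odot>\<^bsub>Y\<^esub> snd p)),
    cinner = (\<lambda>p q. cinner X (fst p) (fst q) + cinner Y (snd p) (snd q))\<rparr>"


section \<open>Bounded operators\<close>

text \<open>Operators are extensional functions, so that equality of functions is equality of operators.\<close>

definition bounded_ops :: "'a hilbert \<Rightarrow> 'b hilbert \<Rightarrow> ('a \<Rightarrow> 'b) set"
  where "bounded_ops X Y = {T \<in> carrier X \<rightarrow>\<^sub>E carrier Y.
    (\<forall>x\<in>carrier X. \<forall>y\<in>carrier X. T (x \<oplus>\<^bsub>X\<^esub> y) = T x \<oplus>\<^bsub>Y\<^esub> T y) \<and>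
    (\<forall>a. \<forall>x\<in>carrier X. T (a \<odot>\<^bsub>X\<^esub> x) = a \<odot>\<^bsub>Y\<^esub> T x) \<and>
    (\<exists>K. \<forall>x\<in>carrier X. hnorm Y (T x) \<le> K * hnorm X x)}"

definition op_norm :: "'a hilbert \<Rightarrow> 'b hilbert \<Rightarrow> ('a \<Rightarrow> 'b) \<Rightarrow> real"
  where "op_norm X Y T = (SUP x\<in>{x \<in> carrier X. hnorm X x \<le> 1}. hnorm Y (T x))"

definition op_invertible :: "'a hilbert \<Rightarrow> ('a \<Rightarrow> 'a) \<Rightarrow> bool"
  where "op_invertible X T \<longleftrightarrow> T \<in> bounded_ops X X \<and>
    (\<exists>S\<in>bounded_ops X X. \<forall>x\<in>carrier X. S (T x) = x \<and> T (S x) = x)"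

definition op_inv :: "'a hilbert \<Rightarrow> ('a \<Rightarrow> 'a) \<Rightarrow> 'a \<Rightarrow> 'a"
  where "op_inv X T = (\<lambda>x\<in>carrier X. inv_into (carrier X) T x)"

text \<open>\<open>zI - T\<close> and \<open>I - zT\<close>\<close>

definition scalar_minus_op :: "'a hilbert \<Rightarrow> complex \<Rightarrow> ('a \<Rightarrow> 'a) \<Rightarrow> 'a \<Rightarrow> 'a"
  where "scalar_minus_op X z T = (\<lambda>x\<in>carrier X. (z \<odot>\<^bsub>X\<^esub> x) \<ominus>\<^bsub>X\<^esub> T x)"

definition id_minus_scaled :: "'a hilbert \<Rightarrow> complex \<Rightarrow> ('a \<Rightarrow> 'a) \<Rightarrow> 'a \<Rightarrow> 'a"
  where "id_minus_scaled X z T = (\<lambda>x\<in>carrier X. x \<ominus>\<^bsub>X\<^esub> (z \<odot>\<^bsub>X\<^esub> T x))"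

definition op_spectrum :: "'a hilbert \<Rightarrow> ('a \<Rightarrow> 'a) \<Rightarrow> complex set"
  where "op_spectrum X T = {z. \<not> op_invertible X (scalar_minus_op X z T)}"

definition exponentially_stable :: "'a hilbert \<Rightarrow> ('a \<Rightarrow> 'a) \<Rightarrow> bool"
  where "exponentially_stable X T \<longleftrightarrow> T \<in> bounded_ops X X \<and> op_spectrum X T \<subseteq> ball 0 1"


section \<open>Dichotomous systems and stable representations\<close>

text \<open>
  An operator-valued function is a partial function on the complex plane. The functions given by
  the two formulas are taken on their natural domains, where the occurring operator inverses exist.
\<close>

definition dichotomous_system ::
    "'x hilbert \<Rightarrow> 'u hilbert \<Rightarrow> ('x \<Rightarrow> 'x) \<Rightarrow> ('u \<Rightarrow> 'x) \<Rightarrow> ('x \<Rightarrow> 'u) \<Rightarrow> ('u \<Rightarrow> 'u) \<Rightarrow> bool"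
  where "dichotomous_system X U A B C D \<longleftrightarrow>
    complex_hilbert X \<and> complex_hilbert U \<and>
    A \<in> bounded_ops X X \<and> B \<in> bounded_ops U X \<and> C \<in> bounded_ops X U \<and> D \<in> bounded_ops U U \<and>
    op_spectrum X A \<inter> sphere 0 1 = {}"

definition transfer_function ::
    "'x hilbert \<Rightarrow> 'u hilbert \<Rightarrow> ('x \<Rightarrow> 'x) \<Rightarrow> ('u \<Rightarrow> 'x) \<Rightarrow> ('x \<Rightarrow> 'u) \<Rightarrow> ('u \<Rightarrow> 'u)
      \<Rightarrow> complex \<rightharpoonup> ('u \<Rightarrow> 'u)"
  where "transfer_function X U A B C D = (\<lambda>z.
    if op_invertible X (id_minus_scaled X z A)
    then Some (\<lambda>u\<in>carrier U.
      D u \<oplus>\<^bsub>U\<^esub> (z \<odot>\<^bsub>U\<^esub> C (op_inv X (id_minus_scaled X z A) (B u))))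
    else None)"

definition stable_data ::
    "'u hilbert \<Rightarrow> 'p hilbert \<Rightarrow> 'm hilbert \<Rightarrow> ('u \<Rightarrow> 'u)
      \<Rightarrow> ('p \<Rightarrow> 'u) \<Rightarrow> ('p \<Rightarrow> 'p) \<Rightarrow> ('u \<Rightarrow> 'p) \<Rightarrow> ('m \<Rightarrow> 'u) \<Rightarrow> ('m \<Rightarrow> 'm) \<Rightarrow> ('u \<Rightarrow> 'm) \<Rightarrow> bool"
  where "stable_data U Xp Xm \<delta> \<gamma>p \<alpha>p \<beta>p \<gamma>m \<alpha>m \<beta>m \<longleftrightarrow>
    complex_hilbert U \<and> complex_hilbert Xp \<and> complex_hilbert Xm \<and>
    \<delta> \<in> bounded_ops U U \<and>
    \<gamma>p \<in> bounded_ops Xp U \<and> \<alpha>p \<in> bounded_ops Xp Xp \<and> \<beta>p \<in> bounded_ops U Xp \<and>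
    \<gamma>m \<in> bounded_ops Xm U \<and> \<alpha>m \<in> bounded_ops Xm Xm \<and> \<beta>m \<in> bounded_ops U Xm \<and>
    exponentially_stable Xp \<alpha>p \<and> exponentially_stable Xm \<alpha>m"

definition stable_function ::
    "'u hilbert \<Rightarrow> 'p hilbert \<Rightarrow> 'm hilbert \<Rightarrow> ('u \<Rightarrow> 'u)
      \<Rightarrow> ('p \<Rightarrow> 'u) \<Rightarrow> ('p \<Rightarrow> 'p) \<Rightarrow> ('u \<Rightarrow> 'p) \<Rightarrow> ('m \<Rightarrow> 'u) \<Rightarrow> ('m \<Rightarrow> 'm) \<Rightarrow> ('u \<Rightarrow> 'm)
      \<Rightarrow> complex \<rightharpoonup> ('u \<Rightarrow> 'u)"
  where "stable_function U Xp Xm \<delta> \<gamma>p \<alpha>p \<beta>p \<gamma>m \<alpha>m \<beta>m = (\<lambda>z.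
    if op_invertible Xp (id_minus_scaled Xp z \<alpha>p) \<and> op_invertible Xm (scalar_minus_op Xm z \<alpha>m)
    then Some (\<lambda>u\<in>carrier U.
      \<delta> u \<oplus>\<^bsub>U\<^esub> (z \<odot>\<^bsub>U\<^esub> \<gamma>p (op_inv Xp (id_minus_scaled Xp z \<alpha>p) (\<beta>p u)))
        \<oplus>\<^bsub>U\<^esub> \<gamma>m (op_inv Xm (scalar_minus_op Xm z \<alpha>m) (\<beta>m u)))
    else None)"

definition has_pole :: "'u hilbert \<Rightarrow> (complex \<rightharpoonup> ('u \<Rightarrow> 'u)) \<Rightarrow> complex \<Rightarrow> bool"
  where "has_pole U R a \<longleftrightarrow>
    (\<forall>\<^sub>F z in at a. z \<in> dom R) \<and> (LIM z at a. op_norm U U (the (R z)) :> at_top)"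

text \<open>
  Block form of \<open>A\<close>, \<open>B\<close>, \<open>C\<close> with respect to \<open>X = Sm \<dotplus> Sp\<close>. Boundedness of the blocks is not
  part of the definition, as it follows from boundedness of \<open>A\<close>, \<open>B\<close>, \<open>C\<close>.
\<close>

definition block_decomposition ::
    "'x hilbert \<Rightarrow> 'u hilbert \<Rightarrow> ('x \<Rightarrow> 'x) \<Rightarrow> ('u \<Rightarrow> 'x) \<Rightarrow> ('x \<Rightarrow> 'u) \<Rightarrow> 'x set \<Rightarrow> 'x set
      \<Rightarrow> ('x \<Rightarrow> 'x) \<Rightarrow> ('x \<Rightarrow> 'x) \<Rightarrow> ('u \<Rightarrow> 'x) \<Rightarrow> ('u \<Rightarrow> 'x) \<Rightarrow> ('x \<Rightarrow> 'u) \<Rightarrow> ('x \<Rightarrow> 'u) \<Rightarrow> bool"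
  where "block_decomposition X U A B C Sm Sp Am Ap Bm Bp Cm Cp \<longleftrightarrow>
    Am \<in> Sm \<rightarrow>\<^sub>E Sm \<and> Ap \<in> Sp \<rightarrow>\<^sub>E Sp \<and> (\<forall>x\<in>Sm. A x = Am x) \<and> (\<forall>x\<in>Sp. A x = Ap x) \<and>
    Bm \<in> carrier U \<rightarrow>\<^sub>E Sm \<and> Bp \<in> carrier U \<rightarrow>\<^sub>E Sp \<and>
    (\<forall>u\<in>carrier U. B u = Bm u \<oplus>\<^bsub>X\<^esub> Bp u) \<and>
    Cm = restrict C Sm \<and> Cp = restrict C Sp"

text \<open>Block operators on \<open>hilbert_sum X Y\<close>: diagonal, column and row.\<close>

definition diag_op :: "'a hilbert \<Rightarrow> 'b hilbert \<Rightarrow> ('a \<Rightarrow> 'a) \<Rightarrow> ('b \<Rightarrow> 'b) \<Rightarrow> 'a \<times> 'b \<Rightarrow> 'a \<times> 'b"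
  where "diag_op X Y S T = (\<lambda>p\<in>carrier X \<times> carrier Y. (S (fst p), T (snd p)))"

definition column_op :: "'u hilbert \<Rightarrow> ('u \<Rightarrow> 'a) \<Rightarrow> ('u \<Rightarrow> 'b) \<Rightarrow> 'u \<Rightarrow> 'a \<times> 'b"
  where "column_op U S T = (\<lambda>u\<in>carrier U. (S u, T u))"

definition row_op ::
    "'a hilbert \<Rightarrow> 'b hilbert \<Rightarrow> 'u hilbert \<Rightarrow> ('a \<Rightarrow> 'u) \<Rightarrow> ('b \<Rightarrow> 'u) \<Rightarrow> 'a \<times> 'b \<Rightarrow> 'u"
  where "row_op X Y U S T = (\<lambda>p\<in>carrier X \<times> carrier Y. S (fst p) \<oplus>\<^bsub>U\<^esub> T (snd p))"

end

theory Submission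
  imports Defs "HOL-Real_Asymp.Real_Asymp"
begin

text \<open>
  Passing from a stable representation to a dichotomous system is algebra: since
  \<open>I - z \<alpha>\<^sub>-\<^sup>-\<^sup>1 = - (z I - \<alpha>\<^sub>-) \<alpha>\<^sub>-\<^sup>-\<^sup>1\<close>, the block operators on the direct sum have the right domain of
  invertibility, no spectrum on the circle, and the right transfer function
  (\<open>stable_to_dichotomous\<close>). Near \<open>0\<close> the operators \<open>(I - z A)\<^sup>-\<^sup>1\<close> are bounded, so there is no pole.

  Conversely, a decomposition \<open>X = Sm \<dotplus> Sp\<close> makes the system similar to the one on the external
  direct sum of \<open>Sm\<close> and \<open>Sp\<close>, to which the same algebra applies (\<open>dichotomous_to_stable\<close>). Two
  analytic facts are needed. For the first equivalence a decomposition has to exist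
  (\<open>spectral_decomposition\<close>), and for the block operators and the similarity to be bounded, the
  projection onto \<open>Sp\<close> along \<open>Sm\<close> has to be bounded (\<open>spectral_projection_bounded\<close>).

  Both facts come from one sequence that approximates the Riesz projection of an operator \<open>T\<close> without
  spectrum on the circle, and no operator-valued integral is used. For \<open>N = 2\<^sup>j\<close> the
  operator \<open>S\<^sub>j = (I - T\<^sup>N)\<^sup>-\<^sup>1\<close> is the mean of \<open>(I - e T)\<^sup>-\<^sup>1\<close> over the \<open>N\<close>-th roots of unity \<open>e\<close>. The
  resolvent is bounded and Lipschitz on the circle, so these Riemann sums satisfy
  \<open>\<parallel>S\<^sub>j\<^sub>+\<^sub>1 - S\<^sub>j\<parallel> = O(2\<^sup>-\<^sup>j)\<close> and converge to a bounded operator \<open>P\<close>. The operator \<open>S\<^sub>j\<^sub>+\<^sub>1\<close> is also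
  the product of \<open>(I - T\<^sup>N)\<^sup>-\<^sup>1\<close> and \<open>(I + T\<^sup>N)\<^sup>-\<^sup>1\<close>, which both tend to \<open>P\<close>; hence \<open>P\<close> is idempotent.
  On the range of \<open>P\<close> the operator \<open>(I - v\<^sup>N T\<^sup>N) S\<^sub>j\<close> is close to the identity if \<open>|v| \<le> 1\<close> and \<open>j\<close> is
  large, and this makes its factor \<open>I - v T\<close> invertible there. On the kernel of \<open>P\<close> the same holds for
  \<open>u I - T\<close> with \<open>|u| \<le> 1\<close>. These are the two spectral conditions.

  For an exponentially stable operator \<open>T\<close> the idempotents obtained from \<open>w T\<close> with \<open>|w| \<le> 1\<close> depend
  on \<open>w\<close> in a Lipschitz way. Commuting idempotents at distance less than \<open>1\<close> are equal, so they are all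
  equal to the one for \<open>w = 0\<close>, which is the identity (\<open>P_eq_id\<close>). For a given decomposition this applies
  to \<open>A\<close> on \<open>Sp\<close> and to the inverse of \<open>A\<close> on \<open>Sm\<close>. It follows that the operators \<open>S\<^sub>j\<close> formed from
  \<open>A\<close> tend to the identity on \<open>Sp\<close> and to \<open>0\<close> on \<open>Sm\<close>, so that the projection onto \<open>Sp\<close> along
  \<open>Sm\<close> is the bounded operator \<open>P\<close>.

  The first equivalence speaks of state spaces over one type. The direct sum of two Hilbert spaces over
  this type has a copy over the same type, since a nonzero Hilbert space is infinite and an
  infinite set is equipotent to its square (\<open>hilbert_sum_embeds\<close>).
\<close>

section \<open>Vectors and norms\<close>

lemma complex_ring_simps [simp]:
  "carrier complex_ring = UNIV" "mult complex_ring = (*)" "one complex_ring = 1"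
  "zero complex_ring = 0" "add complex_ring = (+)"
  by (simp_all add: complex_ring_def)

lemma hilbert_module: "complex_hilbert X \<Longrightarrow> module complex_ring X"
  by (simp add: complex_hilbert_def)

lemma hilbert_smult_one: "complex_hilbert X \<Longrightarrow> x \<in> carrier X \<Longrightarrow> 1 \<odot>\<^bsub>X\<^esub> x = x"
  using module.smult_one[OF hilbert_module, of X x] by simp

lemma hilbert_closed:
  assumes "complex_hilbert X"
  shows "\<zero>\<^bsub>X\<^esub> \<in> carrier X"
    and "x \<in> carrier X \<Longrightarrow> y \<in> carrier X \<Longrightarrow> x \<oplus>\<^bsub>X\<^esub> y \<in> carrier X"
    and "x \<in> carrier X \<Longrightarrow> a \<odot>\<^bsub>X\<^esub> x \<in> carrier X"
    and "x \<in> carrier X \<Longrightarrow> \<ominus>\<^bsub>X\<^esub> x \<in> carrier X"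
    and "x \<in> carrier X \<Longrightarrow> y \<in> carrier X \<Longrightarrow> x \<ominus>\<^bsub>X\<^esub> y \<in> carrier X"
proof -
  interpret complex_hilbert X by fact
  show "\<zero>\<^bsub>X\<^esub> \<in> carrier X" by simp
  show "x \<in> carrier X \<Longrightarrow> y \<in> carrier X \<Longrightarrow> x \<oplus>\<^bsub>X\<^esub> y \<in> carrier X" by simp
  show "x \<in> carrier X \<Longrightarrow> a \<odot>\<^bsub>X\<^esub> x \<in> carrier X" by simp
  show "x \<in> carrier X \<Longrightarrow> \<ominus>\<^bsub>X\<^esub> x \<in> carrier X" by simp
  show "x \<in> carrier X \<Longrightarrow> y \<in> carrier X \<Longrightarrow> x \<ominus>\<^bsub>X\<^esub> y \<in> carrier X" by simp
qed

lemma cinner_left: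
  assumes "complex_hilbert X" and z: "z \<in> carrier X"
  shows "cinner X \<zero>\<^bsub>X\<^esub> z = 0"
    and "x \<in> carrier X \<Longrightarrow> y \<in> carrier X \<Longrightarrow> cinner X (x \<oplus>\<^bsub>X\<^esub> y) z = cinner X x z + cinner X y z"
    and "x \<in> carrier X \<Longrightarrow> cinner X (a \<odot>\<^bsub>X\<^esub> x) z = a * cinner X x z"
    and "x \<in> carrier X \<Longrightarrow> cinner X (\<ominus>\<^bsub>X\<^esub> x) z = - cinner X x z"
    and "x \<in> carrier X \<Longrightarrow> y \<in> carrier X \<Longrightarrow> cinner X (x \<ominus>\<^bsub>X\<^esub> y) z = cinner X x z - cinner X y z"
proof -
  interpret complex_hilbert X by fact
  show 0: "cinner X \<zero>\<^bsub>X\<^esub> z = 0"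
    using cinner_add_left[of "\<zero>\<^bsub>X\<^esub>" "\<zero>\<^bsub>X\<^esub>" z] z by simp
  show add: "cinner X (x \<oplus>\<^bsub>X\<^esub> y) z = cinner X x z + cinner X y z"
    if "x \<in> carrier X" "y \<in> carrier X" for x y
    using that z cinner_add_left by blast
  show "x \<in> carrier X \<Longrightarrow> cinner X (a \<odot>\<^bsub>X\<^esub> x) z = a * cinner X x z"
    using z cinner_smult_left by blast
  show neg: "cinner X (\<ominus>\<^bsub>X\<^esub> x) z = - cinner X x z" if "x \<in> carrier X" for x
    using add[of x "\<ominus>\<^bsub>X\<^esub> x"] that 0 by (simp add: M.r_neg add_eq_0_iff)
  show "x \<in> carrier X \<Longrightarrow> y \<in> carrier X \<Longrightarrow> cinner X (x \<ominus>\<^bsub>X\<^esub> y) z = cinner X x z - cinner X y z"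
    by (simp add: M.minus_eq add neg)
qed

text \<open>
  A vector is determined by its inner products. This turns every linear identity between vectors
  into a linear identity between complex numbers.
\<close>

lemma hilbert_eqI:
  assumes H: "complex_hilbert X" and x: "x \<in> carrier X" and y: "y \<in> carrier X"
    and eq: "\<And>z. z \<in> carrier X \<Longrightarrow> cinner X x z = cinner X y z"
  shows "x = y"
proof -
  interpret complex_hilbert X by fact
  have "cinner X (x \<ominus>\<^bsub>X\<^esub> y) (x \<ominus>\<^bsub>X\<^esub> y) = 0"
    using x y by (simp add: cinner_left[OF H] eq)
  then have "x \<ominus>\<^bsub>X\<^esub> y = \<zero>\<^bsub>X\<^esub>" using x y cinner_definite by simp
  then have "x \<oplus>\<^bsub>X\<^esub> (\<ominus>\<^bsub>X\<^esub> y) = \<zero>\<^bsub>X\<^esub>" by (simp add: M.minus_eq)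
  then show ?thesis using M.minus_equality[of x "\<ominus>\<^bsub>X\<^esub> y"] x y by simp
qed

lemma hilbert_eq_if_minus_zero:
  assumes H: "complex_hilbert X" and x: "x \<in> carrier X" and y: "y \<in> carrier X"
    and eq: "x \<ominus>\<^bsub>X\<^esub> y = \<zero>\<^bsub>X\<^esub>"
  shows "x = y"
proof (rule hilbert_eqI[OF H x y])
  fix z assume z: "z \<in> carrier X"
  show "cinner X x z = cinner X y z"
    using cinner_left(1,5)[OF H z] x y eq by (metis eq_iff_diff_eq_0)
qed

lemma hnorm_nonneg:
  assumes "complex_hilbert X" "x \<in> carrier X"
  shows "0 \<le> hnorm X x"
  using assms complex_hilbert.cinner_nonneg[OF assms] by (simp add: hnorm_def)

lemma hnorm_eq_0_iff:
  assumes H: "complex_hilbert X" and x: "x \<in> carrier X"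
  shows "hnorm X x = 0 \<longleftrightarrow> x = \<zero>\<^bsub>X\<^esub>"
proof
  assume "hnorm X x = 0"
  moreover have "Im (cinner X x x) = 0"
    using complex_hilbert.cinner_commute[OF H x x] by (simp add: complex_eq_iff)
  ultimately have "cinner X x x = 0" by (simp add: hnorm_def complex_eq_iff)
  then show "x = \<zero>\<^bsub>X\<^esub>" by (rule complex_hilbert.cinner_definite[OF H x])
next
  assume "x = \<zero>\<^bsub>X\<^esub>"
  then show "hnorm X x = 0" using cinner_left(1)[OF H x] by (simp add: hnorm_def)
qed

lemma hnorm_zero: "complex_hilbert X \<Longrightarrow> hnorm X \<zero>\<^bsub>X\<^esub> = 0"
  by (simp add: hnorm_eq_0_iff hilbert_closed(1))

lemma hnorm_smult:
  assumes H: "complex_hilbert X" and x: "x \<in> carrier X"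
  shows "hnorm X (a \<odot>\<^bsub>X\<^esub> x) = cmod a * hnorm X x"
proof -
  have "cinner X x (a \<odot>\<^bsub>X\<^esub> x) = cnj a * cinner X x x"
    using complex_hilbert.cinner_commute[OF H x hilbert_closed(3)[OF H x], of a]
      complex_hilbert.cinner_commute[OF H x x]
    by (metis cinner_left(3)[OF H x x] complex_cnj_mult)
  then have "cinner X (a \<odot>\<^bsub>X\<^esub> x) (a \<odot>\<^bsub>X\<^esub> x) = (a * cnj a) * cinner X x x"
    by (simp add: cinner_left[OF H] hilbert_closed[OF H] x)
  also have "\<dots> = of_real ((cmod a)\<^sup>2) * cinner X x x"
    by (metis complex_norm_square)
  finally show ?thesis by (simp add: hnorm_def real_sqrt_mult)
qed

lemma hnorm_neg:
  assumes H: "complex_hilbert X" and x: "x \<in> carrier X"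
  shows "hnorm X (\<ominus>\<^bsub>X\<^esub> x) = hnorm X x"
proof -
  have "\<ominus>\<^bsub>X\<^esub> x = (-1) \<odot>\<^bsub>X\<^esub> x"
    by (rule hilbert_eqI[OF H]) (simp_all add: hilbert_closed[OF H] cinner_left[OF H] x)
  then show ?thesis by (simp add: hnorm_smult[OF H x])
qed

lemma hnorm_add:
  assumes H: "complex_hilbert X" and x: "x \<in> carrier X" and y: "y \<in> carrier X"
  shows "hnorm X (x \<oplus>\<^bsub>X\<^esub> y) \<le> hnorm X x + hnorm X y"
proof -
  interpret Metric_space "carrier X" "hdist X"
    by (rule complex_hilbert.hdist_Metric_space[OF H])
  note [simp] = hilbert_closed[OF H] x y
  have 1: "x \<ominus>\<^bsub>X\<^esub> (\<ominus>\<^bsub>X\<^esub> y) = x \<oplus>\<^bsub>X\<^esub> y" "x \<ominus>\<^bsub>X\<^esub> \<zero>\<^bsub>X\<^esub> = x" "\<zero>\<^bsub>X\<^esub> \<ominus>\<^bsub>X\<^esub> (\<ominus>\<^bsub>X\<^esub> y) = y"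
    by (rule hilbert_eqI[OF H]; simp add: cinner_left[OF H])+
  show ?thesis
    using triangle[of x "\<zero>\<^bsub>X\<^esub>" "\<ominus>\<^bsub>X\<^esub> y"] by (simp add: hdist_def 1)
qed

lemma hnorm_minus:
  assumes H: "complex_hilbert X" and x: "x \<in> carrier X" and y: "y \<in> carrier X"
  shows "hnorm X (x \<ominus>\<^bsub>X\<^esub> y) \<le> hnorm X x + hnorm X y"
  using hnorm_add[OF H x hilbert_closed(4)[OF H y]] hnorm_neg[OF H y]
  by (simp add: a_minus_def)

lemma hnorm_minus_commute:
  assumes H: "complex_hilbert X" and x: "x \<in> carrier X" and y: "y \<in> carrier X"
  shows "hnorm X (x \<ominus>\<^bsub>X\<^esub> y) = hnorm X (y \<ominus>\<^bsub>X\<^esub> x)"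
proof -
  have "x \<ominus>\<^bsub>X\<^esub> y = \<ominus>\<^bsub>X\<^esub> (y \<ominus>\<^bsub>X\<^esub> x)"
    by (rule hilbert_eqI[OF H]) (simp_all add: hilbert_closed[OF H] cinner_left[OF H] x y)
  then show ?thesis by (simp add: hnorm_neg[OF H] hilbert_closed[OF H] x y)
qed

lemma hnorm_triangle:
  assumes H: "complex_hilbert X" and x: "x \<in> carrier X" and y: "y \<in> carrier X" and z: "z \<in> carrier X"
  shows "hnorm X (x \<ominus>\<^bsub>X\<^esub> z) \<le> hnorm X (x \<ominus>\<^bsub>X\<^esub> y) + hnorm X (y \<ominus>\<^bsub>X\<^esub> z)"
proof -
  have "x \<ominus>\<^bsub>X\<^esub> z = (x \<ominus>\<^bsub>X\<^esub> y) \<oplus>\<^bsub>X\<^esub> (y \<ominus>\<^bsub>X\<^esub> z)"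
    by (rule hilbert_eqI[OF H]) (simp_all add: hilbert_closed[OF H] cinner_left[OF H] x y z)
  then show ?thesis using hnorm_add[OF H] by (simp add: hilbert_closed[OF H] x y z)
qed

lemma hilbert_eq_if_close:
  assumes H: "complex_hilbert X" and x: "x \<in> carrier X" and y: "y \<in> carrier X"
    and lim: "c \<longlonglongrightarrow> (0::real)" and le: "\<And>k::nat. hnorm X (x \<ominus>\<^bsub>X\<^esub> y) \<le> c k"
  shows "x = y"
proof -
  have "hnorm X (x \<ominus>\<^bsub>X\<^esub> y) \<le> 0"
    using LIMSEQ_le_const[OF lim] le by blast
  then have "x \<ominus>\<^bsub>X\<^esub> y = \<zero>\<^bsub>X\<^esub>"
    using hnorm_nonneg[OF H] hnorm_eq_0_iff[OF H] hilbert_closed(5)[OF H x y] by (metis antisym)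
  then show ?thesis by (rule hilbert_eq_if_minus_zero[OF H x y])
qed

text \<open>
  The only form in which completeness is used: increments that decrease geometrically are summable,
  with an explicit rate of convergence.
\<close>

lemma hilbert_complete_geometric:
  assumes H: "complex_hilbert X" and s: "\<And>k::nat. s k \<in> carrier X"
    and le: "\<And>k. hnorm X (s (Suc k) \<ominus>\<^bsub>X\<^esub> s k) \<le> c / 2 ^ k"
  obtains x where "x \<in> carrier X" "\<And>k. hnorm X (s k \<ominus>\<^bsub>X\<^esub> x) \<le> 2 * c / 2 ^ k"
proof -
  interpret Metric_space "carrier X" "hdist X"
    by (rule complex_hilbert.hdist_Metric_space[OF H])
  note [simp] = hilbert_closed[OF H] s
  have c: "0 \<le> c" using le[of 0] hnorm_nonneg[OF H, of "s (Suc 0) \<ominus>\<^bsub>X\<^esub> s 0"] by simp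
  have step: "hnorm X (s (k + m) \<ominus>\<^bsub>X\<^esub> s k) \<le> 2 * c / 2 ^ k - 2 * c / 2 ^ (k + m)" for k m
  proof (induction m)
    case 0
    have "s k \<ominus>\<^bsub>X\<^esub> s k = \<zero>\<^bsub>X\<^esub>"
      by (rule hilbert_eqI[OF H]) (simp_all add: cinner_left[OF H])
    then show ?case by (simp add: hnorm_zero[OF H])
  next
    case (Suc m)
    have "hnorm X (s (k + Suc m) \<ominus>\<^bsub>X\<^esub> s k)
        \<le> hnorm X (s (Suc (k + m)) \<ominus>\<^bsub>X\<^esub> s (k + m)) + hnorm X (s (k + m) \<ominus>\<^bsub>X\<^esub> s k)"
      using hnorm_triangle[OF H] by simp
    also have "\<dots> \<le> c / 2 ^ (k + m) + (2 * c / 2 ^ k - 2 * c / 2 ^ (k + m))"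
      using le[of "k + m"] Suc.IH by simp
    also have "\<dots> = 2 * c / 2 ^ k - 2 * c / 2 ^ (k + Suc m)" by simp
    finally show ?case .
  qed
  have step': "hnorm X (s k \<ominus>\<^bsub>X\<^esub> s n) \<le> 2 * c / 2 ^ k" if "k \<le> n" for k n
  proof -
    have "hnorm X (s n \<ominus>\<^bsub>X\<^esub> s k) \<le> 2 * c / 2 ^ k"
      using step[of k "n - k"] that c by (smt (verit) divide_nonneg_pos le_add_diff_inverse zero_less_power)
    then show ?thesis using hnorm_minus_commute[OF H] by simp
  qed
  have lim0: "(\<lambda>k. 2 * c / 2 ^ k) \<longlonglongrightarrow> 0" by real_asymp
  have "MCauchy s"
    unfolding MCauchy_def
  proof (intro conjI allI impI)
    show "range s \<subseteq> carrier X" by auto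
    fix e :: real assume "0 < e"
    then obtain N where N: "\<And>k. k \<ge> N \<Longrightarrow> 2 * c / 2 ^ k < e"
      using order_tendstoD(2)[OF lim0] by (auto simp: eventually_sequentially)
    have "hnorm X (s n \<ominus>\<^bsub>X\<^esub> s m) < e" if "N \<le> n" "N \<le> m" for n m
    proof (cases "n \<le> m")
      case True
      then show ?thesis using step'[OF True] N[OF that(1)] by linarith
    next
      case False
      then show ?thesis using step'[of m n] N[OF that(2)] hnorm_minus_commute[OF H, of "s n" "s m"] by simp
    qed
    then show "\<exists>N. \<forall>n n'. N \<le> n \<longrightarrow> N \<le> n' \<longrightarrow> hdist X (s n) (s n') < e"
      by (auto simp: hdist_def)
  qed
  then obtain x where "limitin mtopology s x sequentially"
    using complex_hilbert.complete[OF H] mcomplete_def by blast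
  then have x: "x \<in> carrier X" and lim: "\<And>e. e > 0 \<Longrightarrow> \<exists>N. \<forall>n\<ge>N. hdist X (s n) x < e"
    unfolding limit_metric_sequentially by auto
  have "hnorm X (s k \<ominus>\<^bsub>X\<^esub> x) \<le> 2 * c / 2 ^ k" for k
  proof (rule field_le_epsilon)
    fix e :: real assume "0 < e"
    then obtain N where N: "\<And>n. n \<ge> N \<Longrightarrow> hdist X (s n) x < e" using lim by blast
    define n where "n = max N k"
    have "hnorm X (s n \<ominus>\<^bsub>X\<^esub> x) < e" using N[of n] x by (simp add: hdist_def n_def)
    then show "hnorm X (s k \<ominus>\<^bsub>X\<^esub> x) \<le> 2 * c / 2 ^ k + e"
      using step'[of k n] hnorm_triangle[OF H s s x, of k n] by (simp add: n_def)
  qed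
  then show ?thesis using that x by blast
qed

section \<open>Bounded operators\<close>

lemma bounded_opsI:
  assumes H: "complex_hilbert X"
    and "\<And>x. x \<in> carrier X \<Longrightarrow> T x \<in> carrier Y"
    and "\<And>x y. x \<in> carrier X \<Longrightarrow> y \<in> carrier X \<Longrightarrow> T (x \<oplus>\<^bsub>X\<^esub> y) = T x \<oplus>\<^bsub>Y\<^esub> T y"
    and "\<And>a x. x \<in> carrier X \<Longrightarrow> T (a \<odot>\<^bsub>X\<^esub> x) = a \<odot>\<^bsub>Y\<^esub> T x"
    and "\<And>x. x \<in> carrier X \<Longrightarrow> hnorm Y (T x) \<le> K * hnorm X x"
  shows "(\<lambda>x\<in>carrier X. T x) \<in> bounded_ops X Y"
  using assms(2-) by (auto simp: bounded_ops_def hilbert_closed[OF H] intro!: exI[of _ K])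

lemma bounded_ops_simps:
  assumes T: "T \<in> bounded_ops X Y"
  shows "x \<in> carrier X \<Longrightarrow> T x \<in> carrier Y"
    and "x \<in> carrier X \<Longrightarrow> y \<in> carrier X \<Longrightarrow> T (x \<oplus>\<^bsub>X\<^esub> y) = T x \<oplus>\<^bsub>Y\<^esub> T y"
    and "x \<in> carrier X \<Longrightarrow> T (a \<odot>\<^bsub>X\<^esub> x) = a \<odot>\<^bsub>Y\<^esub> T x"
  using T by (auto simp: bounded_ops_def PiE_iff)

lemma bounded_ops_group:
  assumes T: "T \<in> bounded_ops X Y" and HX: "complex_hilbert X" and HY: "complex_hilbert Y"
  shows "T \<zero>\<^bsub>X\<^esub> = \<zero>\<^bsub>Y\<^esub>"
    and "x \<in> carrier X \<Longrightarrow> T (\<ominus>\<^bsub>X\<^esub> x) = \<ominus>\<^bsub>Y\<^esub> T x"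
    and "x \<in> carrier X \<Longrightarrow> y \<in> carrier X \<Longrightarrow> T (x \<ominus>\<^bsub>X\<^esub> y) = T x \<ominus>\<^bsub>Y\<^esub> T y"
proof -
  note [simp] = hilbert_closed[OF HX] hilbert_closed[OF HY] bounded_ops_simps[OF T]
  have "\<zero>\<^bsub>X\<^esub> = 0 \<odot>\<^bsub>X\<^esub> \<zero>\<^bsub>X\<^esub>"
    by (rule hilbert_eqI[OF HX]) (simp_all add: cinner_left[OF HX])
  then have "T \<zero>\<^bsub>X\<^esub> = 0 \<odot>\<^bsub>Y\<^esub> T \<zero>\<^bsub>X\<^esub>" by (metis bounded_ops_simps(3)[OF T] hilbert_closed(1)[OF HX])
  also have "\<dots> = \<zero>\<^bsub>Y\<^esub>"
    by (rule hilbert_eqI[OF HY]) (simp_all add: cinner_left[OF HY])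
  finally show "T \<zero>\<^bsub>X\<^esub> = \<zero>\<^bsub>Y\<^esub>" .
  show neg: "T (\<ominus>\<^bsub>X\<^esub> x) = \<ominus>\<^bsub>Y\<^esub> T x" if x: "x \<in> carrier X" for x
  proof -
    note [simp] = x
    have "\<ominus>\<^bsub>X\<^esub> x = (-1) \<odot>\<^bsub>X\<^esub> x"
      by (rule hilbert_eqI[OF HX]) (simp_all add: cinner_left[OF HX])
    then have "T (\<ominus>\<^bsub>X\<^esub> x) = (-1) \<odot>\<^bsub>Y\<^esub> T x" by simp
    also have "\<dots> = \<ominus>\<^bsub>Y\<^esub> T x"
      by (rule hilbert_eqI[OF HY]) (simp_all add: cinner_left[OF HY])
    finally show ?thesis .
  qed
  show "x \<in> carrier X \<Longrightarrow> y \<in> carrier X \<Longrightarrow> T (x \<ominus>\<^bsub>X\<^esub> y) = T x \<ominus>\<^bsub>Y\<^esub> T y"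
    by (simp add: a_minus_def neg)
qed

lemma bounded_ops_bound:
  assumes T: "T \<in> bounded_ops X Y" and H: "complex_hilbert X"
  obtains K where "0 < K" "\<And>x. x \<in> carrier X \<Longrightarrow> hnorm Y (T x) \<le> K * hnorm X x"
proof -
  obtain K where K: "\<And>x. x \<in> carrier X \<Longrightarrow> hnorm Y (T x) \<le> K * hnorm X x"
    using T unfolding bounded_ops_def by blast
  have "hnorm Y (T x) \<le> max K 1 * hnorm X x" if "x \<in> carrier X" for x
    using K[OF that] mult_right_mono[of K "max K 1" "hnorm X x"] hnorm_nonneg[OF H that] by simp
  then show ?thesis using that[of "max K 1"] by simp
qed

lemma bounded_ops_ext:
  assumes "S \<in> bounded_ops X Y" "T \<in> bounded_ops X Y" "\<And>x. x \<in> carrier X \<Longrightarrow> S x = T x"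
  shows "S = T"
  using assms by (auto simp: bounded_ops_def intro: PiE_ext)

lemma bounded_ops_compose:
  assumes S: "S \<in> bounded_ops Y Z" and T: "T \<in> bounded_ops X Y"
    and HX: "complex_hilbert X" and HY: "complex_hilbert Y"
  shows "(\<lambda>x\<in>carrier X. S (T x)) \<in> bounded_ops X Z"
proof -
  obtain K where K: "0 < K" "\<And>y. y \<in> carrier Y \<Longrightarrow> hnorm Z (S y) \<le> K * hnorm Y y"
    using bounded_ops_bound[OF S HY] by blast
  obtain L where L: "0 < L" "\<And>x. x \<in> carrier X \<Longrightarrow> hnorm Y (T x) \<le> L * hnorm X x"
    using bounded_ops_bound[OF T HX] by blast
  have "hnorm Z (S (T x)) \<le> (K * L) * hnorm X x" if "x \<in> carrier X" for x
    using K(2)[of "T x"] L(2)[OF that] K(1) that bounded_ops_simps(1)[OF T that]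
    by (smt (verit) mult.assoc mult_left_mono)
  then show ?thesis
    by (intro bounded_opsI[OF HX])
      (simp_all add: bounded_ops_simps[OF S] bounded_ops_simps[OF T])
qed

lemma bounded_ops_lincomb:
  assumes S: "S \<in> bounded_ops X Y" and T: "T \<in> bounded_ops X Y"
    and HX: "complex_hilbert X" and HY: "complex_hilbert Y"
  shows "(\<lambda>x\<in>carrier X. (u \<odot>\<^bsub>Y\<^esub> S x) \<oplus>\<^bsub>Y\<^esub> (v \<odot>\<^bsub>Y\<^esub> T x)) \<in> bounded_ops X Y"
proof -
  note [simp] = hilbert_closed[OF HX] hilbert_closed[OF HY] bounded_ops_simps[OF T] bounded_ops_simps[OF S]
  obtain K where K: "0 < K" "\<And>y. y \<in> carrier X \<Longrightarrow> hnorm Y (S y) \<le> K * hnorm X y"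
    using bounded_ops_bound[OF S HX] by blast
  obtain L where L: "0 < L" "\<And>x. x \<in> carrier X \<Longrightarrow> hnorm Y (T x) \<le> L * hnorm X x"
    using bounded_ops_bound[OF T HX] by blast
  have "hnorm Y ((u \<odot>\<^bsub>Y\<^esub> S x) \<oplus>\<^bsub>Y\<^esub> (v \<odot>\<^bsub>Y\<^esub> T x)) \<le> (cmod u * K + cmod v * L) * hnorm X x"
    if x: "x \<in> carrier X" for x
  proof -
    have "hnorm Y ((u \<odot>\<^bsub>Y\<^esub> S x) \<oplus>\<^bsub>Y\<^esub> (v \<odot>\<^bsub>Y\<^esub> T x)) \<le> cmod u * hnorm Y (S x) + cmod v * hnorm Y (T x)"
      using hnorm_add[OF HY, of "u \<odot>\<^bsub>Y\<^esub> S x" "v \<odot>\<^bsub>Y\<^esub> T x"] x by (simp add: hnorm_smult[OF HY])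
    also have "\<dots> \<le> cmod u * (K * hnorm X x) + cmod v * (L * hnorm X x)"
      by (intro add_mono mult_left_mono K(2)[OF x] L(2)[OF x]) simp_all
    finally show ?thesis by (simp add: algebra_simps)
  qed
  then show ?thesis
  proof (intro bounded_opsI[OF HX])
    fix x y assume [simp]: "x \<in> carrier X" "y \<in> carrier X"
    show "(u \<odot>\<^bsub>Y\<^esub> S (x \<oplus>\<^bsub>X\<^esub> y)) \<oplus>\<^bsub>Y\<^esub> (v \<odot>\<^bsub>Y\<^esub> T (x \<oplus>\<^bsub>X\<^esub> y)) =
      ((u \<odot>\<^bsub>Y\<^esub> S x) \<oplus>\<^bsub>Y\<^esub> (v \<odot>\<^bsub>Y\<^esub> T x)) \<oplus>\<^bsub>Y\<^esub> ((u \<odot>\<^bsub>Y\<^esub> S y) \<oplus>\<^bsub>Y\<^esub> (v \<odot>\<^bsub>Y\<^esub> T y))"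
      by (rule hilbert_eqI[OF HY]) (simp_all add: cinner_left[OF HY] algebra_simps)
  next
    fix a x assume [simp]: "x \<in> carrier X"
    show "(u \<odot>\<^bsub>Y\<^esub> S (a \<odot>\<^bsub>X\<^esub> x)) \<oplus>\<^bsub>Y\<^esub> (v \<odot>\<^bsub>Y\<^esub> T (a \<odot>\<^bsub>X\<^esub> x)) =
      a \<odot>\<^bsub>Y\<^esub> ((u \<odot>\<^bsub>Y\<^esub> S x) \<oplus>\<^bsub>Y\<^esub> (v \<odot>\<^bsub>Y\<^esub> T x))"
      by (rule hilbert_eqI[OF HY]) (simp_all add: cinner_left[OF HY] algebra_simps)
  qed simp_all
qed

lemma bounded_ops_id:
  assumes "complex_hilbert X"
  shows "(\<lambda>x\<in>carrier X. x) \<in> bounded_ops X X"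
  by (rule bounded_opsI[OF assms, where K = 1]) simp_all

text \<open>Operators \<open>u I - v T\<close>, which cover both \<open>z I - T\<close> and \<open>I - z T\<close>.\<close>

definition pencil :: "'a hilbert \<Rightarrow> complex \<Rightarrow> complex \<Rightarrow> ('a \<Rightarrow> 'a) \<Rightarrow> 'a \<Rightarrow> 'a"
  where "pencil X u v T = (\<lambda>x\<in>carrier X. (u \<odot>\<^bsub>X\<^esub> x) \<ominus>\<^bsub>X\<^esub> (v \<odot>\<^bsub>X\<^esub> T x))"

lemma pencil_apply [simp]:
  "x \<in> carrier X \<Longrightarrow> pencil X u v T x = (u \<odot>\<^bsub>X\<^esub> x) \<ominus>\<^bsub>X\<^esub> (v \<odot>\<^bsub>X\<^esub> T x)"
  by (simp add: pencil_def)

lemma pencil_bounded: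
  assumes H: "complex_hilbert X" and T: "T \<in> bounded_ops X X"
  shows "pencil X u v T \<in> bounded_ops X X"
proof -
  note [simp] = hilbert_closed[OF H] bounded_ops_simps[OF T]
  have "pencil X u v T = (\<lambda>x\<in>carrier X. (u \<odot>\<^bsub>X\<^esub> (\<lambda>x\<in>carrier X. x) x) \<oplus>\<^bsub>X\<^esub> ((- v) \<odot>\<^bsub>X\<^esub> T x))"
    unfolding pencil_def
    by (rule restrict_ext, rule hilbert_eqI[OF H]) (simp_all add: cinner_left[OF H])
  then show ?thesis using bounded_ops_lincomb[OF bounded_ops_id[OF H] T H H] by simp
qed

lemma scalar_minus_op_pencil:
  assumes H: "complex_hilbert X" and T: "T \<in> bounded_ops X X"
  shows "scalar_minus_op X z T = pencil X z 1 T"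
  unfolding scalar_minus_op_def pencil_def
  by (rule restrict_ext, rule hilbert_eqI[OF H])
    (simp_all add: cinner_left[OF H] hilbert_closed[OF H] bounded_ops_simps[OF T])

lemma id_minus_scaled_pencil:
  assumes H: "complex_hilbert X" and T: "T \<in> bounded_ops X X"
  shows "id_minus_scaled X z T = pencil X 1 z T"
  unfolding id_minus_scaled_def pencil_def
  by (rule restrict_ext, rule hilbert_eqI[OF H])
    (simp_all add: cinner_left[OF H] hilbert_closed[OF H] bounded_ops_simps[OF T])

lemma op_invertibleI:
  assumes "T \<in> bounded_ops X X" "S \<in> bounded_ops X X"
    and "\<And>x. x \<in> carrier X \<Longrightarrow> S (T x) = x" "\<And>x. x \<in> carrier X \<Longrightarrow> T (S x) = x"
  shows "op_invertible X T" "op_inv X T = S"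
proof -
  show "op_invertible X T" using assms by (auto simp: op_invertible_def)
  have inj: "inj_on T (carrier X)" using assms(3) by (metis inj_on_inverseI)
  show "op_inv X T = S"
  proof (rule PiE_ext)
    show "op_inv X T x = S x" if "x \<in> carrier X" for x
      using inv_into_f_f[OF inj, of "S x"] assms(4)[OF that] bounded_ops_simps(1)[OF assms(2) that] that
      by (simp add: op_inv_def)
    show S: "S \<in> carrier X \<rightarrow>\<^sub>E carrier X" using assms(2) by (simp add: bounded_ops_def)
    show "op_inv X T \<in> carrier X \<rightarrow>\<^sub>E carrier X"
      using S \<open>\<And>x. x \<in> carrier X \<Longrightarrow> op_inv X T x = S x\<close> by (auto simp: PiE_iff op_inv_def)
  qed
qed

lemma op_invertibleD:
  assumes "op_invertible X T"
  shows "T \<in> bounded_ops X X" "op_inv X T \<in> bounded_ops X X"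
    and "x \<in> carrier X \<Longrightarrow> op_inv X T (T x) = x" "x \<in> carrier X \<Longrightarrow> T (op_inv X T x) = x"
proof -
  obtain S where "T \<in> bounded_ops X X" "S \<in> bounded_ops X X"
    and "\<And>x. x \<in> carrier X \<Longrightarrow> S (T x) = x" "\<And>x. x \<in> carrier X \<Longrightarrow> T (S x) = x"
    using assms by (auto simp: op_invertible_def)
  moreover from this have "op_inv X T = S" by (rule op_invertibleI)
  ultimately show "T \<in> bounded_ops X X" "op_inv X T \<in> bounded_ops X X"
    and "x \<in> carrier X \<Longrightarrow> op_inv X T (T x) = x" "x \<in> carrier X \<Longrightarrow> T (op_inv X T x) = x"
    by simp_all
qed

lemma op_invertible_op_inv:
  assumes "op_invertible X T"
  shows "op_invertible X (op_inv X T)" "op_inv X (op_inv X T) = T"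
  using op_invertibleI[of "op_inv X T" X T] op_invertibleD[OF assms] by blast+

text \<open>A surjection that is bounded below is injective and has a bounded inverse.\<close>

lemma op_invertible_if_surj_bounded_below:
  assumes H: "complex_hilbert X" and T: "T \<in> bounded_ops X X"
    and surj: "\<And>y. y \<in> carrier X \<Longrightarrow> \<exists>x\<in>carrier X. T x = y"
    and below: "\<And>x. x \<in> carrier X \<Longrightarrow> hnorm X x \<le> c * hnorm X (T x)"
  shows "op_invertible X T"
proof -
  note [simp] = hilbert_closed[OF H] bounded_ops_simps[OF T]
  have inj: "x = y" if "x \<in> carrier X" "y \<in> carrier X" "T x = T y" for x y
  proof -
    have "T (x \<ominus>\<^bsub>X\<^esub> y) = \<zero>\<^bsub>X\<^esub>"
      by (rule hilbert_eqI[OF H]) (simp_all add: that bounded_ops_group[OF T H H] cinner_left[OF H])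
    then have "hnorm X (x \<ominus>\<^bsub>X\<^esub> y) \<le> 0"
      using below[of "x \<ominus>\<^bsub>X\<^esub> y"] that by (simp add: hnorm_zero[OF H])
    then show ?thesis using hilbert_eq_if_close[OF H, of x y "\<lambda>_. 0"] that by simp
  qed
  define S where "S y = (SOME x. x \<in> carrier X \<and> T x = y)" for y
  have S: "S y \<in> carrier X" "T (S y) = y" if "y \<in> carrier X" for y
    using someI_ex[of "\<lambda>x. x \<in> carrier X \<and> T x = y"] surj[OF that] by (auto simp: S_def)
  have "(\<lambda>x\<in>carrier X. S x) \<in> bounded_ops X X"
  proof (rule bounded_opsI[OF H, where K = c])
    show "hnorm X (S x) \<le> c * hnorm X x" if "x \<in> carrier X" for x
      using below[of "S x"] S that by simp
  next
    fix x y assume [simp]: "x \<in> carrier X" "y \<in> carrier X"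
    show "S (x \<oplus>\<^bsub>X\<^esub> y) = S x \<oplus>\<^bsub>X\<^esub> S y" by (rule inj) (simp_all add: S)
  next
    fix a x assume [simp]: "x \<in> carrier X"
    show "S (a \<odot>\<^bsub>X\<^esub> x) = a \<odot>\<^bsub>X\<^esub> S x" by (rule inj) (simp_all add: S)
  qed (simp add: S)
  then show ?thesis
    by (rule op_invertibleI(1)[OF T]) (use S inj in simp_all)
qed

text \<open>Geometric iteration of the residual solves \<open>T x = y\<close> if \<open>\<parallel>T - I\<parallel> \<le> 1/2\<close>.\<close>

lemma op_invertible_near_id:
  assumes H: "complex_hilbert X" and T: "T \<in> bounded_ops X X"
    and near: "\<And>x. x \<in> carrier X \<Longrightarrow> hnorm X (x \<ominus>\<^bsub>X\<^esub> T x) \<le> hnorm X x / 2"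
  shows "op_invertible X T"
proof (rule op_invertible_if_surj_bounded_below[OF H T])
  note [simp] = hilbert_closed[OF H] bounded_ops_simps[OF T] bounded_ops_group[OF T H H]
  fix y assume y [simp]: "y \<in> carrier X"
  define s where "s = rec_nat \<zero>\<^bsub>X\<^esub> (\<lambda>_ x. x \<oplus>\<^bsub>X\<^esub> (y \<ominus>\<^bsub>X\<^esub> T x))"
  have s: "s 0 = \<zero>\<^bsub>X\<^esub>" "\<And>k. s (Suc k) = s k \<oplus>\<^bsub>X\<^esub> (y \<ominus>\<^bsub>X\<^esub> T (s k))"
    by (simp_all add: s_def)
  have sc [simp]: "s k \<in> carrier X" for k by (induction k) (simp_all add: s)
  have res: "hnorm X (y \<ominus>\<^bsub>X\<^esub> T (s k)) \<le> hnorm X y / 2 ^ k" for k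
  proof (induction k)
    case 0
    have "y \<ominus>\<^bsub>X\<^esub> \<zero>\<^bsub>X\<^esub> = y" by (rule hilbert_eqI[OF H]) (simp_all add: cinner_left[OF H])
    then show ?case by (simp add: s)
  next
    case (Suc k)
    have "y \<ominus>\<^bsub>X\<^esub> T (s (Suc k)) = (y \<ominus>\<^bsub>X\<^esub> T (s k)) \<ominus>\<^bsub>X\<^esub> T (y \<ominus>\<^bsub>X\<^esub> T (s k))"
      by (rule hilbert_eqI[OF H]) (simp_all add: s cinner_left[OF H])
    then show ?case using near[of "y \<ominus>\<^bsub>X\<^esub> T (s k)"] Suc by simp
  qed
  have "s (Suc k) \<ominus>\<^bsub>X\<^esub> s k = y \<ominus>\<^bsub>X\<^esub> T (s k)" for k
    by (rule hilbert_eqI[OF H]) (simp_all add: s cinner_left[OF H])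
  then have "hnorm X (s (Suc k) \<ominus>\<^bsub>X\<^esub> s k) \<le> hnorm X y / 2 ^ k" for k
    by (simp add: res)
  then obtain x where x [simp]: "x \<in> carrier X"
    and lim: "\<And>k. hnorm X (s k \<ominus>\<^bsub>X\<^esub> x) \<le> 2 * hnorm X y / 2 ^ k"
    using hilbert_complete_geometric[where s = s, OF H sc] by blast
  obtain K where K: "0 < K" "\<And>x. x \<in> carrier X \<Longrightarrow> hnorm X (T x) \<le> K * hnorm X x"
    using bounded_ops_bound[OF T H] by blast
  have "hnorm X (y \<ominus>\<^bsub>X\<^esub> T x) \<le> (1 + 2 * K) * hnorm X y / 2 ^ k" for k
  proof -
    have "hnorm X (y \<ominus>\<^bsub>X\<^esub> T x) \<le> hnorm X (y \<ominus>\<^bsub>X\<^esub> T (s k)) + hnorm X (T (s k) \<ominus>\<^bsub>X\<^esub> T x)"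
      by (rule hnorm_triangle[OF H]) simp_all
    also have "T (s k) \<ominus>\<^bsub>X\<^esub> T x = T (s k \<ominus>\<^bsub>X\<^esub> x)" by simp
    also have "hnorm X (T (s k \<ominus>\<^bsub>X\<^esub> x)) \<le> K * (2 * hnorm X y / 2 ^ k)"
      using K(2)[of "s k \<ominus>\<^bsub>X\<^esub> x"] mult_left_mono[OF lim[of k], of K] K(1) by simp
    finally show ?thesis using res[of k] by (simp add: field_simps)
  qed
  moreover have "(\<lambda>k. (1 + 2 * K) * hnorm X y / 2 ^ k) \<longlonglongrightarrow> 0" by real_asymp
  ultimately have "y = T x" using hilbert_eq_if_close[OF H] by simp
  then show "\<exists>x\<in>carrier X. T x = y" by (metis x)
next
  note [simp] = hilbert_closed[OF H] bounded_ops_simps[OF T]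
  fix x assume [simp]: "x \<in> carrier X"
  have "x = (x \<ominus>\<^bsub>X\<^esub> T x) \<oplus>\<^bsub>X\<^esub> T x"
    by (rule hilbert_eqI[OF H]) (simp_all add: cinner_left[OF H])
  then have "hnorm X x \<le> hnorm X (x \<ominus>\<^bsub>X\<^esub> T x) + hnorm X (T x)"
    using hnorm_add[OF H, of "x \<ominus>\<^bsub>X\<^esub> T x" "T x"] by simp
  then show "hnorm X x \<le> 2 * hnorm X (T x)" using near[of x] by simp
qed

text \<open>
  If \<open>S T = T S\<close> is invertible, then \<open>T (S T)\<^sup>-\<^sup>1\<close> is a right inverse of \<open>S\<close> and \<open>(S T)\<^sup>-\<^sup>1 T\<close> is a left
  inverse, so the two coincide.
\<close>

lemma op_invertible_commuting_factor:
  assumes H: "complex_hilbert X" and S: "S \<in> bounded_ops X X" and T: "T \<in> bounded_ops X X"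
    and comm: "\<And>x. x \<in> carrier X \<Longrightarrow> S (T x) = T (S x)"
    and Q: "op_invertible X Q" and QST: "\<And>x. x \<in> carrier X \<Longrightarrow> Q x = S (T x)"
  shows "op_invertible X S"
proof (rule op_invertibleI(1)[OF S])
  note [simp] = bounded_ops_simps(1)[OF T] bounded_ops_simps(1)[OF S]
  note D = op_invertibleD[OF Q]
  note [simp] = bounded_ops_simps(1)[OF D(2)]
  let ?V = "\<lambda>x\<in>carrier X. T (op_inv X Q x)"
  show "?V \<in> bounded_ops X X" by (rule bounded_ops_compose[OF T D(2) H H])
  show R: "S (?V x) = x" if "x \<in> carrier X" for x
    using that QST[of "op_inv X Q x"] D(4)[OF that] by simp
  have L: "op_inv X Q (T (S x)) = x" if "x \<in> carrier X" for x
    using that D(3)[OF that] by (simp add: QST comm)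
  show "?V (S x) = x" if "x \<in> carrier X" for x
    using L[of "?V (S x)"] R[of "S x"] L[OF that] that by simp
qed

lemma op_inv_commute:
  assumes Q: "op_invertible X Q" and B: "B \<in> bounded_ops X X"
    and comm: "\<And>x. x \<in> carrier X \<Longrightarrow> B (Q x) = Q (B x)" and x: "x \<in> carrier X"
  shows "B (op_inv X Q x) = op_inv X Q (B x)"
proof -
  note D = op_invertibleD[OF Q]
  note [simp] = bounded_ops_simps(1)[OF B] bounded_ops_simps(1)[OF D(1)] bounded_ops_simps(1)[OF D(2)] D(3,4) x
  have "Q (B (op_inv X Q x)) = B x" by (simp flip: comm)
  then have "op_inv X Q (Q (B (op_inv X Q x))) = op_inv X Q (B x)" by simp
  then show ?thesis by simp
qed

section \<open>Squares of pencils and commuting idempotents\<close>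

lemma pencil_mult_conjugate:
  assumes H: "complex_hilbert X" and T: "T \<in> bounded_ops X X" and x: "x \<in> carrier X"
  shows "pencil X u v T (pencil X u (- v) T x) = pencil X (u\<^sup>2) (v\<^sup>2) (\<lambda>x\<in>carrier X. T (T x)) x"
proof -
  note [simp] = hilbert_closed[OF H] bounded_ops_simps[OF T] bounded_ops_group[OF T H H] x
  show ?thesis
    by (rule hilbert_eqI[OF H]) (simp_all add: cinner_left[OF H] power2_eq_square algebra_simps)
qed

lemma op_invertible_pencil_of_square:
  assumes H: "complex_hilbert X" and T: "T \<in> bounded_ops X X"
    and inv: "op_invertible X (pencil X (u\<^sup>2) (v\<^sup>2) (\<lambda>x\<in>carrier X. T (T x)))"
  shows "op_invertible X (pencil X u v T)"
proof (rule op_invertible_commuting_factor[OF H pencil_bounded[OF H T] pencil_bounded[OF H T] _ inv])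
  fix x assume x: "x \<in> carrier X"
  show "pencil X u v T (pencil X u (- v) T x) = pencil X u (- v) T (pencil X u v T x)"
    using pencil_mult_conjugate[OF H T x, of u v] pencil_mult_conjugate[OF H T x, of u "- v"] by simp
  show "pencil X (u\<^sup>2) (v\<^sup>2) (\<lambda>x\<in>carrier X. T (T x)) x = pencil X u v T (pencil X u (- v) T x)"
    using pencil_mult_conjugate[OF H T x] by simp
qed

text \<open>
  \<open>(I - w\<^sup>2 T\<^sup>2)\<^sup>-\<^sup>1\<close> is both the product and the mean of \<open>(I - w T)\<^sup>-\<^sup>1\<close> and \<open>(I + w T)\<^sup>-\<^sup>1\<close>.
\<close>

lemma pencil_square_inverse:
  assumes H: "complex_hilbert X" and T: "T \<in> bounded_ops X X"
    and inv: "op_invertible X (pencil X 1 w T)" "op_invertible X (pencil X 1 (- w) T)"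
  defines "V \<equiv> op_inv X (pencil X 1 w T)" and "V' \<equiv> op_inv X (pencil X 1 (- w) T)"
    and "Q \<equiv> pencil X 1 (w\<^sup>2) (\<lambda>x\<in>carrier X. T (T x))"
  shows "op_invertible X Q"
    and "x \<in> carrier X \<Longrightarrow> op_inv X Q x = V (V' x)"
    and "x \<in> carrier X \<Longrightarrow> op_inv X Q x = ((1/2) \<odot>\<^bsub>X\<^esub> V x) \<oplus>\<^bsub>X\<^esub> ((1/2) \<odot>\<^bsub>X\<^esub> V' x)"
proof -
  note D = op_invertibleD[OF inv(1), folded V_def] and D' = op_invertibleD[OF inv(2), folded V'_def]
  note cl [simp] = hilbert_closed[OF H] bounded_ops_simps[OF T] bounded_ops_group[OF T H H]
    bounded_ops_simps(1)[OF D(2)] bounded_ops_simps(1)[OF D'(2)]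
  note pc = bounded_ops_simps(1)[OF D(1)] bounded_ops_simps(1)[OF D'(1)]
  have TT: "(\<lambda>x\<in>carrier X. T (T x)) \<in> bounded_ops X X" by (rule bounded_ops_compose[OF T T H H])
  have Q1: "Q x = pencil X 1 (- w) T (pencil X 1 w T x)" if "x \<in> carrier X" for x
    using pencil_mult_conjugate[OF H T that, of 1 "- w"] by (simp add: Q_def)
  have VV: "(\<lambda>x\<in>carrier X. V (V' x)) \<in> bounded_ops X X" by (rule bounded_ops_compose[OF D(2) D'(2) H H])
  have a: "(\<lambda>x\<in>carrier X. V (V' x)) (Q x) = x" if "x \<in> carrier X" for x
    using that bounded_ops_simps(1)[OF pencil_bounded[OF H TT] that, of 1 "w\<^sup>2"]
    by (simp only: restrict_apply Q_def[symmetric] if_True) (simp only: Q1 D D' pc)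
  have b: "Q ((\<lambda>x\<in>carrier X. V (V' x)) x) = x" if "x \<in> carrier X" for x
    using that by (simp only: restrict_apply if_True Q1 cl) (simp only: D D' cl)
  have bQ: "Q \<in> bounded_ops X X" unfolding Q_def by (rule pencil_bounded[OF H TT])
  note I = op_invertibleI[OF bQ VV a b]
  show "op_invertible X Q" by (rule I(1))
  show prod: "op_inv X Q x = V (V' x)" if "x \<in> carrier X" for x using I(2) that by simp
  show "op_inv X Q x = ((1/2) \<odot>\<^bsub>X\<^esub> V x) \<oplus>\<^bsub>X\<^esub> ((1/2) \<odot>\<^bsub>X\<^esub> V' x)" if x: "x \<in> carrier X"
  proof -
    let ?q = "V' x"
    note [simp] = x
    have "?q = (1/2) \<odot>\<^bsub>X\<^esub> (pencil X 1 w T ?q \<oplus>\<^bsub>X\<^esub> pencil X 1 (- w) T ?q)"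
      by (rule hilbert_eqI[OF H]) (simp_all add: cinner_left[OF H] algebra_simps)
    also have "pencil X 1 (- w) T ?q = x" by (rule D'(4)[OF x])
    finally have "V ?q = V ((1/2) \<odot>\<^bsub>X\<^esub> (pencil X 1 w T ?q \<oplus>\<^bsub>X\<^esub> x))" by simp
    also have "\<dots> = (1/2) \<odot>\<^bsub>X\<^esub> (V (pencil X 1 w T ?q) \<oplus>\<^bsub>X\<^esub> V x)"
      using pc(1)[of ?q] by (simp del: pencil_apply add: bounded_ops_simps[OF D(2)])
    also have "V (pencil X 1 w T ?q) = ?q" by (rule D(3)) simp
    finally have "V ?q = (1/2) \<odot>\<^bsub>X\<^esub> (?q \<oplus>\<^bsub>X\<^esub> V x)" .
    also have "\<dots> = ((1/2) \<odot>\<^bsub>X\<^esub> V x) \<oplus>\<^bsub>X\<^esub> ((1/2) \<odot>\<^bsub>X\<^esub> ?q)"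
      by (rule hilbert_eqI[OF H]) (simp_all add: cinner_left[OF H] algebra_simps)
    finally show ?thesis using prod[OF x] by simp
  qed
qed

text \<open>\<open>T\<close> to the power \<open>2\<^sup>j\<close>.\<close>

primrec dyadic_power :: "'a hilbert \<Rightarrow> ('a \<Rightarrow> 'a) \<Rightarrow> nat \<Rightarrow> 'a \<Rightarrow> 'a"
  where "dyadic_power X T 0 = T"
  | "dyadic_power X T (Suc j) = (\<lambda>x\<in>carrier X. dyadic_power X T j (dyadic_power X T j x))"

lemma dyadic_power_bounded:
  assumes "complex_hilbert X" "T \<in> bounded_ops X X"
  shows "dyadic_power X T j \<in> bounded_ops X X"
proof (induction j)
  case (Suc j)
  show ?case unfolding dyadic_power.simps by (rule bounded_ops_compose[OF Suc Suc assms(1) assms(1)])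
qed (simp add: assms)

lemma dyadic_power_commute:
  assumes H: "complex_hilbert X" and T: "T \<in> bounded_ops X X" and B: "B \<in> bounded_ops X X"
    and comm: "\<And>x. x \<in> carrier X \<Longrightarrow> B (T x) = T (B x)"
  shows "x \<in> carrier X \<Longrightarrow> B (dyadic_power X T j x) = dyadic_power X T j (B x)"
  by (induction j arbitrary: x)
    (simp_all add: comm bounded_ops_simps(1)[OF B] bounded_ops_simps(1)[OF dyadic_power_bounded[OF H T]])

lemma pencil_commute:
  assumes H: "complex_hilbert X" and T: "T \<in> bounded_ops X X" and B: "B \<in> bounded_ops X X"
    and comm: "\<And>x. x \<in> carrier X \<Longrightarrow> B (T x) = T (B x)" and x: "x \<in> carrier X"
  shows "B (pencil X u v T x) = pencil X u v T (B x)"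
  using x by (simp add: comm bounded_ops_simps[OF B] bounded_ops_group[OF B H H]
      bounded_ops_simps(1)[OF T] hilbert_closed[OF H])

text \<open>Iterating the factorization \<open>u\<^sup>2 I - v\<^sup>2 T\<^sup>2 = (u I - v T) (u I + v T)\<close>.\<close>

lemma op_invertible_pencil_of_dyadic_power:
  assumes H: "complex_hilbert X" and T: "T \<in> bounded_ops X X"
    and inv: "op_invertible X (pencil X (u ^ 2 ^ j) (v ^ 2 ^ j) (dyadic_power X T j))"
  shows "op_invertible X (pencil X u v T)"
  using inv
proof (induction j)
  case (Suc j)
  have "op_invertible X (pencil X (u ^ 2 ^ j) (v ^ 2 ^ j) (dyadic_power X T j))"
  proof (rule op_invertible_pencil_of_square[OF H dyadic_power_bounded[OF H T]])
    have "(z ^ 2 ^ j)\<^sup>2 = z ^ 2 ^ Suc j" for z :: complex by (simp add: mult.commute flip: power_mult)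
    then show "op_invertible X (pencil X ((u ^ 2 ^ j)\<^sup>2) ((v ^ 2 ^ j)\<^sup>2)
        (\<lambda>x\<in>carrier X. dyadic_power X T j (dyadic_power X T j x)))"
      using Suc.prems by (simp only: dyadic_power.simps)
  qed
  then show ?case by (rule Suc.IH)
qed simp

text \<open>The difference \<open>d\<close> of two commuting idempotents satisfies \<open>d\<^sup>3 = d\<close>, so it vanishes if \<open>\<parallel>d\<parallel> < 1\<close>.\<close>

lemma commuting_idempotents_eq:
  assumes H: "complex_hilbert X" and P: "P \<in> bounded_ops X X" and Q: "Q \<in> bounded_ops X X"
    and idem: "\<And>x. x \<in> carrier X \<Longrightarrow> P (P x) = P x" "\<And>x. x \<in> carrier X \<Longrightarrow> Q (Q x) = Q x"
    and comm: "\<And>x. x \<in> carrier X \<Longrightarrow> P (Q x) = Q (P x)"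
    and close: "\<And>x. x \<in> carrier X \<Longrightarrow> hnorm X (P x \<ominus>\<^bsub>X\<^esub> Q x) \<le> c * hnorm X x" and c: "0 \<le> c" "c < 1"
    and x: "x \<in> carrier X"
  shows "P x = Q x"
proof -
  note [simp] = hilbert_closed[OF H] bounded_ops_simps(1)[OF P] bounded_ops_simps(1)[OF Q]
    bounded_ops_group[OF P H H] bounded_ops_group[OF Q H H] idem comm x
  define d where "d y = P y \<ominus>\<^bsub>X\<^esub> Q y" for y
  have d [simp]: "d y \<in> carrier X" if "y \<in> carrier X" for y using that by (simp add: d_def)
  have "d (d (d x)) = d x"
    by (rule hilbert_eqI[OF H]) (simp, simp, simp add: d_def cinner_left[OF H])
  moreover have "hnorm X (d (d (d x))) \<le> c * (c * hnorm X (d x))"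
    using close[of "d (d x)"] mult_left_mono[OF close[of "d x"] c(1)] by (simp flip: d_def)
  ultimately have "(1 - c * c) * hnorm X (d x) \<le> 0" by (simp add: algebra_simps)
  moreover have "c * c < 1" using c by (smt (verit) mult_left_le)
  ultimately have "hnorm X (d x) \<le> 0"
    by (smt (verit) mult_pos_pos)
  then show ?thesis
    using hilbert_eq_if_close[OF H, of "P x" "Q x" "\<lambda>_. 0"] by (simp add: d_def)
qed

section \<open>Means of the resolvent over roots of unity\<close>

text \<open>
  The operators \<open>(I - w T)\<^sup>-\<^sup>1\<close> exist and are uniformly bounded by \<open>M\<close> for \<open>w\<close> in a rotation invariant
  part \<open>\<Omega>\<close> of the closed unit disc, and \<open>K\<close> bounds \<open>T\<close>. The cases of interest are the unit circle for
  an operator without spectrum on the circle, and the closed disc for an exponentially stable one.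
\<close>

locale resolvent_family =
  fixes X :: "'a hilbert" and T :: "'a \<Rightarrow> 'a" and \<Omega> :: "complex set" and M K :: real
  assumes H: "complex_hilbert X" and T: "T \<in> bounded_ops X X"
    and K: "0 \<le> K" "\<And>x. x \<in> carrier X \<Longrightarrow> hnorm X (T x) \<le> K * hnorm X x"
    and \<Omega>_disc: "\<And>w. w \<in> \<Omega> \<Longrightarrow> cmod w \<le> 1"
    and \<Omega>_rot: "\<And>w e. w \<in> \<Omega> \<Longrightarrow> cmod e = 1 \<Longrightarrow> w * e \<in> \<Omega>"
    and inv: "\<And>w. w \<in> \<Omega> \<Longrightarrow> op_invertible X (pencil X 1 w T)"
    and M: "0 \<le> M" "\<And>w x. w \<in> \<Omega> \<Longrightarrow> x \<in> carrier X \<Longrightarrow>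
      hnorm X (op_inv X (pencil X 1 w T) x) \<le> M * hnorm X x"
begin

text \<open>
  \<open>S j w = (I - (w T)\<^bsup>N\<^esup>)\<^sup>-\<^sup>1\<close> for \<open>N = 2\<^sup>j\<close>. It is the mean of the operators \<open>(I - w e T)\<^sup>-\<^sup>1\<close>
  over the \<open>N\<close>-th roots of unity \<open>e\<close>.
\<close>

definition S :: "nat \<Rightarrow> complex \<Rightarrow> 'a \<Rightarrow> 'a"
  where "S j w = op_inv X (pencil X 1 (w ^ 2 ^ j) (dyadic_power X T j))"

text \<open>A primitive root of unity of order \<open>2\<^bsup>j+1\<^esup>\<close>, so that its \<open>2\<^sup>j\<close>-th power is \<open>-1\<close>.\<close>

definition \<eta> :: "nat \<Rightarrow> complex"
  where "\<eta> j = cis (pi / 2 ^ j)"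

lemma \<eta>_power: "(w * \<eta> j) ^ 2 ^ j = - (w ^ 2 ^ j)"
proof -
  have "real (2 ^ j) * (pi / 2 ^ j) = pi" by simp
  then have "cis (pi / 2 ^ j) ^ 2 ^ j = -1"
    using Complex.DeMoivre[of "pi / 2 ^ j" "2 ^ j"] by (simp only: cis_pi)
  then have "\<eta> j ^ 2 ^ j = -1" by (simp add: \<eta>_def)
  then show ?thesis by (simp add: power_mult_distrib)
qed

lemma \<eta>_\<Omega>: "w \<in> \<Omega> \<Longrightarrow> w * \<eta> j \<in> \<Omega>"
  by (rule \<Omega>_rot) (simp_all add: \<eta>_def)

lemma \<eta>_close:
  assumes "w \<in> \<Omega>"
  shows "cmod (w * \<eta> j - w) \<le> pi / 2 ^ j"
proof -
  have "cmod (\<eta> j - 1) = 2 * \<bar>sin (pi / 2 ^ j / 2)\<bar>"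
    using dist_exp_i_1[of "pi / 2 ^ j"] by (simp add: \<eta>_def cis_conv_exp)
  also have "\<dots> \<le> 2 * \<bar>pi / 2 ^ j / 2\<bar>"
    using abs_sin_x_le_abs_x[of "pi / 2 ^ j / 2"] by linarith
  also have "\<dots> = pi / 2 ^ j" by simp
  finally have "cmod w * cmod (\<eta> j - 1) \<le> 1 * (pi / 2 ^ j)"
    using \<Omega>_disc[OF assms] by (intro mult_mono) simp_all
  then show ?thesis by (simp add: right_diff_distrib flip: norm_mult)
qed

lemma S_step:
  assumes "w \<in> \<Omega>"
    and "op_invertible X (pencil X 1 (w ^ 2 ^ j) (dyadic_power X T j))"
    and "op_invertible X (pencil X 1 ((w * \<eta> j) ^ 2 ^ j) (dyadic_power X T j))"
  shows "op_invertible X (pencil X 1 (w ^ 2 ^ Suc j) (dyadic_power X T (Suc j)))"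
    and "x \<in> carrier X \<Longrightarrow> S (Suc j) w x = S j w (S j (w * \<eta> j) x)"
    and "x \<in> carrier X \<Longrightarrow> S (Suc j) w x =
      ((1/2) \<odot>\<^bsub>X\<^esub> S j w x) \<oplus>\<^bsub>X\<^esub> ((1/2) \<odot>\<^bsub>X\<^esub> S j (w * \<eta> j) x)"
proof -
  have eq: "(w ^ 2 ^ j)\<^sup>2 = w ^ 2 ^ Suc j" by (simp add: mult.commute flip: power_mult)
  note L = pencil_square_inverse[OF H dyadic_power_bounded[OF H T] assms(2) assms(3)[unfolded \<eta>_power], unfolded eq]
  show "op_invertible X (pencil X 1 (w ^ 2 ^ Suc j) (dyadic_power X T (Suc j)))"
    using L(1) by simp
  show "x \<in> carrier X \<Longrightarrow> S (Suc j) w x = S j w (S j (w * \<eta> j) x)"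
    using L(2) by (simp add: S_def \<eta>_power)
  show "x \<in> carrier X \<Longrightarrow> S (Suc j) w x =
      ((1/2) \<odot>\<^bsub>X\<^esub> S j w x) \<oplus>\<^bsub>X\<^esub> ((1/2) \<odot>\<^bsub>X\<^esub> S j (w * \<eta> j) x)"
    using L(3) by (simp add: S_def \<eta>_power)
qed

lemma S_inv: "w \<in> \<Omega> \<Longrightarrow> op_invertible X (pencil X 1 (w ^ 2 ^ j) (dyadic_power X T j))"
proof (induction j arbitrary: w)
  case 0
  then show ?case by (simp add: inv)
next
  case (Suc j)
  show ?case by (rule S_step(1)[OF Suc.prems Suc.IH[OF Suc.prems] Suc.IH[OF \<eta>_\<Omega>[OF Suc.prems]]])
qed

lemma S_prod: "w \<in> \<Omega> \<Longrightarrow> x \<in> carrier X \<Longrightarrow> S (Suc j) w x = S j w (S j (w * \<eta> j) x)"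
  by (simp add: S_step(2) S_inv \<eta>_\<Omega>)

lemma S_mean: "w \<in> \<Omega> \<Longrightarrow> x \<in> carrier X \<Longrightarrow>
    S (Suc j) w x = ((1/2) \<odot>\<^bsub>X\<^esub> S j w x) \<oplus>\<^bsub>X\<^esub> ((1/2) \<odot>\<^bsub>X\<^esub> S j (w * \<eta> j) x)"
  by (simp add: S_step(3) S_inv \<eta>_\<Omega>)

lemma S_bounded: "w \<in> \<Omega> \<Longrightarrow> S j w \<in> bounded_ops X X"
  unfolding S_def using op_invertibleD(2)[OF S_inv] by simp

lemma S_closed [simp]: "w \<in> \<Omega> \<Longrightarrow> x \<in> carrier X \<Longrightarrow> S j w x \<in> carrier X"
  using bounded_ops_simps(1)[OF S_bounded] by simp

lemma S_norm: "w \<in> \<Omega> \<Longrightarrow> x \<in> carrier X \<Longrightarrow> hnorm X (S j w x) \<le> M * hnorm X x"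
proof (induction j arbitrary: w)
  case 0
  then show ?case by (simp add: S_def M)
next
  case (Suc j)
  note [simp] = hilbert_closed[OF H] Suc.prems \<eta>_\<Omega>
  have "hnorm X (S (Suc j) w x) \<le> hnorm X ((1/2) \<odot>\<^bsub>X\<^esub> S j w x) + hnorm X ((1/2) \<odot>\<^bsub>X\<^esub> S j (w * \<eta> j) x)"
    unfolding S_mean[OF Suc.prems] by (rule hnorm_add[OF H]) simp_all
  then show ?case using Suc.IH[of w] Suc.IH[of "w * \<eta> j"] by (simp add: hnorm_smult[OF H])
qed

text \<open>
  The resolvent is Lipschitz in \<open>w\<close> by the resolvent identity, and means inherit the constant, which
  therefore does not depend on \<open>j\<close>.
\<close>

lemma S_Lipschitz:
  "w \<in> \<Omega> \<Longrightarrow> v \<in> \<Omega> \<Longrightarrow> x \<in> carrier X \<Longrightarrow>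
    hnorm X (S j w x \<ominus>\<^bsub>X\<^esub> S j v x) \<le> M * K * M * cmod (w - v) * hnorm X x"
proof (induction j arbitrary: w v)
  case 0
  note T' [simp] = hilbert_closed[OF H] bounded_ops_simps[OF T] bounded_ops_group[OF T H H] 0
  let ?R = "\<lambda>w. op_inv X (pencil X 1 w T)"
  note D = op_invertibleD[OF inv]
  note [simp] = bounded_ops_simps(1)[OF D(2)]
  let ?y = "?R v x"
  have x: "x = pencil X 1 v T ?y" by (simp add: D(4) del: pencil_apply)
  have "?R w x = ?R w (pencil X 1 w T ?y \<oplus>\<^bsub>X\<^esub> ((w - v) \<odot>\<^bsub>X\<^esub> T ?y))"
  proof (subst x, rule arg_cong[of _ _ "?R w"])
    show "pencil X 1 v T ?y = pencil X 1 w T ?y \<oplus>\<^bsub>X\<^esub> ((w - v) \<odot>\<^bsub>X\<^esub> T ?y)"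
      by (rule hilbert_eqI[OF H]) (simp_all add: cinner_left[OF H] algebra_simps)
  qed
  also have "\<dots> = ?R w (pencil X 1 w T ?y) \<oplus>\<^bsub>X\<^esub> ((w - v) \<odot>\<^bsub>X\<^esub> ?R w (T ?y))"
    using bounded_ops_simps(1)[OF pencil_bounded[OF H T], of ?y 1 w]
    by (simp add: bounded_ops_simps(2,3)[OF D(2)] del: pencil_apply)
  also have "?R w (pencil X 1 w T ?y) = ?y" by (rule D(3)) simp_all
  finally have "?R w x \<ominus>\<^bsub>X\<^esub> ?y = (w - v) \<odot>\<^bsub>X\<^esub> ?R w (T ?y)"
    by (intro hilbert_eqI[OF H]) (simp_all add: cinner_left[OF H])
  then have "hnorm X (?R w x \<ominus>\<^bsub>X\<^esub> ?y) = cmod (w - v) * hnorm X (?R w (T ?y))"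
    by (simp add: hnorm_smult[OF H])
  also have "\<dots> \<le> cmod (w - v) * (M * (K * (M * hnorm X x)))"
  proof (rule mult_left_mono)
    have "hnorm X (?R w (T ?y)) \<le> M * hnorm X (T ?y)" by (rule M) simp_all
    also have "\<dots> \<le> M * (K * hnorm X ?y)" by (intro mult_left_mono K M) simp_all
    also have "\<dots> \<le> M * (K * (M * hnorm X x))" by (intro mult_left_mono K M) simp_all
    finally show "hnorm X (?R w (T ?y)) \<le> M * (K * (M * hnorm X x))" .
  qed simp
  finally show ?case by (simp add: S_def algebra_simps)
next
  case (Suc j)
  note [simp] = hilbert_closed[OF H] Suc.prems \<eta>_\<Omega>
  let ?L = "M * K * M * cmod (w - v) * hnorm X x"
  have "cmod (w * \<eta> j - v * \<eta> j) = cmod (w - v)"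
    by (simp add: \<eta>_def norm_mult flip: left_diff_distrib)
  then have 1: "hnorm X (S j (w * \<eta> j) x \<ominus>\<^bsub>X\<^esub> S j (v * \<eta> j) x) \<le> ?L"
    using Suc.IH[of "w * \<eta> j" "v * \<eta> j"] by simp
  have 2: "hnorm X (S j w x \<ominus>\<^bsub>X\<^esub> S j v x) \<le> ?L"
    using Suc.IH[of w v] by simp
  have "S (Suc j) w x \<ominus>\<^bsub>X\<^esub> S (Suc j) v x = ((1/2) \<odot>\<^bsub>X\<^esub> (S j w x \<ominus>\<^bsub>X\<^esub> S j v x))
      \<oplus>\<^bsub>X\<^esub> ((1/2) \<odot>\<^bsub>X\<^esub> (S j (w * \<eta> j) x \<ominus>\<^bsub>X\<^esub> S j (v * \<eta> j) x))"
    by (rule hilbert_eqI[OF H]) (simp_all add: S_mean cinner_left[OF H] algebra_simps)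
  then have "hnorm X (S (Suc j) w x \<ominus>\<^bsub>X\<^esub> S (Suc j) v x) \<le> hnorm X ((1/2) \<odot>\<^bsub>X\<^esub> (S j w x \<ominus>\<^bsub>X\<^esub> S j v x))
      + hnorm X ((1/2) \<odot>\<^bsub>X\<^esub> (S j (w * \<eta> j) x \<ominus>\<^bsub>X\<^esub> S j (v * \<eta> j) x))"
    using hnorm_add[OF H] by simp
  also have "\<dots> \<le> ?L" using 1 2 by (simp add: hnorm_smult[OF H])
  finally show ?case .
qed

text \<open>The rate of convergence: \<open>\<parallel>S (j+1) w - S j w\<parallel> \<le> C / 2\<^sup>j\<close>.\<close>

definition C :: real where "C = M * K * M * pi"

lemma S_rot_close:
  assumes w: "w \<in> \<Omega>" and x: "x \<in> carrier X"
  shows "hnorm X (S j (w * \<eta> j) x \<ominus>\<^bsub>X\<^esub> S j w x) \<le> C * hnorm X x / 2 ^ j"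
proof -
  have "hnorm X (S j (w * \<eta> j) x \<ominus>\<^bsub>X\<^esub> S j w x) \<le> M * K * M * cmod (w * \<eta> j - w) * hnorm X x"
    by (rule S_Lipschitz) (simp_all add: \<eta>_\<Omega> w x)
  also have "\<dots> \<le> M * K * M * (pi / 2 ^ j) * hnorm X x"
    by (intro mult_left_mono mult_right_mono \<eta>_close w hnorm_nonneg[OF H x]) (simp add: M K)
  finally show ?thesis by (simp add: C_def)
qed

lemma S_Suc_close:
  assumes w: "w \<in> \<Omega>" and x: "x \<in> carrier X"
  shows "hnorm X (S (Suc j) w x \<ominus>\<^bsub>X\<^esub> S j w x) \<le> C * hnorm X x / 2 ^ j"
proof -
  note [simp] = hilbert_closed[OF H] \<eta>_\<Omega> w x
  have "S (Suc j) w x \<ominus>\<^bsub>X\<^esub> S j w x = (1/2) \<odot>\<^bsub>X\<^esub> (S j (w * \<eta> j) x \<ominus>\<^bsub>X\<^esub> S j w x)"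
    by (rule hilbert_eqI[OF H]) (simp_all add: S_mean cinner_left[OF H] algebra_simps)
  then have "hnorm X (S (Suc j) w x \<ominus>\<^bsub>X\<^esub> S j w x) \<le> hnorm X (S j (w * \<eta> j) x \<ominus>\<^bsub>X\<^esub> S j w x)"
    using hnorm_nonneg[OF H, of "S j (w * \<eta> j) x \<ominus>\<^bsub>X\<^esub> S j w x"] by (simp add: hnorm_smult[OF H])
  also have "\<dots> \<le> C * hnorm X x / 2 ^ j" by (rule S_rot_close[OF w x])
  finally show ?thesis .
qed

text \<open>
  The strong limit of \<open>S j w\<close> as \<open>j\<close> tends to infinity. For \<open>w = 1\<close>, if \<open>1 \<in> \<Omega>\<close>, it is the Riesz
  projection of \<open>T\<close> for the open unit disc.
\<close>

definition P :: "complex \<Rightarrow> 'a \<Rightarrow> 'a"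
  where "P w = (\<lambda>x\<in>carrier X. SOME y. y \<in> carrier X \<and>
    (\<forall>j. hnorm X (S j w x \<ominus>\<^bsub>X\<^esub> y) \<le> 2 * (C * hnorm X x) / 2 ^ j))"

lemma P_lim:
  assumes w: "w \<in> \<Omega>" and x: "x \<in> carrier X"
  shows "P w x \<in> carrier X" "hnorm X (S j w x \<ominus>\<^bsub>X\<^esub> P w x) \<le> 2 * C * hnorm X x / 2 ^ j"
proof -
  obtain y where "y \<in> carrier X" "\<And>j. hnorm X (S j w x \<ominus>\<^bsub>X\<^esub> y) \<le> 2 * (C * hnorm X x) / 2 ^ j"
    using hilbert_complete_geometric[where s = "\<lambda>j. S j w x", OF H S_closed[OF w x] S_Suc_close[OF w x]]
    by blast
  then have "\<exists>y. y \<in> carrier X \<and> (\<forall>j. hnorm X (S j w x \<ominus>\<^bsub>X\<^esub> y) \<le> 2 * (C * hnorm X x) / 2 ^ j)" by blast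
  from someI_ex[OF this] x
  show "P w x \<in> carrier X" "hnorm X (S j w x \<ominus>\<^bsub>X\<^esub> P w x) \<le> 2 * C * hnorm X x / 2 ^ j"
    by (simp_all add: P_def mult.assoc)
qed

lemma P_eqI:
  assumes w: "w \<in> \<Omega>" and x: "x \<in> carrier X" and y: "y \<in> carrier X"
    and le: "\<And>j. hnorm X (S j w x \<ominus>\<^bsub>X\<^esub> y) \<le> c / 2 ^ j"
  shows "P w x = y"
proof (rule hilbert_eq_if_close[OF H P_lim(1)[OF w x] y])
  show "(\<lambda>j. (2 * C * hnorm X x + c) / 2 ^ j) \<longlonglongrightarrow> 0" by real_asymp
  show "hnorm X (P w x \<ominus>\<^bsub>X\<^esub> y) \<le> (2 * C * hnorm X x + c) / 2 ^ j" for j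
    using hnorm_triangle[OF H P_lim(1)[OF w x] S_closed[OF w x] y, of j] P_lim(2)[OF w x, of j] le[of j]
      hnorm_minus_commute[OF H P_lim(1)[OF w x] S_closed[OF w x], of j]
    by (simp add: add_divide_distrib)
qed

lemma P_bounded:
  assumes w: "w \<in> \<Omega>"
  shows "P w \<in> bounded_ops X X"
proof -
  note [simp] = hilbert_closed[OF H] bounded_ops_simps[OF S_bounded[OF w]] w P_lim(1)[OF w]
  have "(\<lambda>x\<in>carrier X. P w x) \<in> bounded_ops X X"
  proof (rule bounded_opsI[OF H, where K = "M + 2 * C"])
    fix x y assume [simp]: "x \<in> carrier X" "y \<in> carrier X"
    show "P w (x \<oplus>\<^bsub>X\<^esub> y) = P w x \<oplus>\<^bsub>X\<^esub> P w y"
    proof (rule P_eqI[where c = "2 * C * hnorm X x + 2 * C * hnorm X y"])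
      fix j
      have "S j w (x \<oplus>\<^bsub>X\<^esub> y) \<ominus>\<^bsub>X\<^esub> (P w x \<oplus>\<^bsub>X\<^esub> P w y) = (S j w x \<ominus>\<^bsub>X\<^esub> P w x) \<oplus>\<^bsub>X\<^esub> (S j w y \<ominus>\<^bsub>X\<^esub> P w y)"
        by (rule hilbert_eqI[OF H]) (simp_all add: cinner_left[OF H])
      then have "hnorm X (S j w (x \<oplus>\<^bsub>X\<^esub> y) \<ominus>\<^bsub>X\<^esub> (P w x \<oplus>\<^bsub>X\<^esub> P w y))
          \<le> hnorm X (S j w x \<ominus>\<^bsub>X\<^esub> P w x) + hnorm X (S j w y \<ominus>\<^bsub>X\<^esub> P w y)"
        using hnorm_add[OF H] by simp
      then show "hnorm X (S j w (x \<oplus>\<^bsub>X\<^esub> y) \<ominus>\<^bsub>X\<^esub> (P w x \<oplus>\<^bsub>X\<^esub> P w y))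
          \<le> (2 * C * hnorm X x + 2 * C * hnorm X y) / 2 ^ j"
        using P_lim(2)[OF w, of x j] P_lim(2)[OF w, of y j] by (simp add: add_divide_distrib)
    qed simp_all
  next
    fix a x assume [simp]: "x \<in> carrier X"
    show "P w (a \<odot>\<^bsub>X\<^esub> x) = a \<odot>\<^bsub>X\<^esub> P w x"
    proof (rule P_eqI[where c = "cmod a * (2 * C * hnorm X x)"])
      fix j
      have "S j w (a \<odot>\<^bsub>X\<^esub> x) \<ominus>\<^bsub>X\<^esub> (a \<odot>\<^bsub>X\<^esub> P w x) = a \<odot>\<^bsub>X\<^esub> (S j w x \<ominus>\<^bsub>X\<^esub> P w x)"
        by (rule hilbert_eqI[OF H]) (simp_all add: cinner_left[OF H] algebra_simps)
      then show "hnorm X (S j w (a \<odot>\<^bsub>X\<^esub> x) \<ominus>\<^bsub>X\<^esub> (a \<odot>\<^bsub>X\<^esub> P w x)) \<le> cmod a * (2 * C * hnorm X x) / 2 ^ j"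
        using mult_left_mono[OF P_lim(2)[OF w, of x j] norm_ge_zero[of a]] by (simp add: hnorm_smult[OF H])
    qed simp_all
  next
    fix x assume [simp]: "x \<in> carrier X"
    have "P w x = S 0 w x \<ominus>\<^bsub>X\<^esub> (S 0 w x \<ominus>\<^bsub>X\<^esub> P w x)"
      by (rule hilbert_eqI[OF H]) (simp_all add: cinner_left[OF H])
    then have "hnorm X (P w x) \<le> hnorm X (S 0 w x) + hnorm X (S 0 w x \<ominus>\<^bsub>X\<^esub> P w x)"
      using hnorm_minus[OF H, of "S 0 w x" "S 0 w x \<ominus>\<^bsub>X\<^esub> P w x"] by simp
    then show "hnorm X (P w x) \<le> (M + 2 * C) * hnorm X x"
      using S_norm[OF w, of x 0] P_lim(2)[OF w, of x 0] by (simp add: distrib_right)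
  qed simp
  moreover have "(\<lambda>x\<in>carrier X. P w x) = P w" unfolding P_def by (rule restrict_restrict[THEN trans]) simp
  ultimately show ?thesis by simp
qed

lemma S_commute:
  assumes w: "w \<in> \<Omega>" and B: "B \<in> bounded_ops X X"
    and comm: "\<And>x. x \<in> carrier X \<Longrightarrow> B (T x) = T (B x)" and x: "x \<in> carrier X"
  shows "B (S j w x) = S j w (B x)"
  unfolding S_def
  by (intro op_inv_commute[OF S_inv[OF w] B] pencil_commute[OF H dyadic_power_bounded[OF H T] B]
      dyadic_power_commute[OF H T B] comm x)

lemma P_commute:
  assumes w: "w \<in> \<Omega>" and B: "B \<in> bounded_ops X X"
    and comm: "\<And>x. x \<in> carrier X \<Longrightarrow> B (T x) = T (B x)" and x: "x \<in> carrier X"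
  shows "B (P w x) = P w (B x)"
proof -
  note [simp] = hilbert_closed[OF H] bounded_ops_simps(1)[OF B] w x P_lim(1)[OF w]
  obtain L where L: "0 < L" "\<And>x. x \<in> carrier X \<Longrightarrow> hnorm X (B x) \<le> L * hnorm X x"
    using bounded_ops_bound[OF B H] by blast
  have "P w (B x) = B (P w x)"
  proof (rule P_eqI[where c = "L * (2 * C * hnorm X x)"])
    fix j
    have "S j w (B x) \<ominus>\<^bsub>X\<^esub> B (P w x) = B (S j w x \<ominus>\<^bsub>X\<^esub> P w x)"
      by (simp add: bounded_ops_group[OF B H H] S_commute[OF w B comm x])
    then have "hnorm X (S j w (B x) \<ominus>\<^bsub>X\<^esub> B (P w x)) \<le> L * hnorm X (S j w x \<ominus>\<^bsub>X\<^esub> P w x)"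
      using L(2) by simp
    also have "\<dots> \<le> L * (2 * C * hnorm X x / 2 ^ j)"
      using L(1) by (intro mult_left_mono P_lim) simp_all
    finally show "hnorm X (S j w (B x) \<ominus>\<^bsub>X\<^esub> B (P w x)) \<le> L * (2 * C * hnorm X x) / 2 ^ j" by simp
  qed simp_all
  then show ?thesis by simp
qed

text \<open>In \<open>S (j+1) w = S j w \<circ> S j (w \<eta>\<^sub>j)\<close> all three operators tend to \<open>P w\<close>.\<close>

lemma P_idem:
  assumes w: "w \<in> \<Omega>" and x: "x \<in> carrier X"
  shows "P w (P w x) = P w x"
proof (rule P_eqI[OF w P_lim(1)[OF w x] P_lim(1)[OF w x], where c = "3 * M * C * hnorm X x + C * hnorm X x"])
  fix j
  note [simp] = hilbert_closed[OF H] w x P_lim(1)[OF w] \<eta>_\<Omega>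
  let ?p = "P w x" and ?t = "S j (w * \<eta> j) x"
  have "hnorm X (?p \<ominus>\<^bsub>X\<^esub> ?t) \<le> hnorm X (?p \<ominus>\<^bsub>X\<^esub> S j w x) + hnorm X (S j w x \<ominus>\<^bsub>X\<^esub> ?t)"
    by (rule hnorm_triangle[OF H]) simp_all
  also have "\<dots> \<le> 3 * C * hnorm X x / 2 ^ j"
    using P_lim(2)[OF w x, of j] S_rot_close[OF w x, of j]
      hnorm_minus_commute[OF H, of ?p "S j w x"] hnorm_minus_commute[OF H, of ?t "S j w x"]
    by simp
  finally have 1: "M * hnorm X (?p \<ominus>\<^bsub>X\<^esub> ?t) \<le> M * (3 * C * hnorm X x / 2 ^ j)"
    by (intro mult_left_mono M)
  have "S j w ?p \<ominus>\<^bsub>X\<^esub> S (Suc j) w x = S j w (?p \<ominus>\<^bsub>X\<^esub> ?t)"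
    by (simp add: S_prod bounded_ops_group[OF S_bounded[OF w] H H])
  then have 2: "hnorm X (S j w ?p \<ominus>\<^bsub>X\<^esub> S (Suc j) w x) \<le> M * (3 * C * hnorm X x / 2 ^ j)"
    using S_norm[OF w, of "?p \<ominus>\<^bsub>X\<^esub> ?t" j] 1 by simp
  have "hnorm X (S j w ?p \<ominus>\<^bsub>X\<^esub> ?p) \<le> hnorm X (S j w ?p \<ominus>\<^bsub>X\<^esub> S (Suc j) w x) + hnorm X (S (Suc j) w x \<ominus>\<^bsub>X\<^esub> ?p)"
    by (rule hnorm_triangle[OF H]) simp_all
  then show "hnorm X (S j w ?p \<ominus>\<^bsub>X\<^esub> ?p) \<le> (3 * M * C * hnorm X x + C * hnorm X x) / 2 ^ j"
    using 2 P_lim(2)[OF w x, of "Suc j"] by (simp add: add_divide_distrib mult.assoc mult.left_commute)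
qed

lemma P_Lipschitz:
  assumes w: "w \<in> \<Omega>" and v: "v \<in> \<Omega>" and x: "x \<in> carrier X"
  shows "hnorm X (P w x \<ominus>\<^bsub>X\<^esub> P v x) \<le> M * K * M * cmod (w - v) * hnorm X x"
proof (rule LIMSEQ_le_const)
  show "(\<lambda>j. M * K * M * cmod (w - v) * hnorm X x + 4 * C * hnorm X x / 2 ^ j)
      \<longlonglongrightarrow> M * K * M * cmod (w - v) * hnorm X x"
    by real_asymp
  note [simp] = w v x P_lim(1)[OF w] P_lim(1)[OF v]
  have "hnorm X (P w x \<ominus>\<^bsub>X\<^esub> P v x) \<le> M * K * M * cmod (w - v) * hnorm X x + 4 * C * hnorm X x / 2 ^ j" for j
    using hnorm_triangle[OF H, of "P w x" "S j w x" "P v x"]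
      hnorm_triangle[OF H, of "S j w x" "S j v x" "P v x"]
      hnorm_minus_commute[OF H, of "P w x" "S j w x"]
      P_lim(2)[OF w x, of j] P_lim(2)[OF v x, of j] S_Lipschitz[OF w v x, of j]
    by simp
  then show "\<exists>N. \<forall>j\<ge>N. hnorm X (P w x \<ominus>\<^bsub>X\<^esub> P v x)
      \<le> M * K * M * cmod (w - v) * hnorm X x + 4 * C * hnorm X x / 2 ^ j"
    by blast
qed

lemma P_locally_constant:
  assumes w: "w \<in> \<Omega>" and v: "v \<in> \<Omega>" and x: "x \<in> carrier X" and close: "M * K * M * cmod (w - v) < 1"
  shows "P w x = P v x"
proof (rule commuting_idempotents_eq[OF H P_bounded[OF w] P_bounded[OF v] P_idem[OF w] P_idem[OF v] _
      P_Lipschitz[OF w v] _ close x])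
  fix x assume x: "x \<in> carrier X"
  have "T (P w x) = P w (T x)" if "x \<in> carrier X" for x by (rule P_commute[OF w T _ that]) simp
  then show "P w (P v x) = P v (P w x)" by (intro P_commute[OF v P_bounded[OF w] _ x]) simp
qed (simp_all add: M(1) K(1))

text \<open>
  If \<open>\<Omega>\<close> contains the disc, then \<open>P w\<close> is constant along the segment from \<open>0\<close> to \<open>1\<close>, and \<open>P 0 = I\<close>.
  Hence \<open>(I - T\<^sup>N)\<^sup>-\<^sup>1\<close> tends to \<open>I\<close> along the powers \<open>N = 2\<^sup>j\<close> for exponentially stable \<open>T\<close>.
\<close>

lemma P_eq_id:
  assumes \<Omega>: "cball 0 1 \<subseteq> \<Omega>" and x: "x \<in> carrier X"
  shows "P 1 x = x"
proof -
  \<comment> \<open>steps of length \<open>1/n\<close> are short enough for the Lipschitz constant \<open>M K M\<close> of \<open>P\<close>\<close>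
  obtain n :: nat where n: "M * K * M < n" using reals_Archimedean2 by blast
  then have n0: "0 < n" using M(1) K(1) by (smt (verit) mult_nonneg_nonneg of_nat_0_less_iff)
  have seg: "of_real (k / n) \<in> \<Omega>" if "k \<le> n" for k :: nat
    using that n0 by (intro subsetD[OF \<Omega>]) (simp add: norm_divide)
  have "P (of_real (k / n)) x = x" if "k \<le> n" for k :: nat
    using that
  proof (induction k)
    case 0
    note [simp] = hilbert_closed[OF H] bounded_ops_simps[OF dyadic_power_bounded[OF H T]] x
    have 0: "0 \<in> \<Omega>" using \<Omega> by auto
    have "S j 0 x = x" for j
    proof -
      have "x = pencil X 1 (0 ^ 2 ^ j) (dyadic_power X T j) x"
        by (rule hilbert_eqI[OF H]) (simp_all add: cinner_left[OF H])
      then show ?thesis using op_invertibleD(3)[OF S_inv[OF 0], of x j] by (simp only: S_def x)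
    qed
    moreover have "x \<ominus>\<^bsub>X\<^esub> x = \<zero>\<^bsub>X\<^esub>" by (rule hilbert_eqI[OF H]) (simp_all add: cinner_left[OF H])
    ultimately show ?case
      by (simp, intro P_eqI[OF 0 x x, where c = 0]) (simp add: hnorm_zero[OF H])
  next
    case (Suc k)
    have "cmod (of_real (Suc k / n) - of_real (k / n)) = 1 / n"
      using n0 by (simp add: add_divide_distrib norm_divide)
    then have "P (of_real (Suc k / n)) x = P (of_real (k / n)) x"
      using Suc.prems n n0 by (intro P_locally_constant seg x) simp_all
    then show ?case using Suc by simp
  qed
  from this[of n] show ?thesis using n0 by simp
qed

end

section \<open>Uniform bounds for the resolvent\<close>

lemma op_invertible_compose:
  assumes H: "complex_hilbert X" and S: "op_invertible X S" and T: "op_invertible X T"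
  shows "op_invertible X (\<lambda>x\<in>carrier X. S (T x))"
proof -
  note DS = op_invertibleD[OF S] and DT = op_invertibleD[OF T]
  note [simp] = bounded_ops_simps(1)[OF DS(1)] bounded_ops_simps(1)[OF DS(2)]
    bounded_ops_simps(1)[OF DT(1)] bounded_ops_simps(1)[OF DT(2)]
  show ?thesis
    by (rule op_invertibleI(1)[OF bounded_ops_compose[OF DS(1) DT(1) H H]
          bounded_ops_compose[OF DT(2) DS(2) H H]]) (simp_all add: DS DT)
qed

lemma op_invertible_scale:
  assumes H: "complex_hilbert X" and c: "c \<noteq> 0"
  shows "op_invertible X (\<lambda>x\<in>carrier X. c \<odot>\<^bsub>X\<^esub> x)"
proof -
  note [simp] = hilbert_closed[OF H]
  have "(\<lambda>x\<in>carrier X. a \<odot>\<^bsub>X\<^esub> x) \<in> bounded_ops X X" for a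
  proof (rule bounded_opsI[OF H, where K = "cmod a"])
    fix x y assume [simp]: "x \<in> carrier X" "y \<in> carrier X"
    show "a \<odot>\<^bsub>X\<^esub> (x \<oplus>\<^bsub>X\<^esub> y) = a \<odot>\<^bsub>X\<^esub> x \<oplus>\<^bsub>X\<^esub> a \<odot>\<^bsub>X\<^esub> y"
      by (rule hilbert_eqI[OF H]) (simp_all add: cinner_left[OF H] algebra_simps)
  next
    fix b x assume [simp]: "x \<in> carrier X"
    show "a \<odot>\<^bsub>X\<^esub> (b \<odot>\<^bsub>X\<^esub> x) = b \<odot>\<^bsub>X\<^esub> (a \<odot>\<^bsub>X\<^esub> x)"
      by (rule hilbert_eqI[OF H]) (simp_all add: cinner_left[OF H])
  qed (simp_all add: hnorm_smult[OF H])
  moreover have "a \<odot>\<^bsub>X\<^esub> (b \<odot>\<^bsub>X\<^esub> x) = x" if "a * b = 1" "x \<in> carrier X" for a b x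
    by (rule hilbert_eqI[OF H])
      (use that in \<open>simp_all add: cinner_left[OF H] flip: mult.assoc\<close>)
  ultimately show ?thesis
    using c by (intro op_invertibleI(1)[where S = "\<lambda>x\<in>carrier X. (1 / c) \<odot>\<^bsub>X\<^esub> x"]) simp_all
qed

lemma op_invertible_scaled:
  assumes H: "complex_hilbert X" and c: "c \<noteq> 0" and S: "op_invertible X S"
    and T: "T \<in> extensional (carrier X)" "\<And>x. x \<in> carrier X \<Longrightarrow> T x = c \<odot>\<^bsub>X\<^esub> S x"
  shows "op_invertible X T"
proof -
  have "T = (\<lambda>x\<in>carrier X. (\<lambda>x\<in>carrier X. c \<odot>\<^bsub>X\<^esub> x) (S x))"
    using T bounded_ops_simps(1)[OF op_invertibleD(1)[OF S]] by (auto simp: extensional_def)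
  then show ?thesis using op_invertible_compose[OF H op_invertible_scale[OF H c] S] by simp
qed

lemma pencil_extensional: "pencil X u v T \<in> extensional (carrier X)"
  by (simp add: pencil_def)

lemma op_invertible_pencil_scaled:
  assumes H: "complex_hilbert X" and T: "T \<in> bounded_ops X X" and c: "c \<noteq> 0"
    and inv: "op_invertible X (pencil X u v T)"
  shows "op_invertible X (pencil X (c * u) (c * v) T)"
proof (rule op_invertible_scaled[OF H c inv pencil_extensional])
  note [simp] = hilbert_closed[OF H] bounded_ops_simps[OF T]
  fix x assume [simp]: "x \<in> carrier X"
  show "pencil X (c * u) (c * v) T x = c \<odot>\<^bsub>X\<^esub> pencil X u v T x"
    by (rule hilbert_eqI[OF H]) (simp_all add: cinner_left[OF H] algebra_simps)
qed

text \<open>The identity behind this is \<open>v I - u T = - T (u I - v T\<^sup>-\<^sup>1)\<close>.\<close>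

lemma op_invertible_pencil_op_inv:
  assumes H: "complex_hilbert X" and T: "op_invertible X T"
  shows "op_invertible X (pencil X u v (op_inv X T)) \<longleftrightarrow> op_invertible X (pencil X v u T)"
proof -
  have imp: "op_invertible X (pencil X v u T)"
    if T: "op_invertible X T" and inv: "op_invertible X (pencil X u v (op_inv X T))" for T u v
  proof (rule op_invertible_scaled[OF H _ op_invertible_compose[OF H T inv] pencil_extensional, of "- 1"])
    note D = op_invertibleD[OF T]
    note [simp] = hilbert_closed[OF H] bounded_ops_simps[OF D(1)] bounded_ops_simps[OF D(2)]
      bounded_ops_group[OF D(1) H H] D(3,4)
    fix x assume [simp]: "x \<in> carrier X"
    show "pencil X v u T x = (- 1) \<odot>\<^bsub>X\<^esub> (\<lambda>x\<in>carrier X. T (pencil X u v (op_inv X T) x)) x"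
      by (rule hilbert_eqI[OF H]) (simp_all add: cinner_left[OF H] algebra_simps)
  qed simp
  show ?thesis
    using imp[OF T] imp[OF op_invertible_op_inv(1)[OF T], of v u] op_invertible_op_inv(2)[OF T] by auto
qed

text \<open>An a priori bound for the resolvent near a point at which it is bounded.\<close>

lemma resolvent_bound_near:
  assumes H: "complex_hilbert X" and T: "T \<in> bounded_ops X X"
    and inv: "op_invertible X (pencil X 1 w T)" "op_invertible X (pencil X 1 v T)"
    and N: "0 \<le> N" "\<And>x. x \<in> carrier X \<Longrightarrow> hnorm X (op_inv X (pencil X 1 w T) x) \<le> N * hnorm X x"
    and K: "\<And>x. x \<in> carrier X \<Longrightarrow> hnorm X (T x) \<le> K * hnorm X x"
    and close: "cmod (v - w) * (N * K) \<le> 1 / 2" and x: "x \<in> carrier X"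
  shows "hnorm X (op_inv X (pencil X 1 v T) x) \<le> 2 * N * hnorm X x"
proof -
  note D = op_invertibleD[OF inv(1)] and D' = op_invertibleD[OF inv(2)]
  note [simp] = hilbert_closed[OF H] bounded_ops_simps[OF T] bounded_ops_simps(1)[OF D(2)] bounded_ops_simps(1)[OF D'(2)] x
  let ?y = "op_inv X (pencil X 1 v T) x"
  have "pencil X 1 w T ?y = pencil X 1 v T ?y \<oplus>\<^bsub>X\<^esub> ((v - w) \<odot>\<^bsub>X\<^esub> T ?y)"
    by (rule hilbert_eqI[OF H]) (simp_all add: cinner_left[OF H] algebra_simps)
  also have "pencil X 1 v T ?y = x" by (rule D'(4)) simp
  finally have "?y = op_inv X (pencil X 1 w T) (x \<oplus>\<^bsub>X\<^esub> ((v - w) \<odot>\<^bsub>X\<^esub> T ?y))"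
    using D(3)[of ?y] by simp
  then have "hnorm X ?y \<le> N * hnorm X (x \<oplus>\<^bsub>X\<^esub> ((v - w) \<odot>\<^bsub>X\<^esub> T ?y))"
    using N(2)[of "x \<oplus>\<^bsub>X\<^esub> ((v - w) \<odot>\<^bsub>X\<^esub> T ?y)"] by simp
  also have "\<dots> \<le> N * (hnorm X x + cmod (v - w) * (K * hnorm X ?y))"
  proof (rule mult_left_mono[OF _ N(1)])
    have "hnorm X (x \<oplus>\<^bsub>X\<^esub> ((v - w) \<odot>\<^bsub>X\<^esub> T ?y)) \<le> hnorm X x + cmod (v - w) * hnorm X (T ?y)"
      using hnorm_add[OF H, of x "(v - w) \<odot>\<^bsub>X\<^esub> T ?y"] by (simp add: hnorm_smult[OF H])
    also have "\<dots> \<le> hnorm X x + cmod (v - w) * (K * hnorm X ?y)"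
      by (intro add_left_mono mult_left_mono K) simp_all
    finally show "hnorm X (x \<oplus>\<^bsub>X\<^esub> ((v - w) \<odot>\<^bsub>X\<^esub> T ?y)) \<le> hnorm X x + cmod (v - w) * (K * hnorm X ?y)" .
  qed
  also have "\<dots> = N * hnorm X x + cmod (v - w) * (N * K) * hnorm X ?y" by (simp add: algebra_simps)
  also have "\<dots> \<le> N * hnorm X x + 1 / 2 * hnorm X ?y"
    by (intro add_left_mono mult_right_mono close hnorm_nonneg[OF H]) simp
  finally show ?thesis by simp
qed

lemma resolvent_bound_compact:
  assumes H: "complex_hilbert X" and T: "T \<in> bounded_ops X X" and \<Omega>: "compact \<Omega>"
    and inv: "\<And>w. w \<in> \<Omega> \<Longrightarrow> op_invertible X (pencil X 1 w T)"
  obtains M where "0 \<le> M" "\<And>w x. w \<in> \<Omega> \<Longrightarrow> x \<in> carrier X \<Longrightarrow>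
      hnorm X (op_inv X (pencil X 1 w T) x) \<le> M * hnorm X x"
proof -
  obtain K where K: "0 < K" "\<And>x. x \<in> carrier X \<Longrightarrow> hnorm X (T x) \<le> K * hnorm X x"
    using bounded_ops_bound[OF T H] by blast
  have "\<exists>N>0. \<forall>x\<in>carrier X. hnorm X (op_inv X (pencil X 1 w T) x) \<le> N * hnorm X x" if "w \<in> \<Omega>" for w
    using bounded_ops_bound[OF op_invertibleD(2)[OF inv[OF that]] H] by metis
  then obtain N where N: "\<And>w. w \<in> \<Omega> \<Longrightarrow> N w > 0"
    "\<And>w x. w \<in> \<Omega> \<Longrightarrow> x \<in> carrier X \<Longrightarrow> hnorm X (op_inv X (pencil X 1 w T) x) \<le> N w * hnorm X x"
    by metis
  define r where "r w = 1 / (2 * (N w * K))" for w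
  have "\<Omega> \<subseteq> (\<Union>w\<in>\<Omega>. ball w (r w))" using N(1) K(1) by (force simp: r_def)
  then obtain F where F: "F \<subseteq> \<Omega>" "finite F" "\<Omega> \<subseteq> (\<Union>w\<in>F. ball w (r w))"
    using compactE_image[OF \<Omega>, of \<Omega> "\<lambda>w. ball w (r w)"] by auto
  define M where "M = (\<Sum>w\<in>F. 2 * N w)"
  have le: "2 * N w \<le> M" if "w \<in> F" for w
    unfolding M_def by (rule member_le_sum[OF that]) (use F N(1) in \<open>auto simp: less_imp_le\<close>)
  have "hnorm X (op_inv X (pencil X 1 v T) x) \<le> M * hnorm X x" if v: "v \<in> \<Omega>" and x: "x \<in> carrier X" for v x
  proof -
    obtain w where w: "w \<in> F" "v \<in> ball w (r w)" using F(3) v by blast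
    have wO: "w \<in> \<Omega>" using w F by blast
    have "cmod (v - w) \<le> r w" using w by (simp add: dist_norm norm_minus_commute)
    then have "cmod (v - w) * (N w * K) \<le> r w * (N w * K)"
      using N(1)[OF wO] K(1) by (intro mult_right_mono) simp_all
    also have "\<dots> = 1 / 2" using N(1)[OF wO] K(1) by (simp add: r_def)
    finally have "hnorm X (op_inv X (pencil X 1 v T) x) \<le> 2 * N w * hnorm X x"
      using N[OF wO] K by (intro resolvent_bound_near[OF H T inv[OF wO] inv[OF v]] x) simp_all
    also have "\<dots> \<le> M * hnorm X x" by (intro mult_right_mono le w hnorm_nonneg[OF H x])
    finally show ?thesis .
  qed
  moreover have "0 \<le> M" unfolding M_def by (rule sum_nonneg) (use F N(1) in \<open>auto simp: less_imp_le\<close>)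
  ultimately show ?thesis using that by blast
qed

lemma op_invertible_pencil_zero:
  assumes H: "complex_hilbert X" and T: "T \<in> bounded_ops X X"
  shows "op_invertible X (pencil X 1 0 T)" "x \<in> carrier X \<Longrightarrow> op_inv X (pencil X 1 0 T) x = x"
proof -
  have "pencil X 1 0 T x = x" if "x \<in> carrier X" for x
    by (rule hilbert_eqI[OF H])
      (use that in \<open>simp_all add: cinner_left[OF H] hilbert_closed[OF H] bounded_ops_simps[OF T]\<close>)
  then have eq: "pencil X 1 0 T = (\<lambda>x\<in>carrier X. x)"
    by (intro bounded_ops_ext[OF pencil_bounded[OF H T] bounded_ops_id[OF H]]) (simp del: pencil_apply)
  note I = op_invertibleI[OF bounded_ops_id[OF H] bounded_ops_id[OF H]]
  show "op_invertible X (pencil X 1 0 T)" unfolding eq by (rule I(1)) simp_all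
  show "x \<in> carrier X \<Longrightarrow> op_inv X (pencil X 1 0 T) x = x" unfolding eq by (subst I(2)) simp_all
qed

lemma op_invertible_pencil_of_spectrum:
  assumes H: "complex_hilbert X" and T: "T \<in> bounded_ops X X"
    and w: "w \<noteq> 0" "inverse w \<notin> op_spectrum X T"
  shows "op_invertible X (pencil X 1 w T)"
proof -
  have "op_invertible X (pencil X (inverse w) 1 T)"
    using w(2) scalar_minus_op_pencil[OF H T] by (simp add: op_spectrum_def)
  from op_invertible_pencil_scaled[OF H T w(1) this] show ?thesis using w(1) by simp
qed

lemma resolvent_family_circle:
  assumes H: "complex_hilbert X" and T: "T \<in> bounded_ops X X"
    and spec: "op_spectrum X T \<inter> sphere 0 1 = {}"
  obtains M K where "resolvent_family X T (sphere 0 1) M K"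
proof -
  have inv: "op_invertible X (pencil X 1 w T)" if "w \<in> sphere 0 1" for w
    using that spec by (intro op_invertible_pencil_of_spectrum[OF H T])
      (auto simp: disjoint_iff norm_inverse)
  obtain M where M: "0 \<le> M" "\<And>w x. w \<in> sphere 0 1 \<Longrightarrow> x \<in> carrier X \<Longrightarrow>
      hnorm X (op_inv X (pencil X 1 w T) x) \<le> M * hnorm X x"
    using resolvent_bound_compact[OF H T compact_sphere inv] by blast
  obtain K where K: "0 < K" "\<And>x. x \<in> carrier X \<Longrightarrow> hnorm X (T x) \<le> K * hnorm X x"
    using bounded_ops_bound[OF T H] by blast
  have "resolvent_family X T (sphere 0 1) M K"
    by (rule resolvent_family.intro) (use H T M K inv in \<open>auto simp: norm_mult\<close>)
  then show ?thesis by (rule that)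
qed

lemma resolvent_family_disc:
  assumes H: "complex_hilbert X" and T: "exponentially_stable X T"
  obtains M K where "resolvent_family X T (cball 0 1) M K"
proof -
  have T': "T \<in> bounded_ops X X" and spec: "op_spectrum X T \<subseteq> ball 0 1"
    using T by (auto simp: exponentially_stable_def)
  have inv: "op_invertible X (pencil X 1 w T)" if w: "w \<in> cball 0 1" for w
  proof (cases "w = 0")
    case False
    have "inverse w \<notin> ball 0 1"
      using w False one_le_inverse[of "cmod w"] by (simp add: norm_inverse)
    then show ?thesis using spec by (intro op_invertible_pencil_of_spectrum[OF H T' False]) blast
  qed (simp add: op_invertible_pencil_zero[OF H T'])
  obtain M where M: "0 \<le> M" "\<And>w x. w \<in> cball 0 1 \<Longrightarrow> x \<in> carrier X \<Longrightarrow>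
      hnorm X (op_inv X (pencil X 1 w T) x) \<le> M * hnorm X x"
    using resolvent_bound_compact[OF H T' compact_cball inv] by blast
  obtain K where K: "0 < K" "\<And>x. x \<in> carrier X \<Longrightarrow> hnorm X (T x) \<le> K * hnorm X x"
    using bounded_ops_bound[OF T' H] by blast
  have "resolvent_family X T (cball 0 1) M K"
    by (rule resolvent_family.intro) (use H T' M K inv in \<open>auto simp: norm_mult\<close>)
  then show ?thesis by (rule that)
qed

section \<open>Completeness and closed subspaces\<close>

text \<open>Completeness is transferred along an isometric bijection onto a complete metric space.\<close>

lemma hdist_of_isometry:
  assumes MS: "Metric_space M d" and bij: "bij_betw g (carrier Y) M"
    and iso: "\<And>x y. x \<in> carrier Y \<Longrightarrow> y \<in> carrier Y \<Longrightarrow> hdist Y x y = d (g x) (g y)"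
  shows "Metric_space (carrier Y) (hdist Y)"
    and "Metric_space.mcomplete M d \<Longrightarrow> Metric_space.mcomplete (carrier Y) (hdist Y)"
proof -
  interpret A: Metric_space M d by fact
  have g: "g x \<in> M" if "x \<in> carrier Y" for x using bij that by (auto simp: bij_betw_def)
  have inj: "g x = g y \<longleftrightarrow> x = y" if "x \<in> carrier Y" "y \<in> carrier Y" for x y
    using bij that by (auto simp: bij_betw_def inj_on_def)
  interpret B: Metric_space "carrier Y" "hdist Y"
  proof
    fix x y z
    have off: "hdist Y x y = 0" if "\<not> (x \<in> carrier Y \<and> y \<in> carrier Y)" for x y
      using that by (auto simp: hdist_def)
    show "0 \<le> hdist Y x y"
      by (cases "x \<in> carrier Y \<and> y \<in> carrier Y") (simp_all add: iso off)
    show "hdist Y x y = hdist Y y x"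
      by (cases "x \<in> carrier Y \<and> y \<in> carrier Y") (auto simp: iso off A.commute)
    show "x \<in> carrier Y \<Longrightarrow> y \<in> carrier Y \<Longrightarrow> hdist Y x y = 0 \<longleftrightarrow> x = y"
      by (simp add: iso g inj)
    show "x \<in> carrier Y \<Longrightarrow> y \<in> carrier Y \<Longrightarrow> z \<in> carrier Y \<Longrightarrow> hdist Y x z \<le> hdist Y x y + hdist Y y z"
      by (simp add: iso g A.triangle)
  qed
  show "Metric_space (carrier Y) (hdist Y)" by (rule B.Metric_space_axioms)
  assume complete: "A.mcomplete"
  show "B.mcomplete"
    unfolding B.mcomplete_def
  proof (intro allI impI)
    fix s assume s: "B.MCauchy s"
    then have sc: "s n \<in> carrier Y" for n by (auto simp: B.MCauchy_def)
    have "A.MCauchy (g \<circ> s)"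
      using s by (auto simp: B.MCauchy_def A.MCauchy_def iso sc g)
    then obtain l where l: "limitin A.mtopology (g \<circ> s) l sequentially"
      using complete A.mcomplete_def by blast
    then have "l \<in> M" by (simp add: A.limit_metric_sequentially)
    then obtain x where x: "x \<in> carrier Y" "g x = l" using bij by (auto simp: bij_betw_def)
    have "limitin B.mtopology s x sequentially"
      unfolding B.limit_metric_sequentially
      using l[unfolded A.limit_metric_sequentially] by (simp add: iso sc x g)
    then show "\<exists>x. limitin B.mtopology s x sequentially" by blast
  qed
qed

lemma subspace_of_simps [simp]:
  "carrier (subspace_of X S) = S" "cinner (subspace_of X S) = cinner X"
  "zero (subspace_of X S) = zero X" "add (subspace_of X S) = add X"
  "smult (subspace_of X S) = smult X" "hnorm (subspace_of X S) = hnorm X"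
  by (simp_all add: subspace_of_def hnorm_def fun_eq_iff)

lemma closed_subspaceD:
  assumes H: "complex_hilbert X" and S: "closed_subspace X S"
  shows "S \<subseteq> carrier X" "\<zero>\<^bsub>X\<^esub> \<in> S" "x \<in> S \<Longrightarrow> y \<in> S \<Longrightarrow> x \<oplus>\<^bsub>X\<^esub> y \<in> S"
    "x \<in> S \<Longrightarrow> a \<odot>\<^bsub>X\<^esub> x \<in> S" "x \<in> S \<Longrightarrow> \<ominus>\<^bsub>X\<^esub> x \<in> S" "x \<in> S \<Longrightarrow> y \<in> S \<Longrightarrow> x \<ominus>\<^bsub>X\<^esub> y \<in> S"
proof -
  interpret module complex_ring X by (rule hilbert_module[OF H])
  have "submodule S complex_ring X" using S by (simp add: closed_subspace_def)
  note E = submoduleE[OF this]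
  show 1: "S \<subseteq> carrier X" "x \<in> S \<Longrightarrow> a \<odot>\<^bsub>X\<^esub> x \<in> S" and neg: "\<And>x. x \<in> S \<Longrightarrow> \<ominus>\<^bsub>X\<^esub> x \<in> S"
    and add: "\<And>x y. x \<in> S \<Longrightarrow> y \<in> S \<Longrightarrow> x \<oplus>\<^bsub>X\<^esub> y \<in> S"
    using E by simp_all
  show diff: "x \<ominus>\<^bsub>X\<^esub> y \<in> S" if "x \<in> S" "y \<in> S" for x y
    using that neg add by (simp add: a_minus_def)
  obtain x where x: "x \<in> S" using E(2) by blast
  have "x \<ominus>\<^bsub>X\<^esub> x = \<zero>\<^bsub>X\<^esub>" using x 1(1) by (auto simp: M.r_neg a_minus_def)
  then show "\<zero>\<^bsub>X\<^esub> \<in> S" using diff[OF x x] by simp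
qed

lemma subspace_of_minus:
  assumes H: "complex_hilbert X" and S: "closed_subspace X S"
  shows "x \<in> S \<Longrightarrow> \<ominus>\<^bsub>subspace_of X S\<^esub> x = \<ominus>\<^bsub>X\<^esub> x"
    and "x \<in> S \<Longrightarrow> y \<in> S \<Longrightarrow> x \<ominus>\<^bsub>subspace_of X S\<^esub> y = x \<ominus>\<^bsub>X\<^esub> y"
proof -
  have "module complex_ring (subspace_of X S)"
    unfolding subspace_of_def
    using S hilbert_module[OF H] by (intro submodule.submodule_is_module) (auto simp: closed_subspace_def)
  then interpret Y: abelian_group "subspace_of X S" by (rule module.axioms(2))
  note D = closed_subspaceD[OF H S]
  show neg: "\<ominus>\<^bsub>subspace_of X S\<^esub> x = \<ominus>\<^bsub>X\<^esub> x" if "x \<in> S" for x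
    using that D abelian_group.l_neg[OF module.axioms(2)[OF hilbert_module[OF H]]]
    by (intro Y.minus_equality) auto
  show "x \<in> S \<Longrightarrow> y \<in> S \<Longrightarrow> x \<ominus>\<^bsub>subspace_of X S\<^esub> y = x \<ominus>\<^bsub>X\<^esub> y"
    by (simp add: a_minus_def neg)
qed

lemma subspace_of_hilbert:
  assumes H: "complex_hilbert X" and S: "closed_subspace X S"
  shows "complex_hilbert (subspace_of X S)"
proof -
  interpret X: complex_hilbert X by fact
  interpret A: Metric_space "carrier X" "hdist X" by (rule X.hdist_Metric_space)
  note D = closed_subspaceD[OF H S]
  interpret Submetric "carrier X" "hdist X" S
    by unfold_locales (rule D)
  have "Metric_space.mcomplete S (hdist X)"
    using S X.complete by (intro closedin_mcomplete_imp_mcomplete) (simp_all add: closed_subspace_def)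
  then have complete: "Metric_space.mcomplete (carrier (subspace_of X S)) (hdist (subspace_of X S))"
    by (intro hdist_of_isometry(2)[OF sub.Metric_space_axioms, of id])
      (use D(1) in \<open>auto simp: hdist_def subspace_of_minus[OF H S]\<close>)
  have "module complex_ring (subspace_of X S)"
    unfolding subspace_of_def
    using S hilbert_module[OF H] by (intro submodule.submodule_is_module) (auto simp: closed_subspace_def)
  moreover have "complex_hilbert_axioms (subspace_of X S)"
  proof (rule complex_hilbert_axioms.intro, unfold subspace_of_simps)
    show "Metric_space.mcomplete S (hdist (subspace_of X S))" using complete by simp
  next
    fix a x y assume "x \<in> S" "y \<in> S"
    then show "cinner X (a \<odot>\<^bsub>X\<^esub> x) y = a * cinner X x y"
      using D(1) X.cinner_smult_left by blast
    show "cinner X x y = cnj (cinner X y x)"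
      using D(1) X.cinner_commute \<open>x \<in> S\<close> \<open>y \<in> S\<close> by blast
  next
    fix x y z assume "x \<in> S" "y \<in> S" "z \<in> S"
    then show "cinner X (x \<oplus>\<^bsub>X\<^esub> y) z = cinner X x z + cinner X y z"
      using D(1) X.cinner_add_left by blast
  next
    fix x assume "x \<in> S"
    then show "0 \<le> Re (cinner X x x)" "cinner X x x = 0 \<Longrightarrow> x = \<zero>\<^bsub>X\<^esub>"
      using D(1) X.cinner_nonneg X.cinner_definite by blast+
  qed
  ultimately show ?thesis by (rule complex_hilbert.intro)
qed

lemma bounded_ops_restrict:
  assumes H: "complex_hilbert X" and T: "T \<in> bounded_ops X Y" and S: "closed_subspace X S"
  shows "restrict T S \<in> bounded_ops (subspace_of X S) Y"
proof -
  obtain K where K: "\<And>x. x \<in> carrier X \<Longrightarrow> hnorm Y (T x) \<le> K * hnorm X x"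
    using bounded_ops_bound[OF T H] by metis
  have S': "x \<in> carrier X" if "x \<in> S" for x using closed_subspaceD(1)[OF H S] that by blast
  show ?thesis
    by (rule bounded_opsI[OF subspace_of_hilbert[OF H S], unfolded subspace_of_simps, where K = K])
      (simp_all add: S' K bounded_ops_simps[OF T])
qed

lemma bounded_ops_into_subspace:
  assumes T: "T \<in> bounded_ops Y X" and S: "\<And>x. x \<in> carrier Y \<Longrightarrow> T x \<in> S"
  shows "T \<in> bounded_ops Y (subspace_of X S)"
  using T S by (auto simp: bounded_ops_def)

lemma bounded_ops_on_subspace:
  assumes H: "complex_hilbert X" and T: "T \<in> bounded_ops X X" and S: "closed_subspace X S"
    and inv: "\<And>x. x \<in> S \<Longrightarrow> T x \<in> S"
  shows "restrict T S \<in> bounded_ops (subspace_of X S) (subspace_of X S)"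
  by (rule bounded_ops_into_subspace[OF bounded_ops_restrict[OF H T S]]) (simp add: inv)

lemma kernel_closed_subspace:
  assumes H: "complex_hilbert X" and Q: "Q \<in> bounded_ops X X"
  shows "closed_subspace X {x \<in> carrier X. Q x = \<zero>\<^bsub>X\<^esub>}"
proof -
  interpret X: complex_hilbert X by fact
  interpret A: Metric_space "carrier X" "hdist X" by (rule X.hdist_Metric_space)
  note [simp] = bounded_ops_simps[OF Q] bounded_ops_group[OF Q H H]
  have z: "a \<odot>\<^bsub>X\<^esub> \<zero>\<^bsub>X\<^esub> = \<zero>\<^bsub>X\<^esub>" for a
    by (rule hilbert_eqI[OF H]) (simp_all add: cinner_left[OF H] hilbert_closed[OF H])
  have sub: "submodule {x \<in> carrier X. Q x = \<zero>\<^bsub>X\<^esub>} complex_ring X"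
    by (rule X.submoduleI) (auto simp: z)
  obtain K where K: "0 < K" "\<And>x. x \<in> carrier X \<Longrightarrow> hnorm X (Q x) \<le> K * hnorm X x"
    using bounded_ops_bound[OF Q H] by blast
  have "closedin A.mtopology {x \<in> carrier X. Q x = \<zero>\<^bsub>X\<^esub>}"
    unfolding A.metric_closedin_iff_sequentially_closed
  proof (intro conjI allI impI)
    fix s l assume "range s \<subseteq> {x \<in> carrier X. Q x = \<zero>\<^bsub>X\<^esub>} \<and> limitin A.mtopology s l sequentially"
    then have s: "\<And>n. s n \<in> carrier X" "\<And>n. Q (s n) = \<zero>\<^bsub>X\<^esub>" and l: "l \<in> carrier X"
      and lim: "\<And>e. e > 0 \<Longrightarrow> \<exists>N. \<forall>n\<ge>N. hdist X (s n) l < e"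
      by (force simp: A.limit_metric_sequentially)+
    note [simp] = s l
    have "hnorm X (Q l) \<le> 0 + e" if "e > 0" for e
    proof -
      obtain n where n: "hdist X (s n) l < e / K" using lim[of "e / K"] \<open>e > 0\<close> K(1) by auto
      have "Q (s n \<ominus>\<^bsub>X\<^esub> l) = \<ominus>\<^bsub>X\<^esub> Q l" by (rule hilbert_eqI[OF H]) (simp_all add: cinner_left[OF H])
      then have "hnorm X (Q l) \<le> K * hnorm X (s n \<ominus>\<^bsub>X\<^esub> l)"
        using K(2)[of "s n \<ominus>\<^bsub>X\<^esub> l"] by (simp add: hnorm_neg[OF H])
      also have "\<dots> \<le> K * (e / K)" using n K(1) by (intro mult_left_mono) (simp_all add: hdist_def)
      finally show ?thesis using K(1) by simp
    qed
    then have "hnorm X (Q l) \<le> 0" by (rule field_le_epsilon)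
    then have "Q l = \<zero>\<^bsub>X\<^esub>" using hnorm_eq_0_iff[OF H, of "Q l"] hnorm_nonneg[OF H, of "Q l"] by simp
    then show "l \<in> {x \<in> carrier X. Q x = \<zero>\<^bsub>X\<^esub>}" by simp
  qed auto
  then show ?thesis using sub by (simp add: closed_subspace_def)
qed

section \<open>The spectral decomposition\<close>

lemma dyadic_power_subspace:
  assumes "\<forall>x\<in>S. T x \<in> S" "S \<subseteq> carrier X" "x \<in> S"
  shows "dyadic_power (subspace_of X S) (restrict T S) j x = dyadic_power X T j x"
    and "dyadic_power X T j x \<in> S"
proof -
  have "dyadic_power (subspace_of X S) (restrict T S) j x = dyadic_power X T j x \<and> dyadic_power X T j x \<in> S"
    using assms(3)
  proof (induction j arbitrary: x)
    case (Suc j)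
    then show ?case using assms(2) by auto
  qed (simp add: assms)
  then show "dyadic_power (subspace_of X S) (restrict T S) j x = dyadic_power X T j x"
    "dyadic_power X T j x \<in> S" by blast+
qed

lemma dyadic_power_op_inv:
  assumes H: "complex_hilbert X" and T: "op_invertible X T"
  shows "x \<in> carrier X \<Longrightarrow> dyadic_power X T j (dyadic_power X (op_inv X T) j x) = x"
proof (induction j arbitrary: x)
  case (Suc j)
  then show ?case
    using bounded_ops_simps(1)[OF dyadic_power_bounded[OF H op_invertibleD(2)[OF T]]] by simp
qed (simp add: op_invertibleD[OF T])

lemma pencil_subspace:
  assumes H: "complex_hilbert X" and S: "closed_subspace X S" and x: "x \<in> S" "T' x = T x" "T x \<in> S"
  shows "pencil (subspace_of X S) u v T' x = pencil X u v T x"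
  using x closed_subspaceD[OF H S] by (auto simp: pencil_def subspace_of_minus[OF H S])

context resolvent_family
begin

lemma S_pencil:
  assumes "w \<in> \<Omega>" "x \<in> carrier X"
  shows "S j w (pencil X 1 (w ^ 2 ^ j) (dyadic_power X T j) x) = x"
    and "pencil X 1 (w ^ 2 ^ j) (dyadic_power X T j) (S j w x) = x"
  unfolding S_def using op_invertibleD(3,4)[OF S_inv[OF assms(1)] assms(2)] by blast+

lemma S_eq: "w \<in> \<Omega> \<Longrightarrow> x \<in> carrier X \<Longrightarrow>
    S j w x \<ominus>\<^bsub>X\<^esub> ((w ^ 2 ^ j) \<odot>\<^bsub>X\<^esub> dyadic_power X T j (S j w x)) = x"
  using S_pencil(2)[of w x j] by (simp add: hilbert_smult_one[OF H])

text \<open>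
  With \<open>N = 2\<^sup>j\<close> and \<open>E = S j 1\<close> one has \<open>(u\<^sup>N I - v\<^sup>N T\<^sup>N) E = (u\<^sup>N - v\<^sup>N) E + v\<^sup>N I\<close>.
  If this is close to the identity on an invariant subspace, then \<open>u I - v T\<close> is invertible there.
\<close>

lemma pencil_invertible_on_subspace:
  assumes Z: "closed_subspace X Z" and TZ: "\<And>x. x \<in> Z \<Longrightarrow> T x \<in> Z"
    and 1: "1 \<in> \<Omega>" and EZ: "\<And>x. x \<in> Z \<Longrightarrow> S j 1 x \<in> Z"
    and near: "\<And>x. x \<in> Z \<Longrightarrow> hnorm X
      (x \<ominus>\<^bsub>X\<^esub> (((u ^ 2 ^ j - v ^ 2 ^ j) \<odot>\<^bsub>X\<^esub> S j 1 x) \<oplus>\<^bsub>X\<^esub> (v ^ 2 ^ j \<odot>\<^bsub>X\<^esub> x))) \<le> hnorm X x / 2"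
  shows "op_invertible (subspace_of X Z) (pencil (subspace_of X Z) u v (restrict T Z))"
proof -
  let ?Y = "subspace_of X Z" and ?N = "2 ^ j :: nat"
  let ?T = "restrict T Z" and ?E = "restrict (S j 1) Z"
  note D = closed_subspaceD[OF H Z]
  have HY: "complex_hilbert ?Y" by (rule subspace_of_hilbert[OF H Z])
  have T': "?T \<in> bounded_ops ?Y ?Y" by (rule bounded_ops_on_subspace[OF H T Z TZ])
  have E': "?E \<in> bounded_ops ?Y ?Y" by (rule bounded_ops_on_subspace[OF H S_bounded[OF 1] Z EZ])
  have Z' [simp]: "x \<in> carrier X" if "x \<in> Z" for x using D(1) that by blast
  have "\<forall>x\<in>Z. T x \<in> Z" using TZ by blast
  note dp = dyadic_power_subspace[OF this D(1)]
  have dY: "dyadic_power ?Y ?T j \<in> bounded_ops ?Y ?Y" by (rule dyadic_power_bounded[OF HY T'])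
  let ?B = "pencil ?Y (u ^ ?N) (v ^ ?N) (dyadic_power ?Y ?T j)"
  have B1: "?B x = pencil X (u ^ ?N) (v ^ ?N) (dyadic_power X T j) x" if "x \<in> Z" for x
    by (rule pencil_subspace[where T' = "dyadic_power ?Y ?T j" and T = "dyadic_power X T j", OF H Z that dp[OF that]])
  have B2: "?B x \<in> Z" if "x \<in> Z" for x
    using bounded_ops_simps(1)[OF pencil_bounded[OF HY dY]] that by (simp del: pencil_apply)
  note B = B1 B2
  define G where "G = (\<lambda>x\<in>Z. ?B (?E x))"
  have G: "G \<in> bounded_ops ?Y ?Y"
    unfolding G_def using bounded_ops_compose[OF pencil_bounded[OF HY dY] E' HY HY] by simp
  have Gx: "G x = ((u ^ ?N - v ^ ?N) \<odot>\<^bsub>X\<^esub> S j 1 x) \<oplus>\<^bsub>X\<^esub> (v ^ ?N \<odot>\<^bsub>X\<^esub> x)" if x: "x \<in> Z" for x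
  proof -
    note [simp] = hilbert_closed[OF H] bounded_ops_simps(1)[OF dyadic_power_bounded[OF H T]] x 1
    let ?d = "dyadic_power X T j (S j 1 x)"
    have eq: "S j 1 x \<ominus>\<^bsub>X\<^esub> (1 \<odot>\<^bsub>X\<^esub> ?d) = x" using S_eq[of 1 x j] by simp
    have ci: "cinner X ?d z = cinner X (S j 1 x) z - cinner X x z" if "z \<in> carrier X" for z
      using arg_cong[OF eq, of "\<lambda>y. cinner X y z"] that by (simp add: cinner_left[OF H] algebra_simps)
    have "G x = pencil X (u ^ ?N) (v ^ ?N) (dyadic_power X T j) (S j 1 x)"
      using B(1)[OF EZ[OF x]] by (simp add: G_def del: pencil_apply)
    also have "\<dots> = ((u ^ ?N - v ^ ?N) \<odot>\<^bsub>X\<^esub> S j 1 x) \<oplus>\<^bsub>X\<^esub> (v ^ ?N \<odot>\<^bsub>X\<^esub> x)"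
      by (rule hilbert_eqI[OF H]) (simp_all add: cinner_left[OF H] ci algebra_simps)
    finally show ?thesis .
  qed
  have Ginv: "op_invertible ?Y G"
  proof (rule op_invertible_near_id[OF HY G], unfold subspace_of_simps)
    fix x assume x: "x \<in> Z"
    then have "G x \<in> Z" using bounded_ops_simps(1)[OF G] by simp
    then show "hnorm X (x \<ominus>\<^bsub>?Y\<^esub> G x) \<le> hnorm X x / 2"
      using near[OF x] x by (simp add: subspace_of_minus[OF H Z] Gx)
  qed
  have comm: "?B (?E x) = ?E (?B x)" if x: "x \<in> Z" for x
  proof -
    have "S j 1 (pencil X (u ^ ?N) (v ^ ?N) (dyadic_power X T j) x)
        = pencil X (u ^ ?N) (v ^ ?N) (dyadic_power X T j) (S j 1 x)"
    proof (rule pencil_commute[OF H dyadic_power_bounded[OF H T] S_bounded[OF 1]])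
      fix y assume y: "y \<in> carrier X"
      have "T (S j 1 y) = S j 1 (T y)" if "y \<in> carrier X" for y by (rule S_commute[OF 1 T _ that]) simp
      then show "S j 1 (dyadic_power X T j y) = dyadic_power X T j (S j 1 y)"
        by (intro dyadic_power_commute[OF H T S_bounded[OF 1] _ y]) simp
    qed (simp add: x)
    then show ?thesis using x B EZ by (simp del: pencil_apply)
  qed
  have "op_invertible ?Y ?B"
    by (rule op_invertible_commuting_factor[OF HY pencil_bounded[OF HY dY] E' _ Ginv])
      (use comm in \<open>simp_all add: G_def del: pencil_apply\<close>)
  then show ?thesis by (rule op_invertible_pencil_of_dyadic_power[OF HY T'])
qed

lemma S_near_P:
  obtains j where "\<And>w x. w \<in> \<Omega> \<Longrightarrow> x \<in> carrier X \<Longrightarrow> hnorm X (S j w x \<ominus>\<^bsub>X\<^esub> P w x) \<le> hnorm X x / 4"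
proof -
  have "(\<lambda>j. 2 * C / 2 ^ j) \<longlonglongrightarrow> 0" by real_asymp
  then obtain j where j: "2 * C / 2 ^ j < 1 / 4"
    using order_tendstoD(2)[of "\<lambda>j. 2 * C / 2 ^ j" 0 sequentially "1 / 4"]
    by (auto simp: eventually_sequentially)
  have "hnorm X (S j w x \<ominus>\<^bsub>X\<^esub> P w x) \<le> hnorm X x / 4" if "w \<in> \<Omega>" "x \<in> carrier X" for w x
  proof -
    have "hnorm X (S j w x \<ominus>\<^bsub>X\<^esub> P w x) \<le> 2 * C / 2 ^ j * hnorm X x" using P_lim(2)[OF that, of j] by simp
    also have "\<dots> \<le> 1 / 4 * hnorm X x" using j hnorm_nonneg[OF H that(2)] by (intro mult_right_mono) simp_all
    finally show ?thesis by simp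
  qed
  then show ?thesis by (rule that)
qed

lemma P_range_pencil_invertible:
  assumes 1: "1 \<in> \<Omega>" and Z: "Z = {x \<in> carrier X. P 1 x = x}" and v: "cmod v \<le> 1"
  shows "closed_subspace X Z" "\<And>x. x \<in> Z \<Longrightarrow> T x \<in> Z"
    "op_invertible (subspace_of X Z) (pencil (subspace_of X Z) 1 v (restrict T Z))"
proof -
  note [simp] = hilbert_closed[OF H] bounded_ops_simps(1)[OF T] P_lim(1)[OF 1] 1
  have ker: "Z = {x \<in> carrier X. pencil X 1 1 (P 1) x = \<zero>\<^bsub>X\<^esub>}"
  proof -
    have "pencil X 1 1 (P 1) x = \<zero>\<^bsub>X\<^esub> \<longleftrightarrow> P 1 x = x" if [simp]: "x \<in> carrier X" for x
    proof -
      have "pencil X 1 1 (P 1) x = x \<ominus>\<^bsub>X\<^esub> P 1 x"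
        by (rule hilbert_eqI[OF H]) (simp_all add: cinner_left[OF H])
      moreover have "x \<ominus>\<^bsub>X\<^esub> x = \<zero>\<^bsub>X\<^esub>" by (rule hilbert_eqI[OF H]) (simp_all add: cinner_left[OF H])
      ultimately show ?thesis using hilbert_eq_if_minus_zero[OF H, of x "P 1 x"] by auto
    qed
    then show ?thesis unfolding Z by (auto simp del: pencil_apply)
  qed
  show cl: "closed_subspace X Z" unfolding ker by (rule kernel_closed_subspace[OF H pencil_bounded[OF H P_bounded[OF 1]]])
  have comm: "T (P 1 x) = P 1 (T x)" if "x \<in> carrier X" for x by (rule P_commute[OF 1 T _ that]) simp
  show TZ: "T x \<in> Z" if "x \<in> Z" for x using that comm[of x] by (simp add: Z)
  \<comment> \<open>the factor \<open>1/4\<close> makes up for \<open>|v\<^sup>N - 1| \<le> 2\<close>\<close>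
  obtain j where j: "\<And>w x. w \<in> \<Omega> \<Longrightarrow> x \<in> carrier X \<Longrightarrow> hnorm X (S j w x \<ominus>\<^bsub>X\<^esub> P w x) \<le> hnorm X x / 4"
    using S_near_P by blast
  have "P 1 (S j 1 x) = S j 1 (P 1 x)" if "x \<in> carrier X" for x
    by (intro S_commute[OF 1 P_bounded[OF 1] _ that]) (simp add: comm)
  then have EZ: "S j 1 x \<in> Z" if "x \<in> Z" for x using that by (simp add: Z)
  show "op_invertible (subspace_of X Z) (pencil (subspace_of X Z) 1 v (restrict T Z))"
  proof (rule pencil_invertible_on_subspace[OF cl TZ 1 EZ])
    fix x assume "x \<in> Z"
    then have [simp]: "x \<in> carrier X" "P 1 x = x" by (simp_all add: Z)
    have "x \<ominus>\<^bsub>X\<^esub> (((1 ^ 2 ^ j - v ^ 2 ^ j) \<odot>\<^bsub>X\<^esub> S j 1 x) \<oplus>\<^bsub>X\<^esub> (v ^ 2 ^ j \<odot>\<^bsub>X\<^esub> x))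
        = (v ^ 2 ^ j - 1) \<odot>\<^bsub>X\<^esub> (S j 1 x \<ominus>\<^bsub>X\<^esub> P 1 x)"
      by (rule hilbert_eqI[OF H]) (simp_all add: cinner_left[OF H] algebra_simps)
    moreover have "cmod (v ^ 2 ^ j - 1) \<le> 2"
      using norm_triangle_ineq4[of "v ^ 2 ^ j" 1] power_le_one[of "cmod v" "2 ^ j"] v by (simp add: norm_power)
    then have "cmod (v ^ 2 ^ j - 1) * hnorm X (S j 1 x \<ominus>\<^bsub>X\<^esub> P 1 x) \<le> 2 * (hnorm X x / 4)"
      by (intro mult_mono j hnorm_nonneg[OF H]) simp_all
    ultimately show "hnorm X (x \<ominus>\<^bsub>X\<^esub> (((1 ^ 2 ^ j - v ^ 2 ^ j) \<odot>\<^bsub>X\<^esub> S j 1 x) \<oplus>\<^bsub>X\<^esub> (v ^ 2 ^ j \<odot>\<^bsub>X\<^esub> x)))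
        \<le> hnorm X x / 2"
      by (simp add: hnorm_smult[OF H])
  qed
qed

lemma P_kernel_pencil_invertible:
  assumes 1: "1 \<in> \<Omega>" and Z: "Z = {x \<in> carrier X. P 1 x = \<zero>\<^bsub>X\<^esub>}" and u: "cmod u \<le> 1"
  shows "closed_subspace X Z" "\<And>x. x \<in> Z \<Longrightarrow> T x \<in> Z"
    "op_invertible (subspace_of X Z) (pencil (subspace_of X Z) u 1 (restrict T Z))"
proof -
  note [simp] = hilbert_closed[OF H] bounded_ops_simps(1)[OF T] P_lim(1)[OF 1] 1
  show cl: "closed_subspace X Z" unfolding Z by (rule kernel_closed_subspace[OF H P_bounded[OF 1]])
  have comm: "T (P 1 x) = P 1 (T x)" if "x \<in> carrier X" for x by (rule P_commute[OF 1 T _ that]) simp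
  show TZ: "T x \<in> Z" if "x \<in> Z" for x
    using that comm[of x] bounded_ops_group(1)[OF T H H] by (simp add: Z)
  \<comment> \<open>the factor \<open>1/4\<close> makes up for \<open>|1 - u\<^sup>N| \<le> 2\<close>\<close>
  obtain j where j: "\<And>w x. w \<in> \<Omega> \<Longrightarrow> x \<in> carrier X \<Longrightarrow> hnorm X (S j w x \<ominus>\<^bsub>X\<^esub> P w x) \<le> hnorm X x / 4"
    using S_near_P by blast
  have "P 1 (S j 1 x) = S j 1 (P 1 x)" if "x \<in> carrier X" for x
    by (intro S_commute[OF 1 P_bounded[OF 1] _ that]) (simp add: comm)
  then have EZ: "S j 1 x \<in> Z" if "x \<in> Z" for x
    using that bounded_ops_group(1)[OF S_bounded[OF 1] H H] by (simp add: Z)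
  show "op_invertible (subspace_of X Z) (pencil (subspace_of X Z) u 1 (restrict T Z))"
  proof (rule pencil_invertible_on_subspace[OF cl TZ 1 EZ])
    fix x assume "x \<in> Z"
    then have [simp]: "x \<in> carrier X" "P 1 x = \<zero>\<^bsub>X\<^esub>" by (simp_all add: Z)
    have "x \<ominus>\<^bsub>X\<^esub> (((u ^ 2 ^ j - 1 ^ 2 ^ j) \<odot>\<^bsub>X\<^esub> S j 1 x) \<oplus>\<^bsub>X\<^esub> (1 ^ 2 ^ j \<odot>\<^bsub>X\<^esub> x))
        = (1 - u ^ 2 ^ j) \<odot>\<^bsub>X\<^esub> (S j 1 x \<ominus>\<^bsub>X\<^esub> P 1 x)"
      by (rule hilbert_eqI[OF H]) (simp_all add: cinner_left[OF H] algebra_simps)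
    moreover have "cmod (1 - u ^ 2 ^ j) \<le> 2"
      using norm_triangle_ineq4[of 1 "u ^ 2 ^ j"] power_le_one[of "cmod u" "2 ^ j"] u by (simp add: norm_power)
    then have "cmod (1 - u ^ 2 ^ j) * hnorm X (S j 1 x \<ominus>\<^bsub>X\<^esub> P 1 x) \<le> 2 * (hnorm X x / 4)"
      by (intro mult_mono j hnorm_nonneg[OF H]) simp_all
    ultimately show "hnorm X (x \<ominus>\<^bsub>X\<^esub> (((u ^ 2 ^ j - 1 ^ 2 ^ j) \<odot>\<^bsub>X\<^esub> S j 1 x) \<oplus>\<^bsub>X\<^esub> (1 ^ 2 ^ j \<odot>\<^bsub>X\<^esub> x)))
        \<le> hnorm X x / 2"
      by (simp add: hnorm_smult[OF H])
  qed
qed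

end

lemma exponentially_stableI:
  assumes H: "complex_hilbert X" and T: "T \<in> bounded_ops X X"
    and inv: "\<And>w. w \<noteq> 0 \<Longrightarrow> cmod w \<le> 1 \<Longrightarrow> op_invertible X (pencil X 1 w T)"
  shows "exponentially_stable X T"
  unfolding exponentially_stable_def
proof (intro conjI T subsetI)
  fix z assume z: "z \<in> op_spectrum X T"
  show "z \<in> ball 0 1"
  proof (rule ccontr)
    assume "z \<notin> ball 0 1"
    then have z1: "1 \<le> cmod z" by simp
    then have z0: "z \<noteq> 0" by auto
    have "op_invertible X (pencil X 1 (1 / z) T)"
      using z1 z0 by (intro inv) (simp_all add: norm_divide divide_le_eq)
    from op_invertible_pencil_scaled[OF H T z0 this] z0 have "op_invertible X (pencil X z 1 T)" by simp
    then show False using z scalar_minus_op_pencil[OF H T] by (simp add: op_spectrum_def)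
  qed
qed

text \<open>
  The Riesz decomposition: \<open>Sp\<close> is the range of the projection \<open>P 1\<close> and \<open>Sm\<close> its kernel.
\<close>

theorem spectral_decomposition:
  assumes H: "complex_hilbert X" and T: "T \<in> bounded_ops X X"
    and spec: "op_spectrum X T \<inter> sphere 0 1 = {}"
  obtains Sm Sp where "direct_sum_decomposition X Sm Sp"
    and "\<And>x. x \<in> Sm \<Longrightarrow> T x \<in> Sm" "\<And>x. x \<in> Sp \<Longrightarrow> T x \<in> Sp"
    and "op_invertible (subspace_of X Sm) (restrict T Sm)"
    and "exponentially_stable (subspace_of X Sp) (restrict T Sp)"
    and "exponentially_stable (subspace_of X Sm) (op_inv (subspace_of X Sm) (restrict T Sm))"
proof -
  obtain M K where "resolvent_family X T (sphere 0 1) M K"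
    using resolvent_family_circle[OF H T spec] .
  then interpret resolvent_family X T "sphere 0 1" M K .
  have 1: "(1::complex) \<in> sphere 0 1" by simp
  note [simp] = hilbert_closed[OF H] P_lim(1)[OF 1]
  define Sp where "Sp = {x \<in> carrier X. P 1 x = x}"
  define Sm where "Sm = {x \<in> carrier X. P 1 x = \<zero>\<^bsub>X\<^esub>}"
  note p = P_range_pencil_invertible[OF 1 Sp_def] and m = P_kernel_pencil_invertible[OF 1 Sm_def]
  have Sp: "closed_subspace X Sp" and Sm: "closed_subspace X Sm"
    using p(1)[of 0] m(1)[of 0] by simp_all
  have TSp: "T x \<in> Sp" if "x \<in> Sp" for x using p(2)[OF _ that, of 0] by simp
  have TSm: "T x \<in> Sm" if "x \<in> Sm" for x using m(2)[OF _ that, of 0] by simp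
  let ?Y = "subspace_of X Sm" and ?A = "restrict T Sm"
  have HY: "complex_hilbert ?Y" by (rule subspace_of_hilbert[OF H Sm])
  have A: "?A \<in> bounded_ops ?Y ?Y" by (rule bounded_ops_on_subspace[OF H T Sm TSm])
  have inv: "op_invertible ?Y ?A"
  proof (rule op_invertible_scaled[OF HY _ m(3)[of 0], of "- 1"])
    fix x assume "x \<in> carrier ?Y"
    then show "?A x = (- 1) \<odot>\<^bsub>?Y\<^esub> pencil ?Y 0 1 ?A x"
      by (intro hilbert_eqI[OF HY])
        (simp_all add: cinner_left[OF HY] hilbert_closed[OF HY] bounded_ops_simps[OF A] del: subspace_of_simps restrict_apply)
  qed simp_all
  have "direct_sum_decomposition X Sm Sp"
    unfolding direct_sum_decomposition_def
  proof (intro conjI Sp Sm)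
    show "Sm \<inter> Sp = {\<zero>\<^bsub>X\<^esub>}" using bounded_ops_group(1)[OF P_bounded[OF 1] H H]
      by (auto simp: Sm_def Sp_def)
    show "Sm <+>\<^bsub>X\<^esub> Sp = carrier X"
    proof
      show "Sm <+>\<^bsub>X\<^esub> Sp \<subseteq> carrier X" by (auto simp: set_add_def' Sm_def Sp_def)
      show "carrier X \<subseteq> Sm <+>\<^bsub>X\<^esub> Sp"
      proof
        fix x assume [simp]: "x \<in> carrier X"
        have "x = (x \<ominus>\<^bsub>X\<^esub> P 1 x) \<oplus>\<^bsub>X\<^esub> P 1 x"
          by (rule hilbert_eqI[OF H]) (simp_all add: cinner_left[OF H])
        moreover have "P 1 x \<in> Sp" by (simp add: Sp_def P_idem[OF 1])
        moreover have "P 1 x \<ominus>\<^bsub>X\<^esub> P 1 x = \<zero>\<^bsub>X\<^esub>"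
          by (rule hilbert_eqI[OF H]) (simp_all add: cinner_left[OF H])
        then have "x \<ominus>\<^bsub>X\<^esub> P 1 x \<in> Sm"
          by (simp add: Sm_def bounded_ops_group[OF P_bounded[OF 1] H H] P_idem[OF 1])
        ultimately show "x \<in> Sm <+>\<^bsub>X\<^esub> Sp" unfolding set_add_def' by blast
      qed
    qed
  qed
  moreover have "exponentially_stable (subspace_of X Sp) (restrict T Sp)"
    by (rule exponentially_stableI[OF subspace_of_hilbert[OF H Sp] bounded_ops_on_subspace[OF H T Sp TSp] p(3)])
  moreover have "exponentially_stable ?Y (op_inv ?Y ?A)"
    using m(3) by (intro exponentially_stableI[OF HY op_invertibleD(2)[OF inv]])
      (simp add: op_invertible_pencil_op_inv[OF HY inv])
  ultimately show ?thesis using that TSm TSp inv by blast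
qed

text \<open>
  Conversely, for every decomposition that splits the spectrum in this way, the projection onto \<open>Sp\<close>
  along \<open>Sm\<close> is the limit \<open>P 1\<close> of the operators \<open>S j 1\<close>. Hence it is bounded.
\<close>

lemma spectral_projection_bounded:
  assumes H: "complex_hilbert X" and T: "T \<in> bounded_ops X X"
    and spec: "op_spectrum X T \<inter> sphere 0 1 = {}"
    and dec: "direct_sum_decomposition X Sm Sp"
    and TSm: "\<And>x. x \<in> Sm \<Longrightarrow> T x \<in> Sm" and TSp: "\<And>x. x \<in> Sp \<Longrightarrow> T x \<in> Sp"
    and inv: "op_invertible (subspace_of X Sm) (restrict T Sm)"
    and stp: "exponentially_stable (subspace_of X Sp) (restrict T Sp)"
    and stm: "exponentially_stable (subspace_of X Sm) (op_inv (subspace_of X Sm) (restrict T Sm))"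
  obtains Q where "Q \<in> bounded_ops X X" "\<And>x. x \<in> Sp \<Longrightarrow> Q x = x" "\<And>x. x \<in> Sm \<Longrightarrow> Q x = \<zero>\<^bsub>X\<^esub>"
proof -
  obtain M K where "resolvent_family X T (sphere 0 1) M K"
    using resolvent_family_circle[OF H T spec] .
  then interpret A: resolvent_family X T "sphere 0 1" M K .
  have one: "(1::complex) \<in> sphere 0 1" and one': "(1::complex) \<in> cball 0 1" by simp_all
  have Sp: "closed_subspace X Sp" and Sm: "closed_subspace X Sm"
    using dec by (auto simp: direct_sum_decomposition_def)
  have HSp: "complex_hilbert (subspace_of X Sp)" and HSm: "complex_hilbert (subspace_of X Sm)"
    by (rule subspace_of_hilbert[OF H Sp] subspace_of_hilbert[OF H Sm])+
  note Dp = closed_subspaceD[OF H Sp] and Dm = closed_subspaceD[OF H Sm]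
  have cp [simp]: "x \<in> carrier X" if "x \<in> Sp" for x using Dp(1) that by blast
  have cm [simp]: "x \<in> carrier X" if "x \<in> Sm" for x using Dm(1) that by blast
  note [simp] = hilbert_closed[OF H]
  have "A.P 1 x = x" if x: "x \<in> Sp" for x
  proof -
    let ?Y = "subspace_of X Sp" and ?T = "restrict T Sp"
    obtain M' K' where "resolvent_family ?Y ?T (cball 0 1) M' K'"
      using resolvent_family_disc[OF HSp stp] .
    then interpret B: resolvent_family ?Y ?T "cball 0 1" M' K' .
    \<comment> \<open>inverses are unique, so \<open>S j 1\<close> formed on \<open>Sp\<close> is the restriction of that formed on \<open>X\<close>\<close>
    have "B.S j 1 x = A.S j 1 x" for j
    proof -
      have y: "B.S j 1 x \<in> Sp" using B.S_closed[OF one', of x j] x by simp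
      have "\<forall>x\<in>Sp. T x \<in> Sp" using TSp by blast
      note dp = dyadic_power_subspace[OF this Dp(1)]
      have "x = pencil ?Y 1 (1 ^ 2 ^ j) (dyadic_power ?Y ?T j) (B.S j 1 x)"
        by (rule B.S_pencil(2)[OF one', symmetric]) (simp add: x)
      also have "\<dots> = pencil X 1 (1 ^ 2 ^ j) (dyadic_power X T j) (B.S j 1 x)"
        by (rule pencil_subspace[where T' = "dyadic_power ?Y ?T j" and T = "dyadic_power X T j", OF H Sp y dp[OF y]])
      finally have "A.S j 1 x = A.S j 1 (pencil X 1 (1 ^ 2 ^ j) (dyadic_power X T j) (B.S j 1 x))"
        by (rule arg_cong)
      also have "\<dots> = B.S j 1 x" by (rule A.S_pencil(1)[OF one]) (simp add: y)
      finally show ?thesis by simp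
    qed
    moreover have "B.P 1 x = x" using B.P_eq_id x by simp
    ultimately show ?thesis
      using A.P_eqI[OF one, of x x "2 * B.C * hnorm X x"] B.P_lim(2)[OF one', of x] x A.S_closed[OF one]
        B.S_closed[OF one', of x]
      by (simp add: subspace_of_minus[OF H Sp])
  qed
  moreover have "A.P 1 x = \<zero>\<^bsub>X\<^esub>" if x: "x \<in> Sm" for x
  proof -
    define Y where "Y = subspace_of X Sm"
    define V where "V = op_inv Y (restrict T Sm)"
    have [simp]: "carrier Y = Sm" "smult Y = smult X" "hnorm Y = hnorm X" by (simp_all add: Y_def)
    have [simp]: "a \<ominus>\<^bsub>Y\<^esub> b = a \<ominus>\<^bsub>X\<^esub> b" if "a \<in> Sm" "b \<in> Sm" for a b
      unfolding Y_def by (rule subspace_of_minus(2)[OF H Sm that])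
    have HY: "complex_hilbert Y" using HSm by (simp add: Y_def)
    have V: "V \<in> bounded_ops Y Y" using op_invertibleD(2)[OF inv] by (simp only: V_def Y_def)
    obtain M' K' where "resolvent_family Y V (cball 0 1) M' K'"
      using resolvent_family_disc[OF HY stm[folded Y_def, folded V_def]] .
    then interpret B: resolvent_family Y V "cball 0 1" M' K' .
    have "\<forall>x\<in>Sm. T x \<in> Sm" using TSm by blast
    note dp = dyadic_power_subspace[OF this Dm(1)]
    have Vj [simp]: "dyadic_power Y V j y \<in> Sm" if "y \<in> Sm" for j y
      using bounded_ops_simps(1)[OF dyadic_power_bounded[OF HY V], of y j] that by simp
    have VT: "dyadic_power X T j (dyadic_power Y V j y) = y" if "y \<in> Sm" for j y
      using dyadic_power_op_inv[OF HSm inv, of y j] dp(1)[OF Vj[OF that], of j j] that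
      by (simp only: \<open>carrier Y = Sm\<close> flip: Y_def V_def)
    \<comment> \<open>\<open>(I - T\<^sup>N)\<^sup>-\<^sup>1 = I - (I - V\<^sup>N)\<^sup>-\<^sup>1\<close> for \<open>V = T\<^sup>-\<^sup>1\<close>, and \<open>V\<close> is exponentially stable\<close>
    have "x \<ominus>\<^bsub>X\<^esub> B.S j 1 x = A.S j 1 x" for j
    proof -
      let ?y = "B.S j 1 x" and ?A = "dyadic_power X T j"
      have y [simp]: "?y \<in> Sm" using B.S_closed[OF one', of x j] x by simp
      have [simp]: "?A z \<in> Sm" if "z \<in> Sm" for z by (rule dp(2)[OF that])
      have e1: "?y \<ominus>\<^bsub>X\<^esub> dyadic_power Y V j ?y = x"
      proof (rule hilbert_eqI[OF H])
        fix z assume z: "z \<in> carrier X"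
        have "?y \<ominus>\<^bsub>X\<^esub> (1 \<odot>\<^bsub>X\<^esub> dyadic_power Y V j ?y) = x"
          using B.S_eq[OF one', of x j] x Dm(4)[OF Vj[OF y], of 1 j] by simp
        from arg_cong[OF this, of "\<lambda>y. cinner X y z"] z
        show "cinner X (?y \<ominus>\<^bsub>X\<^esub> dyadic_power Y V j ?y) z = cinner X x z"
          by (simp add: cinner_left[OF H])
      qed (simp_all add: x)
      have AV: "?A (dyadic_power Y V j ?y) = ?y" by (rule VT[OF y])
      note lin = bounded_ops_group[OF dyadic_power_bounded[OF H T] H H]
      have "?A x = ?A ?y \<ominus>\<^bsub>X\<^esub> ?y" using arg_cong[OF e1, of ?A] AV by (simp add: lin)
      then have "x = pencil X 1 (1 ^ 2 ^ j) ?A (x \<ominus>\<^bsub>X\<^esub> ?y)"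
        by (intro hilbert_eqI[OF H]) (simp_all add: x cinner_left[OF H] lin)
      then have "A.S j 1 x = A.S j 1 (pencil X 1 (1 ^ 2 ^ j) ?A (x \<ominus>\<^bsub>X\<^esub> ?y))"
        by (rule arg_cong)
      also have "\<dots> = x \<ominus>\<^bsub>X\<^esub> ?y" by (rule A.S_pencil(1)[OF one]) (simp add: x)
      finally show ?thesis by simp
    qed
    moreover have "B.P 1 x = x" using B.P_eq_id x by simp
    moreover have "hnorm X ((x \<ominus>\<^bsub>X\<^esub> B.S j 1 x) \<ominus>\<^bsub>X\<^esub> \<zero>\<^bsub>X\<^esub>) = hnorm X (B.S j 1 x \<ominus>\<^bsub>X\<^esub> x)" for j
    proof -
      have [simp]: "B.S j 1 x \<in> Sm" using B.S_closed[OF one', of x j] x by simp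
      have "(x \<ominus>\<^bsub>X\<^esub> B.S j 1 x) \<ominus>\<^bsub>X\<^esub> \<zero>\<^bsub>X\<^esub> = x \<ominus>\<^bsub>X\<^esub> B.S j 1 x"
        by (rule hilbert_eqI[OF H]) (simp_all add: x cinner_left[OF H])
      then show ?thesis using hnorm_minus_commute[OF H, of x "B.S j 1 x"] x by simp
    qed
    ultimately show ?thesis
      using A.P_eqI[OF one, of x "\<zero>\<^bsub>X\<^esub>" "2 * B.C * hnorm X x"] B.P_lim(2)[OF one', of x] x
        B.S_closed[OF one', of x]
      by (simp flip: \<open>\<And>j. x \<ominus>\<^bsub>X\<^esub> B.S j 1 x = A.S j 1 x\<close>)
  qed
  ultimately show ?thesis using that A.P_bounded[OF one] by blast
qed

section \<open>Direct sums and copies of Hilbert spaces\<close>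

lemma hilbert_sum_simps [simp]:
  "carrier (hilbert_sum X Y) = carrier X \<times> carrier Y"
  "zero (hilbert_sum X Y) = (\<zero>\<^bsub>X\<^esub>, \<zero>\<^bsub>Y\<^esub>)"
  "add (hilbert_sum X Y) p q = (fst p \<oplus>\<^bsub>X\<^esub> fst q, snd p \<oplus>\<^bsub>Y\<^esub> snd q)"
  "smult (hilbert_sum X Y) a p = (a \<odot>\<^bsub>X\<^esub> fst p, a \<odot>\<^bsub>Y\<^esub> snd p)"
  "cinner (hilbert_sum X Y) p q = cinner X (fst p) (fst q) + cinner Y (snd p) (snd q)"
  by (simp_all add: hilbert_sum_def)

lemma hnorm_power2:
  assumes "complex_hilbert X" "x \<in> carrier X"
  shows "(hnorm X x)\<^sup>2 = Re (cinner X x x)"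
  using complex_hilbert.cinner_nonneg[OF assms] by (simp add: hnorm_def)

lemma cinner_self_zero:
  assumes "complex_hilbert X" "x \<in> carrier X"
  shows "Re (cinner X x x) = 0 \<Longrightarrow> x = \<zero>\<^bsub>X\<^esub>"
  using hnorm_eq_0_iff[OF assms] by (simp add: hnorm_def)

context
  fixes X :: "'a hilbert" and Y :: "'b hilbert"
  assumes HX: "complex_hilbert X" and HY: "complex_hilbert Y"
begin

lemma hnorm_sum:
  "x \<in> carrier X \<Longrightarrow> y \<in> carrier Y \<Longrightarrow> hnorm (hilbert_sum X Y) (x, y) = sqrt ((hnorm X x)\<^sup>2 + (hnorm Y y)\<^sup>2)"
  by (simp add: hnorm_power2 HX HY) (simp add: hnorm_def)

lemma hilbert_sum_module: "module complex_ring (hilbert_sum X Y)"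
proof -
  note [simp] = hilbert_closed[OF HX] hilbert_closed[OF HY]
  note eq = hilbert_eqI[OF HX] hilbert_eqI[OF HY]
  have neg: "\<ominus>\<^bsub>X\<^esub> x \<oplus>\<^bsub>X\<^esub> x = \<zero>\<^bsub>X\<^esub>" if "x \<in> carrier X" for x
    by (rule eq) (simp_all add: that cinner_left[OF HX])
  have neg': "\<ominus>\<^bsub>Y\<^esub> x \<oplus>\<^bsub>Y\<^esub> x = \<zero>\<^bsub>Y\<^esub>" if "x \<in> carrier Y" for x
    by (rule eq) (simp_all add: that cinner_left[OF HY])
  have "abelian_group (hilbert_sum X Y)"
  proof (rule abelian_groupI)
    fix p assume "p \<in> carrier (hilbert_sum X Y)"
    then show "\<exists>q\<in>carrier (hilbert_sum X Y). q \<oplus>\<^bsub>hilbert_sum X Y\<^esub> p = \<zero>\<^bsub>hilbert_sum X Y\<^esub>"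
      by (intro bexI[of _ "(\<ominus>\<^bsub>X\<^esub> fst p, \<ominus>\<^bsub>Y\<^esub> snd p)"]) (auto simp: neg neg')
  qed (auto intro!: eq simp: cinner_left[OF HX] cinner_left[OF HY])
  then show ?thesis
    by (rule moduleI[OF complex_ring_cring])
      (auto intro!: eq simp: cinner_left[OF HX] cinner_left[OF HY] algebra_simps)
qed

lemma hilbert_sum_minus:
  assumes "x \<in> carrier X" "x' \<in> carrier X" "y \<in> carrier Y" "y' \<in> carrier Y"
  shows "(x, y) \<ominus>\<^bsub>hilbert_sum X Y\<^esub> (x', y') = (x \<ominus>\<^bsub>X\<^esub> x', y \<ominus>\<^bsub>Y\<^esub> y')"
proof -
  note [simp] = hilbert_closed[OF HX] hilbert_closed[OF HY] assms
  interpret abelian_group "hilbert_sum X Y" by (rule module.axioms(2)[OF hilbert_sum_module])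
  have "\<ominus>\<^bsub>X\<^esub> x' \<oplus>\<^bsub>X\<^esub> x' = \<zero>\<^bsub>X\<^esub>" by (rule hilbert_eqI[OF HX]) (simp_all add: cinner_left[OF HX])
  moreover have "\<ominus>\<^bsub>Y\<^esub> y' \<oplus>\<^bsub>Y\<^esub> y' = \<zero>\<^bsub>Y\<^esub>" by (rule hilbert_eqI[OF HY]) (simp_all add: cinner_left[OF HY])
  ultimately have "\<ominus>\<^bsub>hilbert_sum X Y\<^esub> (x', y') = (\<ominus>\<^bsub>X\<^esub> x', \<ominus>\<^bsub>Y\<^esub> y')"
    by (intro minus_equality) simp_all
  then show ?thesis by (simp add: a_minus_def)
qed

lemma hilbert_sum_hilbert: "complex_hilbert (hilbert_sum X Y)"
proof -
  note [simp] = hilbert_closed[OF HX] hilbert_closed[OF HY]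
  interpret X: complex_hilbert X by (rule HX)
  interpret Y: complex_hilbert Y by (rule HY)
  interpret Metric_space12 "carrier X" "hdist X" "carrier Y" "hdist Y"
    using X.hdist_Metric_space Y.hdist_Metric_space by (simp add: Metric_space12_def)
  have "Metric_space.mcomplete (carrier X \<times> carrier Y) (prod_dist (hdist X) (hdist Y))"
    using X.complete Y.complete by (simp add: mcomplete_prod_metric)
  then have "Metric_space.mcomplete (carrier (hilbert_sum X Y)) (hdist (hilbert_sum X Y))"
    by (intro hdist_of_isometry(2)[OF Prod_metric.Metric_space_axioms, of id])
      (auto simp: hdist_def prod_dist_def hilbert_sum_minus hnorm_sum)
  moreover have "p = \<zero>\<^bsub>hilbert_sum X Y\<^esub>"
    if p: "p \<in> carrier (hilbert_sum X Y)" "cinner (hilbert_sum X Y) p p = 0" for p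
  proof -
    have "Re (cinner X (fst p) (fst p)) + Re (cinner Y (snd p) (snd p)) = 0"
      using p(2) by (simp add: complex_eq_iff)
    moreover have "fst p \<in> carrier X" "snd p \<in> carrier Y" using p by auto
    ultimately show ?thesis
      using X.cinner_nonneg Y.cinner_nonneg cinner_self_zero[OF HX] cinner_self_zero[OF HY]
      by (simp add: prod_eq_iff add_nonneg_eq_0_iff)
  qed
  moreover have "cinner (hilbert_sum X Y) p q = cnj (cinner (hilbert_sum X Y) q p)"
    if "p \<in> carrier (hilbert_sum X Y)" "q \<in> carrier (hilbert_sum X Y)" for p q
    using that X.cinner_commute[of "fst p" "fst q"] Y.cinner_commute[of "snd p" "snd q"] by auto
  moreover have "cinner (hilbert_sum X Y) (p \<oplus>\<^bsub>hilbert_sum X Y\<^esub> q) r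
      = cinner (hilbert_sum X Y) p r + cinner (hilbert_sum X Y) q r"
    "cinner (hilbert_sum X Y) (a \<odot>\<^bsub>hilbert_sum X Y\<^esub> p) r = a * cinner (hilbert_sum X Y) p r"
    "0 \<le> Re (cinner (hilbert_sum X Y) p p)"
    if "p \<in> carrier (hilbert_sum X Y)" "q \<in> carrier (hilbert_sum X Y)" "r \<in> carrier (hilbert_sum X Y)" for a p q r
    using that
    by (auto simp: cinner_left[OF HX] cinner_left[OF HY] X.cinner_nonneg Y.cinner_nonneg distrib_left)
  ultimately show ?thesis
    by (intro complex_hilbert.intro hilbert_sum_module complex_hilbert_axioms.intro) blast+
qed

lemma hnorm_sum_le:
  assumes "x \<in> carrier X" "y \<in> carrier Y"
  shows "hnorm (hilbert_sum X Y) (x, y) \<le> hnorm X x + hnorm Y y"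
  using assms hnorm_nonneg[OF HX] hnorm_nonneg[OF HY] by (simp add: hnorm_sum sqrt_sum_squares_le_sum)

lemma hnorm_le_sum:
  assumes "x \<in> carrier X" "y \<in> carrier Y"
  shows "hnorm X x \<le> hnorm (hilbert_sum X Y) (x, y)" "hnorm Y y \<le> hnorm (hilbert_sum X Y) (x, y)"
  using assms by (simp_all add: hnorm_sum)

lemma fst_bounded: "(\<lambda>p\<in>carrier (hilbert_sum X Y). fst p) \<in> bounded_ops (hilbert_sum X Y) X"
  by (rule bounded_opsI[OF hilbert_sum_hilbert, where K = 1]) (auto simp: hnorm_le_sum)

lemma snd_bounded: "(\<lambda>p\<in>carrier (hilbert_sum X Y). snd p) \<in> bounded_ops (hilbert_sum X Y) Y"
  by (rule bounded_opsI[OF hilbert_sum_hilbert, where K = 1]) (auto simp: hnorm_le_sum)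

lemma column_op_bounded:
  assumes HU: "complex_hilbert U" and S: "S \<in> bounded_ops U X" and T: "T \<in> bounded_ops U Y"
  shows "column_op U S T \<in> bounded_ops U (hilbert_sum X Y)"
proof -
  note [simp] = bounded_ops_simps[OF S] bounded_ops_simps[OF T]
  obtain K where K: "\<And>x. x \<in> carrier U \<Longrightarrow> hnorm X (S x) \<le> K * hnorm U x"
    using bounded_ops_bound[OF S HU] by metis
  obtain L where L: "\<And>x. x \<in> carrier U \<Longrightarrow> hnorm Y (T x) \<le> L * hnorm U x"
    using bounded_ops_bound[OF T HU] by metis
  have "hnorm (hilbert_sum X Y) (S x, T x) \<le> (K + L) * hnorm U x" if "x \<in> carrier U" for x
    using hnorm_sum_le[of "S x" "T x"] K[OF that] L[OF that] that by (simp add: distrib_right)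
  then show ?thesis
    unfolding column_op_def by (intro bounded_opsI[OF HU]) simp_all
qed

lemma diag_op_bounded:
  assumes S: "S \<in> bounded_ops X X" and T: "T \<in> bounded_ops Y Y"
  shows "diag_op X Y S T \<in> bounded_ops (hilbert_sum X Y) (hilbert_sum X Y)"
proof -
  note HS = hilbert_sum_hilbert
  have "diag_op X Y S T = column_op (hilbert_sum X Y)
      (\<lambda>p\<in>carrier (hilbert_sum X Y). S ((\<lambda>p\<in>carrier (hilbert_sum X Y). fst p) p))
      (\<lambda>p\<in>carrier (hilbert_sum X Y). T ((\<lambda>p\<in>carrier (hilbert_sum X Y). snd p) p))"
    unfolding diag_op_def column_op_def by auto
  then show ?thesis
    using column_op_bounded[OF HS bounded_ops_compose[OF S fst_bounded HS HX] bounded_ops_compose[OF T snd_bounded HS HY]]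
    by simp
qed

lemma row_op_bounded:
  assumes HU: "complex_hilbert U" and S: "S \<in> bounded_ops X U" and T: "T \<in> bounded_ops Y U"
  shows "row_op X Y U S T \<in> bounded_ops (hilbert_sum X Y) U"
proof -
  note HS = hilbert_sum_hilbert
  let ?S = "\<lambda>p\<in>carrier (hilbert_sum X Y). S ((\<lambda>p\<in>carrier (hilbert_sum X Y). fst p) p)"
  let ?T = "\<lambda>p\<in>carrier (hilbert_sum X Y). T ((\<lambda>p\<in>carrier (hilbert_sum X Y). snd p) p)"
  have "row_op X Y U S T = (\<lambda>p\<in>carrier (hilbert_sum X Y). (1 \<odot>\<^bsub>U\<^esub> ?S p) \<oplus>\<^bsub>U\<^esub> (1 \<odot>\<^bsub>U\<^esub> ?T p))"
    unfolding row_op_def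
    by (auto simp: fun_eq_iff hilbert_smult_one[OF HU] bounded_ops_simps[OF S] bounded_ops_simps[OF T])
  then show ?thesis
    using bounded_ops_lincomb[OF bounded_ops_compose[OF S fst_bounded HS HX]
        bounded_ops_compose[OF T snd_bounded HS HY] HS HU, of 1 1]
    by simp
qed

lemma op_invertible_diag:
  assumes S: "op_invertible X S" and T: "op_invertible Y T"
  shows "op_invertible (hilbert_sum X Y) (diag_op X Y S T)"
    and "op_inv (hilbert_sum X Y) (diag_op X Y S T) = diag_op X Y (op_inv X S) (op_inv Y T)"
proof -
  note S = op_invertibleD[OF S] and T = op_invertibleD[OF T]
  note [simp] = bounded_ops_simps(1)[OF S(1)] bounded_ops_simps(1)[OF S(2)] S(3,4)
    bounded_ops_simps(1)[OF T(1)] bounded_ops_simps(1)[OF T(2)] T(3,4)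
  note I = op_invertibleI[OF diag_op_bounded[OF S(1) T(1)] diag_op_bounded[OF S(2) T(2)]]
  show "op_invertible (hilbert_sum X Y) (diag_op X Y S T)"
    by (rule I(1)) (auto simp: diag_op_def)
  show "op_inv (hilbert_sum X Y) (diag_op X Y S T) = diag_op X Y (op_inv X S) (op_inv Y T)"
    by (rule I(2)) (auto simp: diag_op_def)
qed

lemma op_invertible_diagD:
  assumes S: "S \<in> bounded_ops X X" and T: "T \<in> bounded_ops Y Y"
    and inv: "op_invertible (hilbert_sum X Y) (diag_op X Y S T)"
  shows "op_invertible X S" "op_invertible Y T"
proof -
  note HS = hilbert_sum_hilbert and D = op_invertibleD[OF inv]
  let ?V = "op_inv (hilbert_sum X Y) (diag_op X Y S T)"
  note [simp] = hilbert_closed[OF HX] hilbert_closed[OF HY] bounded_ops_simps(1)[OF S] bounded_ops_simps(1)[OF T]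
    bounded_ops_group(1)[OF S HX HX] bounded_ops_group(1)[OF T HY HY]
  have sm: "a \<odot>\<^bsub>X\<^esub> \<zero>\<^bsub>X\<^esub> = \<zero>\<^bsub>X\<^esub>" "a \<odot>\<^bsub>Y\<^esub> \<zero>\<^bsub>Y\<^esub> = \<zero>\<^bsub>Y\<^esub>" for a
    by (rule hilbert_eqI[OF HX] hilbert_eqI[OF HY]; simp add: cinner_left[OF HX] cinner_left[OF HY])+
  have ad: "\<zero>\<^bsub>X\<^esub> \<oplus>\<^bsub>X\<^esub> \<zero>\<^bsub>X\<^esub> = \<zero>\<^bsub>X\<^esub>" "\<zero>\<^bsub>Y\<^esub> \<oplus>\<^bsub>Y\<^esub> \<zero>\<^bsub>Y\<^esub> = \<zero>\<^bsub>Y\<^esub>"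
    by (rule hilbert_eqI[OF HX] hilbert_eqI[OF HY]; simp add: cinner_left[OF HX] cinner_left[OF HY])+
  have Vc [simp]: "fst (?V p) \<in> carrier X" "snd (?V p) \<in> carrier Y" if "p \<in> carrier X \<times> carrier Y" for p
    using bounded_ops_simps(1)[OF D(2), of p] that by auto
  have dV: "S (fst (?V p)) = fst p" "T (snd (?V p)) = snd p" if "p \<in> carrier X \<times> carrier Y" for p
    using D(4)[of p] bounded_ops_simps(1)[OF D(2), of p] that by (auto simp: diag_op_def prod_eq_iff)
  have Vd: "?V (S x, T y) = (x, y)" if "x \<in> carrier X" "y \<in> carrier Y" for x y
    using D(3)[of "(x, y)"] that by (simp add: diag_op_def)
  have inl: "(\<lambda>x\<in>carrier X. (x, \<zero>\<^bsub>Y\<^esub>)) \<in> bounded_ops X (hilbert_sum X Y)"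
    by (rule bounded_opsI[OF HX, where K = 1])
      (auto simp: sm ad hnorm_sum hnorm_zero[OF HY] hnorm_nonneg[OF HX])
  have inr: "(\<lambda>y\<in>carrier Y. (\<zero>\<^bsub>X\<^esub>, y)) \<in> bounded_ops Y (hilbert_sum X Y)"
    by (rule bounded_opsI[OF HY, where K = 1])
      (auto simp: sm ad hnorm_sum hnorm_zero[OF HX] hnorm_nonneg[OF HY])
  note compl = bounded_ops_compose[OF fst_bounded bounded_ops_compose[OF D(2) inl HX HS] HX HS]
  note compr = bounded_ops_compose[OF snd_bounded bounded_ops_compose[OF D(2) inr HY HS] HY HS]
  show "op_invertible X S"
  proof (rule op_invertibleI(1)[OF S compl])
    fix x assume [simp]: "x \<in> carrier X"
    have [simp]: "?V (x, \<zero>\<^bsub>Y\<^esub>) \<in> carrier X \<times> carrier Y" "?V (S x, \<zero>\<^bsub>Y\<^esub>) \<in> carrier X \<times> carrier Y"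
      using bounded_ops_simps(1)[OF D(2), of "(x, \<zero>\<^bsub>Y\<^esub>)"] bounded_ops_simps(1)[OF D(2), of "(S x, \<zero>\<^bsub>Y\<^esub>)"] by simp_all
    show "S ((\<lambda>x\<in>carrier X. (\<lambda>p\<in>carrier (hilbert_sum X Y). fst p)
        ((\<lambda>x\<in>carrier X. ?V ((\<lambda>x\<in>carrier X. (x, \<zero>\<^bsub>Y\<^esub>)) x)) x)) x) = x"
      using dV(1)[of "(x, \<zero>\<^bsub>Y\<^esub>)"] by simp
    show "(\<lambda>x\<in>carrier X. (\<lambda>p\<in>carrier (hilbert_sum X Y). fst p)
        ((\<lambda>x\<in>carrier X. ?V ((\<lambda>x\<in>carrier X. (x, \<zero>\<^bsub>Y\<^esub>)) x)) x)) (S x) = x"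
      using Vd[of x "\<zero>\<^bsub>Y\<^esub>"] by simp
  qed
  show "op_invertible Y T"
  proof (rule op_invertibleI(1)[OF T compr])
    fix x assume [simp]: "x \<in> carrier Y"
    have [simp]: "?V (\<zero>\<^bsub>X\<^esub>, x) \<in> carrier X \<times> carrier Y" "?V (\<zero>\<^bsub>X\<^esub>, T x) \<in> carrier X \<times> carrier Y"
      using bounded_ops_simps(1)[OF D(2), of "(\<zero>\<^bsub>X\<^esub>, x)"] bounded_ops_simps(1)[OF D(2), of "(\<zero>\<^bsub>X\<^esub>, T x)"] by simp_all
    show "T ((\<lambda>x\<in>carrier Y. (\<lambda>p\<in>carrier (hilbert_sum X Y). snd p)
        ((\<lambda>x\<in>carrier Y. ?V ((\<lambda>y\<in>carrier Y. (\<zero>\<^bsub>X\<^esub>, y)) x)) x)) x) = x"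
      using dV(2)[of "(\<zero>\<^bsub>X\<^esub>, x)"] by simp
    show "(\<lambda>x\<in>carrier Y. (\<lambda>p\<in>carrier (hilbert_sum X Y). snd p)
        ((\<lambda>x\<in>carrier Y. ?V ((\<lambda>y\<in>carrier Y. (\<zero>\<^bsub>X\<^esub>, y)) x)) x)) (T x) = x"
      using Vd[of "\<zero>\<^bsub>X\<^esub>" x] by simp
  qed
qed

lemma pencil_diag:
  assumes S: "S \<in> bounded_ops X X" and T: "T \<in> bounded_ops Y Y"
  shows "pencil (hilbert_sum X Y) u v (diag_op X Y S T) = diag_op X Y (pencil X u v S) (pencil Y u v T)"
proof -
  note [simp] = hilbert_closed[OF HX] hilbert_closed[OF HY] bounded_ops_simps(1)[OF S] bounded_ops_simps(1)[OF T]
  show ?thesis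
    by (auto simp: pencil_def diag_op_def hilbert_sum_minus)
qed

lemma op_invertible_pencil_diag:
  assumes S: "S \<in> bounded_ops X X" and T: "T \<in> bounded_ops Y Y"
  shows "op_invertible (hilbert_sum X Y) (pencil (hilbert_sum X Y) u v (diag_op X Y S T)) \<longleftrightarrow>
    op_invertible X (pencil X u v S) \<and> op_invertible Y (pencil Y u v T)"
  unfolding pencil_diag[OF S T]
  using op_invertible_diag(1) op_invertible_diagD[OF pencil_bounded[OF HX S] pencil_bounded[OF HY T]] by blast

end

text \<open>The copy of a Hilbert space under a map that is injective on its carrier.\<close>

definition image_hilbert :: "('a \<Rightarrow> 'b) \<Rightarrow> 'a hilbert \<Rightarrow> 'b hilbert"
  where "image_hilbert h X = (let g = inv_into (carrier X) h in \<lparr>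
    carrier = h ` carrier X,
    mult = (\<lambda>_ _. h \<zero>\<^bsub>X\<^esub>),
    one = h \<zero>\<^bsub>X\<^esub>,
    zero = h \<zero>\<^bsub>X\<^esub>,
    add = (\<lambda>p q. h (g p \<oplus>\<^bsub>X\<^esub> g q)),
    smult = (\<lambda>a p. h (a \<odot>\<^bsub>X\<^esub> g p)),
    cinner = (\<lambda>p q. cinner X (g p) (g q))\<rparr>)"

lemma image_hilbert_simps:
  assumes h: "inj_on h (carrier X)" and [simp]: "x \<in> carrier X" "y \<in> carrier X"
  shows "carrier (image_hilbert h X) = h ` carrier X"
    "zero (image_hilbert h X) = h \<zero>\<^bsub>X\<^esub>"
    "h x \<oplus>\<^bsub>image_hilbert h X\<^esub> h y = h (x \<oplus>\<^bsub>X\<^esub> y)"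
    "a \<odot>\<^bsub>image_hilbert h X\<^esub> h x = h (a \<odot>\<^bsub>X\<^esub> x)"
    "cinner (image_hilbert h X) (h x) (h y) = cinner X x y"
  using h by (simp_all add: image_hilbert_def Let_def)

lemma image_hilbert_hilbert:
  assumes H: "complex_hilbert X" and h: "inj_on h (carrier X)"
  shows "complex_hilbert (image_hilbert h X)" (is "complex_hilbert ?Y")
    and "x \<in> carrier X \<Longrightarrow> hnorm (image_hilbert h X) (h x) = hnorm X x"
proof -
  interpret X: complex_hilbert X by (rule H)
  note [simp] = hilbert_closed[OF H]
  note s = image_hilbert_simps[OF h]
  have c: "carrier ?Y = h ` carrier X" "zero ?Y = h \<zero>\<^bsub>X\<^esub>" by (simp_all add: image_hilbert_def Let_def)
  note eq = arg_cong[of _ _ h, OF hilbert_eqI[OF H]]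
  have neg: "\<ominus>\<^bsub>X\<^esub> x \<oplus>\<^bsub>X\<^esub> x = \<zero>\<^bsub>X\<^esub>" if "x \<in> carrier X" for x
    by (rule hilbert_eqI[OF H]) (simp_all add: that cinner_left[OF H])
  have grp: "abelian_group ?Y"
  proof (rule abelian_groupI)
    fix p assume "p \<in> carrier ?Y"
    then obtain x where "x \<in> carrier X" "p = h x" by (auto simp: c)
    then show "\<exists>q\<in>carrier ?Y. q \<oplus>\<^bsub>?Y\<^esub> p = \<zero>\<^bsub>?Y\<^esub>"
      by (intro bexI[of _ "h (\<ominus>\<^bsub>X\<^esub> x)"]) (auto simp: s c neg)
  qed (auto intro!: eq simp: c s cinner_left[OF H])
  then interpret Y: abelian_group ?Y .
  have mod: "module complex_ring ?Y"
    by (rule moduleI[OF complex_ring_cring grp])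
      (auto intro!: eq simp: c s cinner_left[OF H] algebra_simps)
  show n: "hnorm ?Y (h x) = hnorm X x" if "x \<in> carrier X" for x
    using that by (simp add: hnorm_def s)
  have minus: "h x \<ominus>\<^bsub>?Y\<^esub> h y = h (x \<ominus>\<^bsub>X\<^esub> y)" if "x \<in> carrier X" "y \<in> carrier X" for x y
  proof -
    have "\<ominus>\<^bsub>?Y\<^esub> h y = h (\<ominus>\<^bsub>X\<^esub> y)"
      using that by (intro Y.minus_equality) (simp_all add: s c neg)
    then show ?thesis using that by (simp add: a_minus_def s)
  qed
  have g: "bij_betw (inv_into (carrier X) h) (carrier ?Y) (carrier X)"
    unfolding c by (rule bij_betw_inv_into) (use h in \<open>simp add: bij_betw_def\<close>)
  have "Metric_space.mcomplete (carrier ?Y) (hdist ?Y)"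
    by (rule hdist_of_isometry(2)[OF X.hdist_Metric_space g _ X.complete])
      (auto simp: c hdist_def minus n h)
  then show "complex_hilbert ?Y"
    by (intro complex_hilbert.intro mod complex_hilbert_axioms.intro)
      (auto simp: c s cinner_left[OF H] X.cinner_nonneg X.cinner_definite X.cinner_commute[symmetric]
        intro!: arg_cong[of _ _ h])
qed

text \<open>A nonzero vector has infinitely many multiples.\<close>

lemma hilbert_finite_trivial:
  assumes H: "complex_hilbert X" and fin: "finite (carrier X)"
  shows "carrier X = {\<zero>\<^bsub>X\<^esub>}"
proof -
  note [simp] = hilbert_closed[OF H]
  have "x = \<zero>\<^bsub>X\<^esub>" if x [simp]: "x \<in> carrier X" for x
  proof (rule ccontr)
    assume "x \<noteq> \<zero>\<^bsub>X\<^esub>"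
    then have n0: "hnorm X x \<noteq> 0" using hnorm_eq_0_iff[OF H x] by simp
    have "inj (\<lambda>t::real. complex_of_real (exp t) \<odot>\<^bsub>X\<^esub> x)"
    proof (rule injI)
      fix s t :: real assume "complex_of_real (exp s) \<odot>\<^bsub>X\<^esub> x = complex_of_real (exp t) \<odot>\<^bsub>X\<^esub> x"
      from arg_cong[OF this, of "hnorm X"] n0 show "s = t" by (simp add: hnorm_smult[OF H])
    qed
    moreover have "range (\<lambda>t::real. complex_of_real (exp t) \<odot>\<^bsub>X\<^esub> x) \<subseteq> carrier X" by auto
    ultimately have "finite (UNIV :: real set)"
      using fin finite_subset finite_imageD by blast
    then show False using infinite_UNIV_char_0 by blast
  qed
  then show ?thesis by auto
qed

text \<open>
  A nonzero Hilbert space has infinitely many vectors, and an infinite type is as large as its square.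
  Hence the direct sum of two Hilbert spaces over a type has a copy over the same type.
\<close>

lemma hilbert_sum_embeds:
  fixes X Y :: "'a hilbert"
  assumes HX: "complex_hilbert X" and HY: "complex_hilbert Y"
  obtains h :: "'a \<times> 'a \<Rightarrow> 'a" where "inj_on h (carrier (hilbert_sum X Y))"
proof (cases "finite (UNIV :: 'a set)")
  case True
  then have "finite (carrier X)" "finite (carrier Y)" by (auto intro: finite_subset)
  then have "inj_on fst (carrier (hilbert_sum X Y))"
    using hilbert_finite_trivial[OF HX] hilbert_finite_trivial[OF HY] by (simp add: inj_on_def)
  then show ?thesis by (rule that)
next
  case False
  obtain h :: "'a \<times> 'a \<Rightarrow> 'a" where "bij_betw h (UNIV \<times> UNIV) UNIV"
    using iffD2[OF card_of_ordIso card_of_Times_same_infinite[OF False]] by blast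
  then have "inj h" by (simp add: bij_betw_def)
  then show ?thesis using that inj_on_subset by blast
qed

section \<open>Transfer functions\<close>

lemma transfer_function_pencil:
  assumes "complex_hilbert X" "A \<in> bounded_ops X X"
  shows "transfer_function X U A B C D = (\<lambda>z.
    if op_invertible X (pencil X 1 z A)
    then Some (\<lambda>u\<in>carrier U. D u \<oplus>\<^bsub>U\<^esub> (z \<odot>\<^bsub>U\<^esub> C (op_inv X (pencil X 1 z A) (B u))))
    else None)"
  unfolding transfer_function_def id_minus_scaled_pencil[OF assms] by (rule refl)

lemma dichotomous_system_pencil:
  "dichotomous_system X U A B C D \<longleftrightarrow> complex_hilbert X \<and> complex_hilbert U \<and>
    A \<in> bounded_ops X X \<and> B \<in> bounded_ops U X \<and> C \<in> bounded_ops X U \<and> D \<in> bounded_ops U U \<and>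
    (\<forall>z. cmod z = 1 \<longrightarrow> op_invertible X (pencil X z 1 A))"
  by (auto simp: dichotomous_system_def op_spectrum_def disjoint_iff scalar_minus_op_pencil)

lemma op_invertible_similar:
  assumes HX: "complex_hilbert X" and HY: "complex_hilbert Y"
    and F: "F \<in> bounded_ops X Y" and G: "G \<in> bounded_ops Y X"
    and GF: "\<And>x. x \<in> carrier X \<Longrightarrow> G (F x) = x" and FG: "\<And>y. y \<in> carrier Y \<Longrightarrow> F (G y) = y"
    and Q': "Q' \<in> bounded_ops Y Y" and QQ': "\<And>x. x \<in> carrier X \<Longrightarrow> Q' (F x) = F (Q x)"
    and Q: "op_invertible X Q"
  shows "op_invertible Y Q'" "x \<in> carrier X \<Longrightarrow> op_inv Y Q' (F x) = F (op_inv X Q x)"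
proof -
  note D = op_invertibleD[OF Q]
  note [simp] = bounded_ops_simps(1)[OF F] bounded_ops_simps(1)[OF G] bounded_ops_simps(1)[OF D(1)]
    bounded_ops_simps(1)[OF D(2)] GF FG D(3,4)
  let ?V = "\<lambda>y\<in>carrier Y. F ((\<lambda>y\<in>carrier Y. op_inv X Q (G y)) y)"
  have V: "?V \<in> bounded_ops Y Y"
    by (rule bounded_ops_compose[OF F bounded_ops_compose[OF D(2) G HY HX] HY HX])
  have y: "\<exists>x\<in>carrier X. y = F x" if "y \<in> carrier Y" for y using that FG[OF that] by (metis bounded_ops_simps(1)[OF G])
  have a: "?V (Q' y) = y" "Q' (?V y) = y" if "y \<in> carrier Y" for y
    using y[OF that] by (auto simp: QQ')
  show "op_invertible Y Q'" by (rule op_invertibleI(1)[OF Q' V a])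
  have "op_inv Y Q' = ?V" by (rule op_invertibleI(2)[OF Q' V a])
  then show "x \<in> carrier X \<Longrightarrow> op_inv Y Q' (F x) = F (op_inv X Q x)" by simp
qed

text \<open>
  A bounded change of coordinates \<open>F\<close> of the state space, with inverse \<open>G\<close>, does not change the
  transfer function.
\<close>

lemma transfer_function_similar:
  assumes HX: "complex_hilbert X" and HY: "complex_hilbert Y"
    and F: "F \<in> bounded_ops X Y" and G: "G \<in> bounded_ops Y X"
    and GF: "\<And>x. x \<in> carrier X \<Longrightarrow> G (F x) = x" and FG: "\<And>y. y \<in> carrier Y \<Longrightarrow> F (G y) = y"
    and A: "A \<in> bounded_ops X X" and A': "A' \<in> bounded_ops Y Y"
    and AA': "\<And>x. x \<in> carrier X \<Longrightarrow> A' (F x) = F (A x)"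
    and B: "B \<in> bounded_ops U X" and BB': "\<And>u. u \<in> carrier U \<Longrightarrow> B' u = F (B u)"
    and CC': "\<And>x. x \<in> carrier X \<Longrightarrow> C' (F x) = C x"
  shows "op_invertible Y (pencil Y u v A') \<longleftrightarrow> op_invertible X (pencil X u v A)"
    and "transfer_function Y U A' B' C' D = transfer_function X U A B C D"
proof -
  note [simp] = bounded_ops_simps(1)[OF F] bounded_ops_simps(1)[OF G] bounded_ops_simps(1)[OF A]
    bounded_ops_simps(1)[OF A'] bounded_ops_simps(1)[OF B] hilbert_closed[OF HX] hilbert_closed[OF HY] GF FG
  have 1: "pencil Y u v A' (F x) = F (pencil X u v A x)" if "x \<in> carrier X" for u v x
    using that by (simp add: AA' bounded_ops_simps[OF F] bounded_ops_group[OF F HX HY])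
  have 2: "pencil X u v A (G y) = G (pencil Y u v A' y)" if "y \<in> carrier Y" for u v y
  proof -
    have "pencil Y u v A' y = F (pencil X u v A (G y))" using 1[of "G y"] that by (simp del: pencil_apply)
    then show ?thesis using that by simp
  qed
  have S: "op_invertible Y (pencil Y u v A')"
    "x \<in> carrier X \<Longrightarrow> op_inv Y (pencil Y u v A') (F x) = F (op_inv X (pencil X u v A) x)"
    if "op_invertible X (pencil X u v A)" for u v x
    using op_invertible_similar[where F = F and Q = "pencil X u v A" and Q' = "pencil Y u v A'",
        OF HX HY F G GF FG pencil_bounded[OF HY A'] 1 that] by blast+
  have "op_invertible X (pencil X u v A)" if "op_invertible Y (pencil Y u v A')" for u v
    using op_invertible_similar(1)[where F = G and Q = "pencil Y u v A'" and Q' = "pencil X u v A",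
        OF HY HX G F FG GF pencil_bounded[OF HX A] 2 that] by blast
  then show inv: "op_invertible Y (pencil Y u v A') \<longleftrightarrow> op_invertible X (pencil X u v A)" for u v
    using S(1) by blast
  have "C' (op_inv Y (pencil Y 1 z A') (B' u)) = C (op_inv X (pencil X 1 z A) (B u))"
    if "op_invertible X (pencil X 1 z A)" "u \<in> carrier U" for z u
    using that S(2)[OF that(1), of "B u"] bounded_ops_simps(1)[OF op_invertibleD(2)[OF that(1)]]
    by (simp add: BB' CC')
  then show "transfer_function Y U A' B' C' D = transfer_function X U A B C D"
    unfolding transfer_function_pencil[OF HX A] transfer_function_pencil[OF HY A'] inv
    by (auto simp: fun_eq_iff)
qed

text \<open>
  Near the origin \<open>\<parallel>(I - z A)\<^sup>-\<^sup>1\<parallel> \<le> 2\<close> wherever this inverse exists, so that the transfer function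
  is bounded there.
\<close>

lemma transfer_function_no_pole:
  assumes "dichotomous_system X U A B C D"
  shows "\<not> has_pole U (transfer_function X U A B C D) 0"
proof
  assume pole: "has_pole U (transfer_function X U A B C D) 0"
  have HX: "complex_hilbert X" and HU: "complex_hilbert U" and A: "A \<in> bounded_ops X X"
    and B: "B \<in> bounded_ops U X" and C: "C \<in> bounded_ops X U" and D: "D \<in> bounded_ops U U"
    using assms by (auto simp: dichotomous_system_def)
  note [simp] = bounded_ops_simps(1)[OF A] bounded_ops_simps(1)[OF B] bounded_ops_simps(1)[OF C]
    bounded_ops_simps(1)[OF D] hilbert_closed[OF HX] hilbert_closed[OF HU]
  obtain KA where KA: "0 < KA" "\<And>x. x \<in> carrier X \<Longrightarrow> hnorm X (A x) \<le> KA * hnorm X x"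
    using bounded_ops_bound[OF A HX] by blast
  obtain KB where KB: "0 < KB" "\<And>u. u \<in> carrier U \<Longrightarrow> hnorm X (B u) \<le> KB * hnorm U u"
    using bounded_ops_bound[OF B HU] by blast
  obtain KC where KC: "0 < KC" "\<And>x. x \<in> carrier X \<Longrightarrow> hnorm U (C x) \<le> KC * hnorm X x"
    using bounded_ops_bound[OF C HX] by blast
  obtain KD where KD: "0 < KD" "\<And>u. u \<in> carrier U \<Longrightarrow> hnorm U (D u) \<le> KD * hnorm U u"
    using bounded_ops_bound[OF D HU] by blast
  define L where "L = KD + KC * (2 * KB)"
  define R where "R = transfer_function X U A B C D"
  have bound: "op_norm U U (the (R z)) \<le> L"
    if z: "z \<in> dom R" "cmod z < 1" "cmod z < 1 / (2 * KA)" for z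
    unfolding op_norm_def
  proof (rule cSUP_least)
    show "{x \<in> carrier U. hnorm U x \<le> 1} \<noteq> {}"
      using hnorm_zero[OF HU] hilbert_closed(1)[OF HU] by (metis (mono_tags, lifting) empty_iff mem_Collect_eq zero_le_one)
    have inv: "op_invertible X (pencil X 1 z A)"
      using z(1) by (auto simp: R_def transfer_function_pencil[OF HX A] split: if_splits)
    note V [simp] = bounded_ops_simps(1)[OF op_invertibleD(2)[OF inv]]
    fix u assume "u \<in> {x \<in> carrier U. hnorm U x \<le> 1}"
    then have u [simp]: "u \<in> carrier U" and u1: "hnorm U u \<le> 1" by auto
    let ?x = "op_inv X (pencil X 1 z A) (B u)"
    have "cmod z * KA \<le> 1 / 2" using z(3) KA(1) by (simp add: field_simps)
    then have "hnorm X ?x \<le> 2 * 1 * hnorm X (B u)"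
      using KA by (intro resolvent_bound_near[OF HX A op_invertible_pencil_zero(1)[OF HX A] inv, of 1 KA])
        (simp_all add: op_invertible_pencil_zero(2)[OF HX A])
    also have "\<dots> \<le> 2 * KB" using KB(2)[OF u] mult_left_mono[OF u1, of KB] KB(1) by linarith
    finally have "KC * hnorm X ?x \<le> KC * (2 * KB)" using KC(1) by (intro mult_left_mono) simp_all
    moreover have "hnorm U (C ?x) \<le> KC * hnorm X ?x" by (rule KC(2)) simp
    moreover have "hnorm U (z \<odot>\<^bsub>U\<^esub> C ?x) \<le> 1 * hnorm U (C ?x)"
      unfolding hnorm_smult[OF HU bounded_ops_simps(1)[OF C V[OF bounded_ops_simps(1)[OF B u]]]]
      using z(2) by (intro mult_right_mono hnorm_nonneg[OF HU]) simp_all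
    moreover have "hnorm U (D u) \<le> KD" using KD(2)[OF u] mult_left_mono[OF u1, of KD] KD(1) by linarith
    moreover have "the (R z) u = D u \<oplus>\<^bsub>U\<^esub> (z \<odot>\<^bsub>U\<^esub> C ?x)"
      using inv by (simp add: R_def transfer_function_pencil[OF HX A])
    ultimately show "hnorm U (the (R z) u) \<le> L"
      using hnorm_add[OF HU, of "D u" "z \<odot>\<^bsub>U\<^esub> C ?x"] by (simp add: L_def)
  qed
  have "\<forall>\<^sub>F z in at 0. z \<in> dom R" "\<forall>\<^sub>F z in at 0. L + 1 \<le> op_norm U U (the (R z))"
    using pole unfolding has_pole_def R_def[symmetric] by (auto simp: filterlim_at_top)
  moreover have "\<forall>\<^sub>F z in at (0::complex). cmod z < min 1 (1 / (2 * KA))"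
    unfolding eventually_at using KA(1) by (intro exI[of _ "min 1 (1 / (2 * KA))"]) auto
  ultimately have "\<forall>\<^sub>F z in at (0::complex). False"
    by eventually_elim (use bound in force)
  then show False by simp
qed

section \<open>From stable representations to dichotomous systems and back\<close>

text \<open>
  The two invertibility conditions match because \<open>I - z \<alpha>\<^sub>-\<^sup>-\<^sup>1 = - (z I - \<alpha>\<^sub>-) \<alpha>\<^sub>-\<^sup>-\<^sup>1\<close>. If
  \<open>q = (z I - \<alpha>\<^sub>-)\<^sup>-\<^sup>1 \<beta>\<^sub>- u\<close>, then \<open>(I - z \<alpha>\<^sub>-\<^sup>-\<^sup>1)\<^sup>-\<^sup>1 \<alpha>\<^sub>-\<^sup>-\<^sup>1 \<beta>\<^sub>- u = - q\<close>, and the \<open>-\<close> part of the transfer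
  function is \<open>\<gamma>\<^sub>- \<alpha>\<^sub>-\<^sup>-\<^sup>1 (z q - \<beta>\<^sub>- u) = \<gamma>\<^sub>- q\<close>.
\<close>

lemma stable_to_dichotomous:
  assumes data: "stable_data U Xp Xm \<delta> \<gamma>p \<alpha>p \<beta>p \<gamma>m \<alpha>m \<beta>m" and inv: "op_invertible Xm \<alpha>m"
  defines "X \<equiv> hilbert_sum Xm Xp" and "A \<equiv> diag_op Xm Xp (op_inv Xm \<alpha>m) \<alpha>p"
    and "B \<equiv> column_op U (\<lambda>u\<in>carrier U. op_inv Xm \<alpha>m (\<beta>m u)) \<beta>p"
    and "C \<equiv> row_op Xm Xp U (\<lambda>x\<in>carrier Xm. \<ominus>\<^bsub>U\<^esub> \<gamma>m (op_inv Xm \<alpha>m x)) \<gamma>p"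
    and "D \<equiv> (\<lambda>u\<in>carrier U. \<delta> u \<ominus>\<^bsub>U\<^esub> \<gamma>m (op_inv Xm \<alpha>m (\<beta>m u)))"
  shows "dichotomous_system X U A B C D"
    and "transfer_function X U A B C D = stable_function U Xp Xm \<delta> \<gamma>p \<alpha>p \<beta>p \<gamma>m \<alpha>m \<beta>m"
proof -
  have HU: "complex_hilbert U" and Hp: "complex_hilbert Xp" and Hm: "complex_hilbert Xm"
    and \<delta>: "\<delta> \<in> bounded_ops U U" and \<gamma>p: "\<gamma>p \<in> bounded_ops Xp U" and \<alpha>p: "\<alpha>p \<in> bounded_ops Xp Xp"
    and \<beta>p: "\<beta>p \<in> bounded_ops U Xp" and \<gamma>m: "\<gamma>m \<in> bounded_ops Xm U" and \<alpha>m: "\<alpha>m \<in> bounded_ops Xm Xm"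
    and \<beta>m: "\<beta>m \<in> bounded_ops U Xm" and stp: "exponentially_stable Xp \<alpha>p" and stm: "exponentially_stable Xm \<alpha>m"
    using data by (auto simp: stable_data_def)
  define V where "V = op_inv Xm \<alpha>m"
  note DV = op_invertibleD[OF inv, folded V_def]
  note HX = hilbert_sum_hilbert[OF Hm Hp, folded X_def]
  note [simp] = hilbert_closed[OF HU] hilbert_closed[OF Hp] hilbert_closed[OF Hm]
    bounded_ops_simps[OF \<delta>] bounded_ops_simps[OF \<gamma>p] bounded_ops_simps[OF \<alpha>p] bounded_ops_simps[OF \<beta>p]
    bounded_ops_simps[OF \<gamma>m] bounded_ops_simps[OF \<alpha>m] bounded_ops_simps[OF \<beta>m] bounded_ops_simps[OF DV(2)] DV(3,4)
    bounded_ops_group[OF \<gamma>m Hm HU] bounded_ops_group[OF \<alpha>m Hm Hm] bounded_ops_group[OF DV(2) Hm Hm]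
  have A: "A \<in> bounded_ops X X" unfolding A_def X_def by (rule diag_op_bounded[OF Hm Hp op_invertibleD(2)[OF inv] \<alpha>p])
  have B: "B \<in> bounded_ops U X"
    unfolding B_def X_def
    by (rule column_op_bounded[OF Hm Hp HU bounded_ops_compose[OF op_invertibleD(2)[OF inv] \<beta>m HU Hm] \<beta>p])
  have \<gamma>V: "(\<lambda>x\<in>carrier Xm. \<gamma>m (V x)) \<in> bounded_ops Xm U" by (rule bounded_ops_compose[OF \<gamma>m DV(2) Hm Hm])
  have "(\<lambda>x\<in>carrier Xm. \<ominus>\<^bsub>U\<^esub> \<gamma>m (V x)) =
      (\<lambda>x\<in>carrier Xm. (0 \<odot>\<^bsub>U\<^esub> (\<lambda>x\<in>carrier Xm. \<gamma>m (V x)) x) \<oplus>\<^bsub>U\<^esub> ((- 1) \<odot>\<^bsub>U\<^esub> (\<lambda>x\<in>carrier Xm. \<gamma>m (V x)) x))"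
    by (rule restrict_ext, rule hilbert_eqI[OF HU]) (simp_all add: cinner_left[OF HU])
  then have "(\<lambda>x\<in>carrier Xm. \<ominus>\<^bsub>U\<^esub> \<gamma>m (V x)) \<in> bounded_ops Xm U"
    using bounded_ops_lincomb[OF \<gamma>V \<gamma>V Hm HU, of 0 "- 1"] by (simp only:)
  then have C: "C \<in> bounded_ops X U"
    unfolding C_def X_def V_def by (intro row_op_bounded[OF Hm Hp HU _ \<gamma>p])
  have V\<beta>: "(\<lambda>u\<in>carrier U. V (\<beta>m u)) \<in> bounded_ops U Xm" by (rule bounded_ops_compose[OF DV(2) \<beta>m HU Hm])
  have \<gamma>V\<beta>: "(\<lambda>u\<in>carrier U. \<gamma>m ((\<lambda>u\<in>carrier U. V (\<beta>m u)) u)) \<in> bounded_ops U U"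
    by (rule bounded_ops_compose[OF \<gamma>m V\<beta> HU Hm])
  have "D = (\<lambda>u\<in>carrier U. (1 \<odot>\<^bsub>U\<^esub> \<delta> u) \<oplus>\<^bsub>U\<^esub> ((- 1) \<odot>\<^bsub>U\<^esub> (\<lambda>u\<in>carrier U. \<gamma>m ((\<lambda>u\<in>carrier U. V (\<beta>m u)) u)) u))"
    unfolding D_def V_def[symmetric]
    by (rule restrict_ext, rule hilbert_eqI[OF HU]) (simp_all add: cinner_left[OF HU])
  then have D: "D \<in> bounded_ops U U"
    using bounded_ops_lincomb[OF \<delta> \<gamma>V\<beta> HU HU, of 1 "- 1"] by (simp only:)
  have inv_A: "op_invertible X (pencil X u v A) \<longleftrightarrow>
      op_invertible Xm (pencil Xm v u \<alpha>m) \<and> op_invertible Xp (pencil Xp u v \<alpha>p)" for u v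
    unfolding X_def A_def op_invertible_pencil_diag[OF Hm Hp op_invertibleD(2)[OF inv] \<alpha>p]
    by (simp add: op_invertible_pencil_op_inv[OF Hm inv])
  have "op_invertible X (pencil X z 1 A)" if z: "cmod z = 1" for z
  proof -
    have z0: "z \<noteq> 0" using z by auto
    have "inverse z \<notin> op_spectrum Xm \<alpha>m" "z \<notin> op_spectrum Xp \<alpha>p"
      using stp stm z by (auto simp: exponentially_stable_def norm_inverse)
    moreover from this(1) have "op_invertible Xm (pencil Xm 1 z \<alpha>m)"
      by (intro op_invertible_pencil_of_spectrum[OF Hm \<alpha>m z0])
    ultimately show ?thesis
      unfolding inv_A by (simp add: op_spectrum_def scalar_minus_op_pencil[OF Hp \<alpha>p])
  qed
  then show "dichotomous_system X U A B C D"
    using HX HU A B C D by (simp add: dichotomous_system_pencil)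
  have eq: "D u \<oplus>\<^bsub>U\<^esub> (z \<odot>\<^bsub>U\<^esub> C (op_inv X (pencil X 1 z A) (B u))) =
      \<delta> u \<oplus>\<^bsub>U\<^esub> (z \<odot>\<^bsub>U\<^esub> \<gamma>p (op_inv Xp (pencil Xp 1 z \<alpha>p) (\<beta>p u)))
        \<oplus>\<^bsub>U\<^esub> \<gamma>m (op_inv Xm (pencil Xm z 1 \<alpha>m) (\<beta>m u))"
    if im: "op_invertible Xm (pencil Xm z 1 \<alpha>m)" and ip: "op_invertible Xp (pencil Xp 1 z \<alpha>p)"
      and u [simp]: "u \<in> carrier U" for z u
  proof -
    note Dm = op_invertibleD[OF im] and Dp = op_invertibleD[OF ip]
    note [simp] = bounded_ops_simps(1)[OF Dm(2)] bounded_ops_simps(1)[OF Dp(2)]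
    let ?q = "op_inv Xm (pencil Xm z 1 \<alpha>m) (\<beta>m u)"
    have iV: "op_invertible Xm (pencil Xm 1 z V)"
      unfolding V_def op_invertible_pencil_op_inv[OF Hm inv] by (rule im)
    have q: "\<beta>m u = pencil Xm z 1 \<alpha>m ?q" by (rule Dm(4)[symmetric]) simp
    have ciq: "cinner U (\<gamma>m (V (\<beta>m u))) w = z * cinner U (\<gamma>m (V ?q)) w - cinner U (\<gamma>m ?q) w"
      if "w \<in> carrier U" for w
      using that by (subst q) (simp add: cinner_left[OF HU])
    have "V (\<beta>m u) = pencil Xm 1 z V (\<ominus>\<^bsub>Xm\<^esub> ?q)"
      by (subst q, rule hilbert_eqI[OF Hm]) (simp_all add: cinner_left[OF Hm])
    then have "op_inv Xm (pencil Xm 1 z V) (V (\<beta>m u)) = \<ominus>\<^bsub>Xm\<^esub> ?q"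
      using op_invertibleD(3)[OF iV, of "\<ominus>\<^bsub>Xm\<^esub> ?q"] by (simp only:) simp
    moreover have "op_inv X (pencil X 1 z A) = diag_op Xm Xp (op_inv Xm (pencil Xm 1 z V)) (op_inv Xp (pencil Xp 1 z \<alpha>p))"
      unfolding X_def A_def V_def[symmetric] pencil_diag[OF Hm Hp DV(2) \<alpha>p]
      by (rule op_invertible_diag(2)[OF Hm Hp iV ip])
    ultimately have "op_inv X (pencil X 1 z A) (B u) = (\<ominus>\<^bsub>Xm\<^esub> ?q, op_inv Xp (pencil Xp 1 z \<alpha>p) (\<beta>p u))"
      by (simp add: B_def diag_op_def column_op_def V_def[symmetric] del: pencil_apply)
    then have "C (op_inv X (pencil X 1 z A) (B u))
        = (\<ominus>\<^bsub>U\<^esub> \<gamma>m (V (\<ominus>\<^bsub>Xm\<^esub> ?q))) \<oplus>\<^bsub>U\<^esub> \<gamma>p (op_inv Xp (pencil Xp 1 z \<alpha>p) (\<beta>p u))"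
      by (simp add: C_def row_op_def V_def[symmetric])
    moreover have "D u = \<delta> u \<ominus>\<^bsub>U\<^esub> \<gamma>m (V (\<beta>m u))" by (simp add: D_def V_def)
    ultimately show ?thesis
      by (intro hilbert_eqI[OF HU]) (simp_all add: cinner_left[OF HU] ciq algebra_simps)
  qed
  show "transfer_function X U A B C D = stable_function U Xp Xm \<delta> \<gamma>p \<alpha>p \<beta>p \<gamma>m \<alpha>m \<beta>m"
    unfolding transfer_function_pencil[OF HX A] stable_function_def inv_A
      id_minus_scaled_pencil[OF Hp \<alpha>p] scalar_minus_op_pencil[OF Hm \<alpha>m]
    by (auto simp: fun_eq_iff eq)
qed

text \<open>
  The given stable data are those to which \<open>stable_to_dichotomous\<close> assigns the block operators
  on the external direct sum of \<open>Sm\<close> and \<open>Sp\<close>. The addition map \<open>F\<close> from this sum onto \<open>X\<close> is a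
  similarity, because the projections \<open>Q\<close> and \<open>Q'\<close> onto \<open>Sp\<close> and \<open>Sm\<close> are bounded.
\<close>

lemma dichotomous_to_stable:
  assumes sys: "dichotomous_system X U A B C D"
    and dec: "direct_sum_decomposition X Sm Sp"
    and blocks: "block_decomposition X U A B C Sm Sp Am Ap Bm Bp Cm Cp"
    and inv: "op_invertible (subspace_of X Sm) Am"
    and stp: "exponentially_stable (subspace_of X Sp) Ap"
    and stm: "exponentially_stable (subspace_of X Sm) (op_inv (subspace_of X Sm) Am)"
  defines "Xp \<equiv> subspace_of X Sp" and "Xm \<equiv> subspace_of X Sm"
    and "\<delta> \<equiv> (\<lambda>u\<in>carrier U. D u \<ominus>\<^bsub>U\<^esub> Cm (op_inv (subspace_of X Sm) Am (Bm u)))"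
    and "\<gamma>m \<equiv> (\<lambda>x\<in>Sm. \<ominus>\<^bsub>U\<^esub> Cm (op_inv (subspace_of X Sm) Am x))"
    and "\<beta>m \<equiv> (\<lambda>u\<in>carrier U. op_inv (subspace_of X Sm) Am (Bm u))"
  shows "stable_data U Xp Xm \<delta> Cp Ap Bp \<gamma>m (op_inv Xm Am) \<beta>m"
    and "transfer_function X U A B C D = stable_function U Xp Xm \<delta> Cp Ap Bp \<gamma>m (op_inv Xm Am) \<beta>m"
proof -
  have HX: "complex_hilbert X" and HU: "complex_hilbert U" and A: "A \<in> bounded_ops X X"
    and B: "B \<in> bounded_ops U X" and C: "C \<in> bounded_ops X U" and D: "D \<in> bounded_ops U U"
    and spec: "op_spectrum X A \<inter> sphere 0 1 = {}"
    using sys by (auto simp: dichotomous_system_def)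
  have Sp: "closed_subspace X Sp" and Sm: "closed_subspace X Sm" and sum: "Sm <+>\<^bsub>X\<^esub> Sp = carrier X"
    using dec by (auto simp: direct_sum_decomposition_def)
  note Dp = closed_subspaceD[OF HX Sp] and Dm = closed_subspaceD[OF HX Sm]
  have cp [simp]: "x \<in> carrier X" if "x \<in> Sp" for x using Dp(1) that by blast
  have cm [simp]: "x \<in> carrier X" if "x \<in> Sm" for x using Dm(1) that by blast
  have Hp: "complex_hilbert Xp" and Hm: "complex_hilbert Xm"
    unfolding Xp_def Xm_def by (rule subspace_of_hilbert[OF HX Sp] subspace_of_hilbert[OF HX Sm])+
  have b: "Am \<in> Sm \<rightarrow>\<^sub>E Sm" "Ap \<in> Sp \<rightarrow>\<^sub>E Sp" "\<And>x. x \<in> Sm \<Longrightarrow> A x = Am x" "\<And>x. x \<in> Sp \<Longrightarrow> A x = Ap x"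
    "Bm \<in> carrier U \<rightarrow>\<^sub>E Sm" "Bp \<in> carrier U \<rightarrow>\<^sub>E Sp" "\<And>u. u \<in> carrier U \<Longrightarrow> B u = Bm u \<oplus>\<^bsub>X\<^esub> Bp u"
    and Cm: "Cm = restrict C Sm" and Cp: "Cp = restrict C Sp"
    using blocks by (auto simp: block_decomposition_def)
  have Am: "Am = restrict A Sm" by (rule ext) (use b(1,3) in \<open>auto simp: PiE_iff extensional_def\<close>)
  have Ap: "Ap = restrict A Sp" by (rule ext) (use b(2,4) in \<open>auto simp: PiE_iff extensional_def\<close>)
  have bc [simp]: "x \<in> Sm \<Longrightarrow> Am x \<in> Sm" "x \<in> Sp \<Longrightarrow> Ap x \<in> Sp"
    "u \<in> carrier U \<Longrightarrow> Bm u \<in> Sm" "u \<in> carrier U \<Longrightarrow> Bp u \<in> Sp" for x u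
    using b by auto
  have ASm: "A x \<in> Sm" if "x \<in> Sm" for x using b(3) that by simp
  have ASp: "A x \<in> Sp" if "x \<in> Sp" for x using b(4) that by simp
  obtain Q where Q: "Q \<in> bounded_ops X X" "\<And>x. x \<in> Sp \<Longrightarrow> Q x = x" "\<And>x. x \<in> Sm \<Longrightarrow> Q x = \<zero>\<^bsub>X\<^esub>"
    using spectral_projection_bounded[OF HX A spec dec ASm ASp inv[unfolded Am] stp[unfolded Ap] stm[unfolded Am]]
    by blast
  note [simp] = hilbert_closed[OF HX] hilbert_closed[OF HU] bounded_ops_simps[OF A] bounded_ops_simps[OF C]
    bounded_ops_simps[OF D] bounded_ops_simps[OF Q(1)] bounded_ops_group[OF C HX HU] bounded_ops_group[OF Q(1) HX HX]
  have Qsum: "Q (x \<oplus>\<^bsub>X\<^esub> y) = y" "(x \<oplus>\<^bsub>X\<^esub> y) \<ominus>\<^bsub>X\<^esub> y = x" if "x \<in> Sm" "y \<in> Sp" for x y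
    by (rule hilbert_eqI[OF HX]; simp add: Q that cinner_left[OF HX])+
  have split: "\<exists>x\<in>Sm. \<exists>y\<in>Sp. z = x \<oplus>\<^bsub>X\<^esub> y" if "z \<in> carrier X" for z
    using that sum unfolding set_add_def' by blast
  have QSp: "Q z \<in> Sp" "z \<ominus>\<^bsub>X\<^esub> Q z \<in> Sm" "(z \<ominus>\<^bsub>X\<^esub> Q z) \<oplus>\<^bsub>X\<^esub> Q z = z" if "z \<in> carrier X" for z
    using split[OF that] Qsum by auto
  have Qp: "Q \<in> bounded_ops X Xp" unfolding Xp_def by (rule bounded_ops_into_subspace[OF Q(1) QSp(1)])
  define Q' where "Q' = (\<lambda>x\<in>carrier X. (1 \<odot>\<^bsub>X\<^esub> (\<lambda>x\<in>carrier X. x) x) \<oplus>\<^bsub>X\<^esub> ((- 1) \<odot>\<^bsub>X\<^esub> Q x))"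
  have Q'_eq: "Q' x = x \<ominus>\<^bsub>X\<^esub> Q x" if "x \<in> carrier X" for x
    by (rule hilbert_eqI[OF HX]) (simp_all add: Q'_def that cinner_left[OF HX])
  have "Q' \<in> bounded_ops X X"
    unfolding Q'_def by (rule bounded_ops_lincomb[OF bounded_ops_id[OF HX] Q(1) HX HX])
  then have Qm: "Q' \<in> bounded_ops X Xm"
    unfolding Xm_def by (rule bounded_ops_into_subspace) (simp add: Q'_eq QSp)
  have QB: "Q (B u) = Bp u" "B u \<ominus>\<^bsub>X\<^esub> Q (B u) = Bm u" "B u \<in> carrier X" if "u \<in> carrier U" for u
  proof -
    have "Bm u \<in> Sm" "Bp u \<in> Sp" using that by simp_all
    note Qsum[OF this] this
    then show "Q (B u) = Bp u" "B u \<ominus>\<^bsub>X\<^esub> Q (B u) = Bm u" "B u \<in> carrier X"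
      by (simp_all only: b(7)[OF that]) simp
  qed
  have "Bp = (\<lambda>u\<in>carrier U. Q (B u))"
    by (rule ext) (use b(6) in \<open>auto simp: PiE_iff extensional_def QB\<close>)
  then have Bp: "Bp \<in> bounded_ops U Xp" using bounded_ops_compose[OF Qp B HU HX] by simp
  have "Bm = (\<lambda>u\<in>carrier U. Q' (B u))"
    by (rule ext) (use b(5) QB(2) in \<open>auto simp: PiE_iff extensional_def Q'_eq QB(1,3)\<close>)
  then have Bm: "Bm \<in> bounded_ops U Xm" using bounded_ops_compose[OF Qm B HU HX] by simp
  have Cm': "Cm \<in> bounded_ops Xm U" unfolding Cm Xm_def by (rule bounded_ops_restrict[OF HX C Sm])
  have Cp': "Cp \<in> bounded_ops Xp U" unfolding Cp Xp_def by (rule bounded_ops_restrict[OF HX C Sp])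
  have Ap': "Ap \<in> bounded_ops Xp Xp" using stp by (simp add: exponentially_stable_def Xp_def)
  define V where "V = op_inv Xm Am"
  note inv' = inv[folded Xm_def]
  note DV = op_invertibleD[OF inv', folded V_def]
  have cX [simp]: "carrier Xm = Sm" "carrier Xp = Sp" "add Xm = add X" "add Xp = add X" "smult Xm = smult X" "smult Xp = smult X"
    by (simp_all add: Xm_def Xp_def)
  have \<beta>m: "\<beta>m \<in> bounded_ops U Xm"
    unfolding \<beta>m_def Xm_def[symmetric] V_def[symmetric] by (rule bounded_ops_compose[OF DV(2) Bm HU Hm])
  have CV: "(\<lambda>x\<in>carrier Xm. Cm (V x)) \<in> bounded_ops Xm U" by (rule bounded_ops_compose[OF Cm' DV(2) Hm Hm])
  have CVc [simp]: "V x \<in> Sm" "Cm x \<in> carrier U" if "x \<in> Sm" for x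
    using bounded_ops_simps(1)[OF DV(2)] bounded_ops_simps(1)[OF Cm'] that by simp_all
  have "\<gamma>m = (\<lambda>x\<in>carrier Xm. (0 \<odot>\<^bsub>U\<^esub> (\<lambda>x\<in>carrier Xm. Cm (V x)) x) \<oplus>\<^bsub>U\<^esub> ((- 1) \<odot>\<^bsub>U\<^esub> (\<lambda>x\<in>carrier Xm. Cm (V x)) x))"
    unfolding \<gamma>m_def Xm_def[symmetric] V_def[symmetric] cX
    by (rule restrict_ext, rule hilbert_eqI[OF HU]) (simp_all add: cinner_left[OF HU])
  then have \<gamma>m: "\<gamma>m \<in> bounded_ops Xm U"
    using bounded_ops_lincomb[OF CV CV Hm HU, of 0 "- 1"] by (simp only:)
  have CVB: "(\<lambda>u\<in>carrier U. (\<lambda>x\<in>carrier Xm. Cm (V x)) (Bm u)) \<in> bounded_ops U U"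
    by (rule bounded_ops_compose[OF CV Bm HU Hm])
  have "\<delta> = (\<lambda>u\<in>carrier U. (1 \<odot>\<^bsub>U\<^esub> D u) \<oplus>\<^bsub>U\<^esub> ((- 1) \<odot>\<^bsub>U\<^esub> (\<lambda>u\<in>carrier U. (\<lambda>x\<in>carrier Xm. Cm (V x)) (Bm u)) u))"
    unfolding \<delta>_def Xm_def[symmetric] V_def[symmetric]
    by (rule restrict_ext, rule hilbert_eqI[OF HU]) (simp_all add: cinner_left[OF HU])
  then have \<delta>: "\<delta> \<in> bounded_ops U U"
    using bounded_ops_lincomb[OF D CVB HU HU, of 1 "- 1"] by (simp only:)
  show data: "stable_data U Xp Xm \<delta> Cp Ap Bp \<gamma>m (op_inv Xm Am) \<beta>m"
    using HU Hp Hm \<delta> Cp' Ap' Bp \<gamma>m op_invertibleD(2)[OF inv'] \<beta>m stp stm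
    by (simp add: stable_data_def Xp_def Xm_def)
  note invV = op_invertible_op_inv[OF inv']
  \<comment> \<open>the block operators recovered from these data are the given ones, by \<open>e1\<close>, \<open>e2\<close> and \<open>e3\<close> below\<close>
  note R = stable_to_dichotomous(2)[OF data invV(1), unfolded invV(2)]
  let ?Y = "hilbert_sum Xm Xp"
  define F where "F = (\<lambda>p\<in>carrier ?Y. fst p \<oplus>\<^bsub>X\<^esub> snd p)"
  have 1: "\<delta> u \<ominus>\<^bsub>U\<^esub> \<gamma>m (Am (\<beta>m u)) = D u" if "u \<in> carrier U" for u
    using that DV(4)[of "Bm u"]
    by (intro hilbert_eqI[OF HU])
      (simp_all add: \<delta>_def \<gamma>m_def \<beta>m_def cinner_left[OF HU] flip: Xm_def V_def)
  have 2: "Am (\<beta>m u) = Bm u" if "u \<in> carrier U" for u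
    using that DV(4)[of "Bm u"] by (simp add: \<beta>m_def flip: Xm_def V_def)
  have 3: "\<ominus>\<^bsub>U\<^esub> \<gamma>m (Am x) = Cm x" if "x \<in> Sm" for x
    using that DV(3)[of x]
    by (intro hilbert_eqI[OF HU]) (simp_all add: \<gamma>m_def cinner_left[OF HU] flip: Xm_def V_def)
  have e1: "(\<lambda>u\<in>carrier U. \<delta> u \<ominus>\<^bsub>U\<^esub> \<gamma>m (Am (\<beta>m u))) = D"
    by (rule ext) (use D in \<open>auto simp: 1 bounded_ops_def PiE_iff extensional_def\<close>)
  have e2: "(\<lambda>u\<in>carrier U. Am (\<beta>m u)) = Bm"
    by (rule ext) (use b(5) in \<open>auto simp: 2 PiE_iff extensional_def\<close>)
  have e3: "(\<lambda>x\<in>carrier Xm. \<ominus>\<^bsub>U\<^esub> \<gamma>m (Am x)) = Cm"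
    by (rule ext) (auto simp: 3 Cm)
  have "transfer_function ?Y U (diag_op Xm Xp Am Ap) (column_op U Bm Bp) (row_op Xm Xp U Cm Cp) D
      = stable_function U Xp Xm \<delta> Cp Ap Bp \<gamma>m (op_inv Xm Am) \<beta>m"
    using R unfolding e1 e2 e3 .
  moreover have "transfer_function X U A B C D
      = transfer_function ?Y U (diag_op Xm Xp Am Ap) (column_op U Bm Bp) (row_op Xm Xp U Cm Cp) D"
  proof (rule transfer_function_similar(2))
    show HY: "complex_hilbert ?Y" by (rule hilbert_sum_hilbert[OF Hm Hp])
    show "complex_hilbert X" "A \<in> bounded_ops X X" by fact+
    show "diag_op Xm Xp Am Ap \<in> bounded_ops ?Y ?Y"
      by (rule diag_op_bounded[OF Hm Hp op_invertibleD(1)[OF inv'] Ap'])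
    show "column_op U Bm Bp \<in> bounded_ops U ?Y" by (rule column_op_bounded[OF Hm Hp HU Bm Bp])
    have n: "hnorm Xm = hnorm X" "hnorm Xp = hnorm X" by (simp_all add: Xm_def Xp_def)
    show "F \<in> bounded_ops ?Y X"
      unfolding F_def
    proof (rule bounded_opsI[OF HY, where K = 2])
      fix p q assume "p \<in> carrier ?Y" "q \<in> carrier ?Y"
      then show "fst (p \<oplus>\<^bsub>?Y\<^esub> q) \<oplus>\<^bsub>X\<^esub> snd (p \<oplus>\<^bsub>?Y\<^esub> q) = (fst p \<oplus>\<^bsub>X\<^esub> snd p) \<oplus>\<^bsub>X\<^esub> (fst q \<oplus>\<^bsub>X\<^esub> snd q)"
        by (intro hilbert_eqI[OF HX]) (auto simp: cinner_left[OF HX])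
    next
      fix a p assume "p \<in> carrier ?Y"
      then show "fst (a \<odot>\<^bsub>?Y\<^esub> p) \<oplus>\<^bsub>X\<^esub> snd (a \<odot>\<^bsub>?Y\<^esub> p) = a \<odot>\<^bsub>X\<^esub> (fst p \<oplus>\<^bsub>X\<^esub> snd p)"
        by (intro hilbert_eqI[OF HX]) (auto simp: cinner_left[OF HX] algebra_simps)
    next
      fix p assume p: "p \<in> carrier ?Y"
      then obtain x y where xy: "p = (x, y)" "x \<in> Sm" "y \<in> Sp" by auto
      then show "hnorm X (fst p \<oplus>\<^bsub>X\<^esub> snd p) \<le> 2 * hnorm ?Y p"
        using hnorm_add[OF HX, of x y] hnorm_le_sum[OF Hm Hp, of x y] by (simp add: n)
    qed auto
    show "column_op X Q' Q \<in> bounded_ops X ?Y" by (rule column_op_bounded[OF Hm Hp HX Qm Qp])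
  qed (auto simp: F_def column_op_def diag_op_def row_op_def Q'_eq Qsum QSp b Cm Cp
      simp del: bounded_ops_simps(2)[OF Q(1)])
  ultimately show "transfer_function X U A B C D = stable_function U Xp Xm \<delta> Cp Ap Bp \<gamma>m (op_inv Xm Am) \<beta>m"
    by simp
qed

lemma dichotomous_system_image:
  assumes sys: "dichotomous_system X U A B C D" and h: "inj_on h (carrier X)"
  obtains A' B' C' where "dichotomous_system (image_hilbert h X) U A' B' C' D"
    "transfer_function (image_hilbert h X) U A' B' C' D = transfer_function X U A B C D"
proof -
  have HX: "complex_hilbert X" and HU: "complex_hilbert U" and A: "A \<in> bounded_ops X X"
    and B: "B \<in> bounded_ops U X" and C: "C \<in> bounded_ops X U" and D: "D \<in> bounded_ops U U"
    and inv: "\<And>z. cmod z = 1 \<Longrightarrow> op_invertible X (pencil X z 1 A)"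
    using sys by (auto simp: dichotomous_system_pencil)
  define Y where "Y = image_hilbert h X"
  have HY: "complex_hilbert Y" unfolding Y_def by (rule image_hilbert_hilbert[OF HX h])
  note [simp] = hilbert_closed[OF HX]
  have c: "carrier Y = h ` carrier X" by (simp add: Y_def image_hilbert_def Let_def)
  note s = image_hilbert_simps[OF h, folded Y_def] image_hilbert_hilbert(2)[OF HX h, folded Y_def]
  define F where "F = (\<lambda>x\<in>carrier X. h x)"
  define G where "G = (\<lambda>y\<in>carrier Y. inv_into (carrier X) h y)"
  have F: "F \<in> bounded_ops X Y"
    unfolding F_def by (rule bounded_opsI[OF HX, where K = 1]) (simp_all add: c s)
  have G: "G \<in> bounded_ops Y X"
    unfolding G_def by (rule bounded_opsI[OF HY, where K = 1]) (auto simp: c s h)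
  have GF: "G (F x) = x" if "x \<in> carrier X" for x using that h by (simp add: F_def G_def c)
  have FG: "F (G y) = y" if "y \<in> carrier Y" for y using that h by (auto simp: F_def G_def c)
  define A' where "A' = (\<lambda>y\<in>carrier Y. F ((\<lambda>y\<in>carrier Y. A (G y)) y))"
  define B' where "B' = (\<lambda>u\<in>carrier U. F (B u))"
  define C' where "C' = (\<lambda>y\<in>carrier Y. C (G y))"
  have A': "A' \<in> bounded_ops Y Y" unfolding A'_def
    by (rule bounded_ops_compose[OF F bounded_ops_compose[OF A G HY HX] HY HX])
  have B': "B' \<in> bounded_ops U Y" unfolding B'_def by (rule bounded_ops_compose[OF F B HU HX])
  have C': "C' \<in> bounded_ops Y U" unfolding C'_def by (rule bounded_ops_compose[OF C G HY HX])
  note Fc = bounded_ops_simps(1)[OF F]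
  have AA': "A' (F x) = F (A x)" and CC': "C' (F x) = C x" if "x \<in> carrier X" for x
    using that Fc[OF that] by (simp_all add: A'_def C'_def GF)
  have BB': "B' u = F (B u)" if "u \<in> carrier U" for u using that by (simp add: B'_def)
  note S = transfer_function_similar[where F = F and A = A and A' = A' and B = B and B' = B' and C = C and C' = C', OF HX HY F G GF FG A A' AA' B BB' CC']
  have "dichotomous_system Y U A' B' C' D"
    using HY HU A' B' C' D inv by (simp add: dichotomous_system_pencil S(1))
  then show ?thesis using that S(2) by (simp add: Y_def)
qed

theorem proposition2p4:
  fixes U :: "'u hilbert" and R :: "complex \<rightharpoonup> ('u \<Rightarrow> 'u)"
  assumes "complex_hilbert U" and "ran R \<subseteq> bounded_ops U U"
  shows
    "((\<exists>(X :: 'x hilbert) A B C D.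
         dichotomous_system X U A B C D \<and> R = transfer_function X U A B C D)
      \<longleftrightarrow>
      (\<exists>(Xp :: 'x hilbert) (Xm :: 'x hilbert) \<delta> \<gamma>p \<alpha>p \<beta>p \<gamma>m \<alpha>m \<beta>m.
         stable_data U Xp Xm \<delta> \<gamma>p \<alpha>p \<beta>p \<gamma>m \<alpha>m \<beta>m \<and> op_invertible Xm \<alpha>m \<and>
         R = stable_function U Xp Xm \<delta> \<gamma>p \<alpha>p \<beta>p \<gamma>m \<alpha>m \<beta>m))
     \<and>
     (\<forall>(Xp :: 'p hilbert) (Xm :: 'm hilbert) \<delta> \<gamma>p \<alpha>p \<beta>p \<gamma>m \<alpha>m \<beta>m.
        stable_data U Xp Xm \<delta> \<gamma>p \<alpha>p \<beta>p \<gamma>m \<alpha>m \<beta>m \<and> op_invertible Xm \<alpha>m \<and>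
        R = stable_function U Xp Xm \<delta> \<gamma>p \<alpha>p \<beta>p \<gamma>m \<alpha>m \<beta>m
        \<longrightarrow>
        (let X = hilbert_sum Xm Xp;
             A = diag_op Xm Xp (op_inv Xm \<alpha>m) \<alpha>p;
             B = column_op U (\<lambda>u\<in>carrier U. op_inv Xm \<alpha>m (\<beta>m u)) \<beta>p;
             C = row_op Xm Xp U (\<lambda>x\<in>carrier Xm. \<ominus>\<^bsub>U\<^esub> \<gamma>m (op_inv Xm \<alpha>m x)) \<gamma>p;
             D = (\<lambda>u\<in>carrier U. \<delta> u \<ominus>\<^bsub>U\<^esub> \<gamma>m (op_inv Xm \<alpha>m (\<beta>m u)))
         in dichotomous_system X U A B C D \<and> R = transfer_function X U A B C D)
        \<and> \<not> has_pole U R 0)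
     \<and>
     (\<forall>(X :: 'x hilbert) A B C D Sm Sp Am Ap Bm Bp Cm Cp.
        dichotomous_system X U A B C D \<and> R = transfer_function X U A B C D \<and>
        direct_sum_decomposition X Sm Sp \<and>
        block_decomposition X U A B C Sm Sp Am Ap Bm Bp Cm Cp \<and>
        op_invertible (subspace_of X Sm) Am \<and>
        exponentially_stable (subspace_of X Sp) Ap \<and>
        exponentially_stable (subspace_of X Sm) (op_inv (subspace_of X Sm) Am)
        \<longrightarrow>
        (let Xp = subspace_of X Sp;
             Xm = subspace_of X Sm;
             \<delta> = (\<lambda>u\<in>carrier U. D u \<ominus>\<^bsub>U\<^esub> Cm (op_inv Xm Am (Bm u)));
             \<gamma>p = Cp;
             \<alpha>p = Ap;
             \<beta>p = Bp;
             \<gamma>m = (\<lambda>x\<in>Sm. \<ominus>\<^bsub>U\<^esub> Cm (op_inv Xm Am x));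
             \<alpha>m = op_inv Xm Am;
             \<beta>m = (\<lambda>u\<in>carrier U. op_inv Xm Am (Bm u))
         in stable_data U Xp Xm \<delta> \<gamma>p \<alpha>p \<beta>p \<gamma>m \<alpha>m \<beta>m \<and>
            R = stable_function U Xp Xm \<delta> \<gamma>p \<alpha>p \<beta>p \<gamma>m \<alpha>m \<beta>m))"
  (is "(?dich \<longleftrightarrow> ?stab) \<and> ?two \<and> ?three")
proof (intro conjI)
  show "?dich \<longleftrightarrow> ?stab"
  proof
    assume ?dich
    then obtain X :: "'x hilbert" and A B C D
      where sys: "dichotomous_system X U A B C D" and R: "R = transfer_function X U A B C D"
      by blast
    have HX: "complex_hilbert X" and A: "A \<in> bounded_ops X X" and B: "B \<in> bounded_ops U X"
      and spec: "op_spectrum X A \<inter> sphere 0 1 = {}"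
      using sys by (auto simp: dichotomous_system_def)
    obtain Sm Sp where dec: "direct_sum_decomposition X Sm Sp"
      and ASm: "\<And>x. x \<in> Sm \<Longrightarrow> A x \<in> Sm" and ASp: "\<And>x. x \<in> Sp \<Longrightarrow> A x \<in> Sp"
      and inv: "op_invertible (subspace_of X Sm) (restrict A Sm)"
      and stp: "exponentially_stable (subspace_of X Sp) (restrict A Sp)"
      and stm: "exponentially_stable (subspace_of X Sm) (op_inv (subspace_of X Sm) (restrict A Sm))"
      using spectral_decomposition[OF HX A spec] by blast
    have "\<exists>xm\<in>Sm. \<exists>xp\<in>Sp. B u = xm \<oplus>\<^bsub>X\<^esub> xp" if "u \<in> carrier U" for u
      using bounded_ops_simps(1)[OF B that] dec unfolding direct_sum_decomposition_def set_add_def' by blast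
    then obtain bm bp where b: "\<And>u. u \<in> carrier U \<Longrightarrow> bm u \<in> Sm" "\<And>u. u \<in> carrier U \<Longrightarrow> bp u \<in> Sp"
      "\<And>u. u \<in> carrier U \<Longrightarrow> B u = bm u \<oplus>\<^bsub>X\<^esub> bp u"
      by metis
    have blocks: "block_decomposition X U A B C Sm Sp (restrict A Sm) (restrict A Sp)
        (restrict bm (carrier U)) (restrict bp (carrier U)) (restrict C Sm) (restrict C Sp)"
      using ASm ASp b by (simp add: block_decomposition_def)
    note S = dichotomous_to_stable[OF sys dec blocks inv stp stm]
    show ?stab
      using S(1) S(2)[folded R] op_invertible_op_inv(1)[OF inv] by blast
  next
    assume ?stab
    then obtain Xp Xm :: "'x hilbert" and \<delta> \<gamma>p \<alpha>p \<beta>p \<gamma>m \<alpha>m \<beta>m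
      where data: "stable_data U Xp Xm \<delta> \<gamma>p \<alpha>p \<beta>p \<gamma>m \<alpha>m \<beta>m" and inv: "op_invertible Xm \<alpha>m"
        and R: "R = stable_function U Xp Xm \<delta> \<gamma>p \<alpha>p \<beta>p \<gamma>m \<alpha>m \<beta>m"
      by blast
    have "complex_hilbert Xm" "complex_hilbert Xp" using data by (auto simp: stable_data_def)
    then obtain h :: "'x \<times> 'x \<Rightarrow> 'x" where h: "inj_on h (carrier (hilbert_sum Xm Xp))"
      using hilbert_sum_embeds by blast
    note S = stable_to_dichotomous[OF data inv]
    show ?dich
      by (rule dichotomous_system_image[OF S(1) h], unfold S(2), fold R) blast
  qed
  show ?two
  proof (intro allI impI, elim conjE)
    fix Xp :: "'p hilbert" and Xm :: "'m hilbert" and \<delta> \<gamma>p \<alpha>p \<beta>p \<gamma>m \<alpha>m \<beta>m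
    assume data: "stable_data U Xp Xm \<delta> \<gamma>p \<alpha>p \<beta>p \<gamma>m \<alpha>m \<beta>m" and inv: "op_invertible Xm \<alpha>m"
      and R: "R = stable_function U Xp Xm \<delta> \<gamma>p \<alpha>p \<beta>p \<gamma>m \<alpha>m \<beta>m"
    note S = stable_to_dichotomous[OF data inv]
    show "(let X = hilbert_sum Xm Xp;
             A = diag_op Xm Xp (op_inv Xm \<alpha>m) \<alpha>p;
             B = column_op U (\<lambda>u\<in>carrier U. op_inv Xm \<alpha>m (\<beta>m u)) \<beta>p;
             C = row_op Xm Xp U (\<lambda>x\<in>carrier Xm. \<ominus>\<^bsub>U\<^esub> \<gamma>m (op_inv Xm \<alpha>m x)) \<gamma>p;
             D = (\<lambda>u\<in>carrier U. \<delta> u \<ominus>\<^bsub>U\<^esub> \<gamma>m (op_inv Xm \<alpha>m (\<beta>m u)))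
         in dichotomous_system X U A B C D \<and> R = transfer_function X U A B C D)
        \<and> \<not> has_pole U R 0"
      using S(1) S(2)[folded R] transfer_function_no_pole[OF S(1)] unfolding Let_def by simp
  qed
  show ?three
    unfolding Let_def
    by (intro allI impI, elim conjE, simp only:) (intro conjI dichotomous_to_stable)
qed

end
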